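(* Let $L>0$ and let $\gamma(s)=(x(s),y(s))$, $s\in[0,L]$, be a smooth, simple, non-closed plane curve parametrized by arc length and symmetric with respect to the $y$-axis, i.e. $x(L-s)=-x(s)$ and $y(L-s)=y(s)$ for $s\in[0,L/2]$. Let $k(s)$ be its signed curvature. Let $\delta>0$ be a constant. Put $$D^F=\{(s,r)\in\mathbb{R}^2: 0<s<L,\ 0<r<\delta\},\qquad D=\{(x(s)+ry'(s),\,y(s)-rx'(s)): (s,r)\in D^F\},$$ and assume that the map $(s,r)\mapsto (x(s)+ry'(s),\,y(s)-rx'(s))$ is one-to-one from $\overline{D^F}$ onto $\overline{D}$. Let $p>1$. If $k(s)$ is concave on $[0,L]$ and $1+rk(s)>0$ on $\overline{D^F}$, then $$\mu_1^{odd}(D)\ge A_p\left(\frac{\pi_p}{L}\right)^p,$$ where $$A_p=\min_{(s,r)\in\overline{D^F}}\frac{1}{(1+rk(s))^p},\qquad \pi_p=2\int_0^{+\infty}\frac{1}{1+\frac{1}{p-1}s^p}\,ds=2\pi\frac{(p-1)^{1/p}}{p\sin(\pi/p)}.$$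
   Context: Signed curvature: $k(s)=x'(s)y''(s)-x''(s)y'(s)$, so that the Jacobian of the map $(s,r)\mapsto(x(s)+ry'(s),y(s)-rx'(s))$ has absolute value $|1+rk(s)|$. For $p>1$ the Neumann $p$-Laplace eigenvalue problem on $D$ is $-\mathrm{div}(|\nabla u|^{p-2}\nabla u)=\mu|u|^{p-2}u$ in $D$, $|\nabla u|^{p-2}\frac{\partial u}{\partial\mathbf{n}}=0$ on $\partial D$ (in the weak sense). $\mu_1^{odd}(D)$ denotes the lowest nonzero eigenvalue of this problem having a corresponding eigenfunction that is odd with respect to the $y$-axis ($u(-x,y)=-u(x,y)$); equivalently, it is the minimum of $\int_D|\nabla v|^p\,dxdy\big/\int_D|v|^p\,dxdy$ over nonzero $v\in W^{1,p}(D)$ odd with respect to the $y$-axis. *)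

theory Defs
  imports "HOL-Analysis.Analysis"
begin

text \<open>Derivatives on the closed interval [0,L] are one-sided at the endpoints, so that
  curvature and normal are defined on all of [0,L].\<close>

definition curve_deriv :: "real \<Rightarrow> (real \<Rightarrow> 'a::real_normed_vector) \<Rightarrow> real \<Rightarrow> 'a" where
  "curve_deriv L f s = vector_derivative f (at s within {0..L})"

definition smooth_curve :: "real \<Rightarrow> (real \<Rightarrow> 'a::real_normed_vector) \<Rightarrow> bool" where
  "smooth_curve L f \<longleftrightarrow>
     (\<forall>n. \<forall>s\<in>{0..L}. (curve_deriv L ^^ n) f differentiable (at s within {0..L}))"

definition arc_length_parametrized :: "real \<Rightarrow> (real \<Rightarrow> real \<times> real) \<Rightarrow> bool" where
  "arc_length_parametrized L \<gamma> \<longleftrightarrow> (\<forall>s\<in>{0..L}. norm (curve_deriv L \<gamma> s) = 1)"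

definition symmetric_curve :: "real \<Rightarrow> (real \<Rightarrow> real \<times> real) \<Rightarrow> bool" where
  "symmetric_curve L \<gamma> \<longleftrightarrow>
     (\<forall>s\<in>{0..L/2}. fst (\<gamma> (L - s)) = - fst (\<gamma> s) \<and> snd (\<gamma> (L - s)) = snd (\<gamma> s))"

definition signed_curvature :: "real \<Rightarrow> (real \<Rightarrow> real \<times> real) \<Rightarrow> real \<Rightarrow> real" where
  "signed_curvature L \<gamma> s =
     (let x = (\<lambda>t. fst (\<gamma> t)); y = (\<lambda>t. snd (\<gamma> t));
          x' = curve_deriv L x; y' = curve_deriv L y
      in x' s * curve_deriv L y' s - curve_deriv L x' s * y' s)"

definition strip_map :: "real \<Rightarrow> (real \<Rightarrow> real \<times> real) \<Rightarrow> real \<times> real \<Rightarrow> real \<times> real" where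
  "strip_map L \<gamma> = (\<lambda>(s, r).
     (fst (\<gamma> s) + r * curve_deriv L (\<lambda>t. snd (\<gamma> t)) s,
      snd (\<gamma> s) - r * curve_deriv L (\<lambda>t. fst (\<gamma> t)) s))"

definition flat_strip :: "real \<Rightarrow> real \<Rightarrow> (real \<times> real) set" where
  "flat_strip L \<delta> = {0<..<L} \<times> {0<..<\<delta>}"

definition curved_strip :: "real \<Rightarrow> real \<Rightarrow> (real \<Rightarrow> real \<times> real) \<Rightarrow> (real \<times> real) set" where
  "curved_strip L \<delta> \<gamma> = strip_map L \<gamma> ` flat_strip L \<delta>"

fun Ck_fun :: "nat \<Rightarrow> ('a::euclidean_space \<Rightarrow> real) \<Rightarrow> bool" where
  "Ck_fun 0 f \<longleftrightarrow> continuous_on UNIV f"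
| "Ck_fun (Suc n) f \<longleftrightarrow> (\<forall>z. f differentiable (at z)) \<and>
     (\<forall>b\<in>Basis. Ck_fun n (\<lambda>z. frechet_derivative f (at z) b))"

definition test_function :: "'a::euclidean_space set \<Rightarrow> ('a \<Rightarrow> real) \<Rightarrow> bool" where
  "test_function D \<phi> \<longleftrightarrow> (\<forall>n. Ck_fun n \<phi>) \<and>
     (\<exists>K. compact K \<and> K \<subseteq> D \<and> (\<forall>z. z \<notin> K \<longrightarrow> \<phi> z = 0))"

definition locally_integrable ::
    "'a::euclidean_space set \<Rightarrow> ('a \<Rightarrow> 'b::euclidean_space) \<Rightarrow> bool" where
  "locally_integrable D f \<longleftrightarrow> (\<forall>K. compact K \<and> K \<subseteq> D \<longrightarrow> f absolutely_integrable_on K)"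

definition weak_gradient ::
    "'a::euclidean_space set \<Rightarrow> ('a \<Rightarrow> real) \<Rightarrow> ('a \<Rightarrow> 'a) \<Rightarrow> bool" where
  "weak_gradient D u g \<longleftrightarrow> locally_integrable D u \<and> locally_integrable D g \<and>
     (\<forall>\<phi>. test_function D \<phi> \<longrightarrow> (\<forall>b\<in>Basis.
        (LINT z|lebesgue_on D. u z * frechet_derivative \<phi> (at z) b)
          = - (LINT z|lebesgue_on D. (g z \<bullet> b) * \<phi> z)))"

definition Lp_fun ::
    "real \<Rightarrow> 'a::euclidean_space set \<Rightarrow> ('a \<Rightarrow> 'b::euclidean_space) \<Rightarrow> bool" where
  "Lp_fun p D f \<longleftrightarrow> f \<in> borel_measurable (lebesgue_on D) \<and>
     integrable (lebesgue_on D) (\<lambda>z. norm (f z) powr p)"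

text \<open>\<open>sobolev p D u g\<close> means that \<open>u\<close> is in W^{1,p}(D) with weak gradient \<open>g\<close>
  (which is unique up to null sets).\<close>

definition sobolev ::
    "real \<Rightarrow> 'a::euclidean_space set \<Rightarrow> ('a \<Rightarrow> real) \<Rightarrow> ('a \<Rightarrow> 'a) \<Rightarrow> bool" where
  "sobolev p D u g \<longleftrightarrow> Lp_fun p D u \<and> Lp_fun p D g \<and> weak_gradient D u g"

definition nonzero_on :: "'a::euclidean_space set \<Rightarrow> ('a \<Rightarrow> real) \<Rightarrow> bool" where
  "nonzero_on D u \<longleftrightarrow> \<not> (AE z in lebesgue_on D. u z = 0)"

definition odd_on :: "(real \<times> real) set \<Rightarrow> (real \<times> real \<Rightarrow> real) \<Rightarrow> bool" where
  "odd_on D u \<longleftrightarrow> (AE z in lebesgue_on D. u (- fst z, snd z) = - u z)"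

text \<open>Weak formulation: the test functions range over all of W^{1,p}(D), which encodes the
  Neumann boundary condition. For \<open>p < 2\<close>, the convention \<open>0 powr a = 0\<close> gives
  |g|^{p-2} g = 0 where g vanishes, and likewise for u, as usual.\<close>

definition neumann_eigenfunction ::
    "real \<Rightarrow> 'a::euclidean_space set \<Rightarrow> real \<Rightarrow> ('a \<Rightarrow> real) \<Rightarrow> bool" where
  "neumann_eigenfunction p D \<mu> u \<longleftrightarrow> nonzero_on D u \<and>
     (\<exists>g. sobolev p D u g \<and>
       (\<forall>\<phi> h. sobolev p D \<phi> h \<longrightarrow>
          (LINT z|lebesgue_on D. norm (g z) powr (p - 2) * (g z \<bullet> h z))
            = \<mu> * (LINT z|lebesgue_on D. \<bar>u z\<bar> powr (p - 2) * u z * \<phi> z)))"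

text \<open>The infimum is taken in the extended reals, so that it is meaningful
  whether or not a minimum is known to exist.\<close>

definition mu1_odd :: "real \<Rightarrow> (real \<times> real) set \<Rightarrow> ereal" where
  "mu1_odd p D =
     Inf {ereal \<mu> |\<mu>. \<mu> \<noteq> 0 \<and> (\<exists>u. neumann_eigenfunction p D \<mu> u \<and> odd_on D u)}"

definition mu1_odd_rayleigh :: "real \<Rightarrow> (real \<times> real) set \<Rightarrow> ereal" where
  "mu1_odd_rayleigh p D =
     Inf {ereal ((LINT z|lebesgue_on D. norm (g z) powr p) / (LINT z|lebesgue_on D. \<bar>v z\<bar> powr p))
       |v g. sobolev p D v g \<and> nonzero_on D v \<and> odd_on D v}"

definition pi_p :: "real \<Rightarrow> real" where
  "pi_p p = 2 * integral {0..} (\<lambda>s. 1 / (1 + 1 / (p - 1) * s powr p))"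

text \<open>The infimum is over a compact set, on which the function is continuous whenever
  \<open>k\<close> is continuous and \<open>1 + r * k s > 0\<close> there, so it is a minimum.\<close>

definition A_const :: "real \<Rightarrow> real \<Rightarrow> real \<Rightarrow> (real \<Rightarrow> real) \<Rightarrow> real" where
  "A_const p L \<delta> k =
     (INF (s, r) \<in> closure (flat_strip L \<delta>). 1 / (1 + r * k s) powr p)"

end

theory Submission
  imports Defs
begin

text \<open>
  In the coordinates \<open>(s, r)\<close> the area element is \<open>w ds dr\<close> with \<open>w = 1 + r k(s)\<close>, and
  \<open>|\<partial>\<^sub>s u| \<le> w |\<nabla>u|\<close>. Hence \<open>|\<nabla>u|\<^sup>p \<ge> A\<^sub>p |\<partial>\<^sub>s u|\<^sup>p\<close>, and it suffices to prove for each \<open>r\<close> the weighted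
  inequality \<open>\<integral> |v'|\<^sup>p w ds \<ge> (\<pi>\<^sub>p / L)\<^sup>p \<integral> |v|\<^sup>p w ds\<close> for odd \<open>v\<close>. Since \<open>k\<close> is concave and even about
  \<open>L / 2\<close>, the weight decreases away from the midpoint, where \<open>v\<close> vanishes. If
  \<open>T' = 1 + \<lambda> T\<^sup>p / (p - 1)\<close> and \<open>T > 0\<close>, then Young's inequality gives
  \<open>(T\<^bsup>1-p\<^esup> |v|\<^sup>p w)' \<le> (|v'|\<^sup>p - \<lambda> |v|\<^sup>p) w\<close>, and integrating over a half interval proves the claim;
  such a \<open>T\<close> exists for \<open>\<lambda> = (\<pi>\<^sub>p / L)\<^sup>p\<close> on every interval of length less than \<open>L / 2\<close>.

  This argument needs a continuously differentiable \<open>u\<close>. A Sobolev function is mollified by a radial kernel,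
  which preserves oddness, on compact parts of the strip. By Jensen's inequality the
  mollification does not increase \<open>\<integral> |\<nabla>u|\<^sup>p\<close>, and along a subsequence it converges to \<open>u\<close> almost
  everywhere, so that Fatou's lemma applies to \<open>\<integral> |u|\<^sup>p\<close>.
\<close>

section \<open>Mollifiers\<close>

text \<open>\<open>T\<close> is modelled on the quotient f / f' for a positive increasing solution f
  of (|f'|^(p-2) f')' + \<lambda> f^(p-1) = 0: division turns this equation into the first-order
  one, and the estimate for T^(1-p) |v|^p is the Picone argument in that form. For \<lambda> = 1 the
  solution starting from 0 blows up at time pi_p / 2, which is how \<open>pi_p\<close> enters;
  rescaling by pi_p / L moves the blow-up to L / 2. One end has T = 0 and the other T infinite, so a
  shortened half interval is used and T is shifted away from 0. The factor A_p is the price for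
  keeping only the tangential part of the gradient: the s-derivative of the coordinate map has
  length w, and A_p is the reciprocal of the largest w^p. The strip has corners and u is not
  extended across its boundary. Hence the left side is restricted to a compact K while the right
  side stays over all of D: on K the mollified gradient sees g only in a small neighbourhood of K
  inside D. Mollification also turns oddness almost everywhere into oddness everywhere, so the
  smooth function vanishes on the axis; this is all that the one-dimensional part uses of
  oddness.\<close>

lemma Ck_fun_imp_continuous: "Ck_fun n f \<Longrightarrow> continuous_on UNIV f"
  by (cases n) (auto simp: continuous_on_eq_continuous_at intro!: differentiable_imp_continuous_within)

lemma Ck_fun_SucD: "Ck_fun (Suc n) f \<Longrightarrow> Ck_fun n f"
  by (induction n arbitrary: f)
    (auto intro!: continuous_at_imp_continuous_on differentiable_imp_continuous_within)

lemma Ck_fun_SucI: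
  assumes "\<And>z. (f has_derivative f' z) (at z)" "\<And>b. b \<in> Basis \<Longrightarrow> Ck_fun n (\<lambda>z. f' z b)"
  shows "Ck_fun (Suc n) f"
proof -
  have "frechet_derivative f (at z) = f' z" for z
    using frechet_derivative_at[OF assms(1)] by simp
  then show ?thesis using assms by (auto simp: differentiable_def)
qed

lemma Ck_fun_SucE:
  assumes "Ck_fun (Suc n) f"
  obtains f' where "\<And>z. (f has_derivative f' z) (at z)"
    "\<And>b. b \<in> Basis \<Longrightarrow> Ck_fun n (\<lambda>z. f' z b)"
  using assms that[of "\<lambda>z. frechet_derivative f (at z)"]
  by (auto simp: frechet_derivative_works)

lemma Ck_fun_const: "Ck_fun n (\<lambda>z. c)"
  by (induction n arbitrary: c) (auto intro: Ck_fun_SucI[where f' = "\<lambda>z h. 0"] simp del: Ck_fun.simps(2))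

lemma Ck_fun_linear: "Ck_fun n (\<lambda>z. z \<bullet> a)"
proof (cases n)
  case (Suc m)
  then show ?thesis
    by (auto intro!: Ck_fun_SucI[where f' = "\<lambda>z h. h \<bullet> a"] Ck_fun_const derivative_eq_intros
        simp del: Ck_fun.simps(2))
qed (auto intro!: continuous_intros)

lemma Ck_fun_add: "Ck_fun n f \<Longrightarrow> Ck_fun n g \<Longrightarrow> Ck_fun n (\<lambda>z. f z + g z)"
proof (induction n arbitrary: f g)
  case (Suc n)
  obtain f' where f: "\<And>z. (f has_derivative f' z) (at z)"
    "\<And>b. b \<in> Basis \<Longrightarrow> Ck_fun n (\<lambda>z. f' z b)" using Ck_fun_SucE[OF Suc.prems(1)] by blast
  obtain g' where g: "\<And>z. (g has_derivative g' z) (at z)"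
    "\<And>b. b \<in> Basis \<Longrightarrow> Ck_fun n (\<lambda>z. g' z b)" using Ck_fun_SucE[OF Suc.prems(2)] by blast
  show ?case
    by (rule Ck_fun_SucI[OF has_derivative_add[OF f(1) g(1)]]) (rule Suc.IH[OF f(2) g(2)])
qed (auto intro: continuous_intros)

lemma Ck_fun_mult: "Ck_fun n f \<Longrightarrow> Ck_fun n g \<Longrightarrow> Ck_fun n (\<lambda>z. f z * g z)"
proof (induction n arbitrary: f g)
  case (Suc n)
  obtain f' where f: "\<And>z. (f has_derivative f' z) (at z)"
    "\<And>b. b \<in> Basis \<Longrightarrow> Ck_fun n (\<lambda>z. f' z b)" using Ck_fun_SucE[OF Suc.prems(1)] by blast
  obtain g' where g: "\<And>z. (g has_derivative g' z) (at z)"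
    "\<And>b. b \<in> Basis \<Longrightarrow> Ck_fun n (\<lambda>z. g' z b)" using Ck_fun_SucE[OF Suc.prems(2)] by blast
  show ?case
    by (rule Ck_fun_SucI[OF has_derivative_mult[OF f(1) g(1)]])
      (intro Ck_fun_add Suc.IH f(2) g(2) Suc.prems[THEN Ck_fun_SucD])
qed (auto intro: continuous_intros)

lemma Ck_fun_sum: "(\<And>i. i \<in> I \<Longrightarrow> Ck_fun n (f i)) \<Longrightarrow> Ck_fun n (\<lambda>z. \<Sum>i\<in>I. f i z)"
  by (induction I rule: infinite_finite_induct) (auto intro: Ck_fun_const Ck_fun_add)

lemma Ck_fun_compose:
  fixes f :: "real \<Rightarrow> real"
  shows "Ck_fun n f \<Longrightarrow> Ck_fun n g \<Longrightarrow> Ck_fun n (\<lambda>z. f (g z))"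
proof (induction n arbitrary: f g)
  case 0
  then show ?case by (auto intro: continuous_on_compose2)
next
  case (Suc n)
  obtain f' where f: "\<And>z. (f has_derivative f' z) (at z)"
    "\<And>b. b \<in> Basis \<Longrightarrow> Ck_fun n (\<lambda>z. f' z b)" using Ck_fun_SucE[OF Suc.prems(1)] by blast
  obtain g' where g: "\<And>z. (g has_derivative g' z) (at z)"
    "\<And>b. b \<in> Basis \<Longrightarrow> Ck_fun n (\<lambda>z. g' z b)" using Ck_fun_SucE[OF Suc.prems(2)] by blast
  \<comment> \<open>On the line a derivative is multiplication by its value at 1, so the chain rule
    becomes a product of functions covered by the induction.\<close>
  have lin: "f' x y = f' x 1 * y" for x y
    using linear_cmul[OF has_derivative_linear[OF f(1)], of x y 1] by simp
  show ?case
  proof (rule Ck_fun_SucI)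
    show "((\<lambda>z. f (g z)) has_derivative (\<lambda>h. f' (g z) (g' z h))) (at z)" for z
      using has_derivative_compose[OF g(1) f(1)] .
    show "Ck_fun n (\<lambda>z. f' (g z) (g' z b))" if "b \<in> Basis" for b
      by (subst lin) (intro Ck_fun_mult g(2) that Suc.IH[OF f(2)] Ck_fun_SucD[OF Suc.prems(2)], simp)
  qed
qed

section \<open>A smooth function that is flat at the origin\<close>

lemma tendsto_poly_exp_at_top: "((\<lambda>x::real. poly P x * exp (- x)) \<longlongrightarrow> 0) at_top"
proof -
  have "((\<lambda>x. \<Sum>i\<le>degree P. coeff P i * (x ^ i / exp x)) \<longlongrightarrow> (\<Sum>i\<le>degree P. coeff P i * 0)) at_top"
    by (intro tendsto_intros tendsto_power_div_exp_0)
  then show ?thesis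
    by (simp add: poly_altdef sum_distrib_right exp_minus field_simps sum_divide_distrib)
qed

text \<open>The functions \<open>P(1/t) exp(-1/t)\<close> form a family closed under differentiation, so all of
  them are smooth.\<close>

definition flat_exp :: "real poly \<Rightarrow> real \<Rightarrow> real" where
  "flat_exp P t = (if t > 0 then poly P (inverse t) * exp (- inverse t) else 0)"

text \<open>With q = 1/t the chain rule contributes the factor q^2, and differentiating P(q) exp(-q)
  with respect to 1/t gives P' - P up to sign; this is the polynomial
  \<open>[:0,0,1:] * (P - pderiv P)\<close>. Away from 0 this is a computation on an open half-line;
  at 0 the exponential beats every polynomial.\<close>

lemma flat_exp_has_derivative:
  "(flat_exp P has_real_derivative flat_exp ([:0,0,1:] * (P - pderiv P)) t) (at t)"
proof (cases t "0::real" rule: linorder_cases)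
  case less
  have "((\<lambda>x. 0) has_real_derivative flat_exp ([:0,0,1:] * (P - pderiv P)) t) (at t)"
    using less by (simp add: flat_exp_def)
  then show ?thesis
    by (rule has_field_derivative_transform_within_open[where S = "{..<0}"])
      (use less in \<open>auto simp: flat_exp_def\<close>)
next
  case greater
  have "((\<lambda>t. poly P (inverse t) * exp (- inverse t)) has_real_derivative
     flat_exp ([:0,0,1:] * (P - pderiv P)) t) (at t)"
  proof -
    have inv: "(inverse has_real_derivative - (inverse t * inverse t)) (at t)"
      using greater DERIV_inverse[of t] by (simp add: power2_eq_square)
    have "((\<lambda>t. poly P (inverse t) * exp (- inverse t)) has_real_derivative
        (poly (pderiv P) (inverse t) * - (inverse t * inverse t)) * exp (- inverse t)
        + (exp (- inverse t) * - (- (inverse t * inverse t))) * poly P (inverse t)) (at t)"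
      by (intro DERIV_mult DERIV_chain2[OF poly_DERIV inv] DERIV_chain2[OF DERIV_exp DERIV_minus[OF inv]])
    moreover have "(poly (pderiv P) (inverse t) * - (inverse t * inverse t)) * exp (- inverse t)
        + (exp (- inverse t) * - (- (inverse t * inverse t))) * poly P (inverse t)
      = flat_exp ([:0,0,1:] * (P - pderiv P)) t"
      using greater by (simp add: flat_exp_def algebra_simps)
    ultimately show ?thesis by simp
  qed
  then show ?thesis
    by (rule has_field_derivative_transform_within_open[where S = "{0<..}"])
      (use greater in \<open>auto simp: flat_exp_def\<close>)
next
  case equal
  \<comment> \<open>\<open>pCons 0 P\<close> is x P(x): the extra factor 1/h of the difference
    quotient at 0 is absorbed into the polynomial.\<close>
  have "((\<lambda>x. poly (pCons 0 P) x * exp (- x)) \<longlongrightarrow> 0) at_top"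
    by (rule tendsto_poly_exp_at_top)
  then have "((\<lambda>h. poly (pCons 0 P) (inverse h) * exp (- inverse h)) \<longlongrightarrow> 0) (at_right 0)"
    by (rule filterlim_compose) (rule filterlim_inverse_at_top_right)
  then have R: "((\<lambda>h. (flat_exp P (0 + h) - flat_exp P 0) / h) \<longlongrightarrow> 0) (at_right 0)"
    by (rule Lim_transform_eventually)
      (auto simp: eventually_at_filter flat_exp_def field_simps)
  have L: "((\<lambda>h. (flat_exp P (0 + h) - flat_exp P 0) / h) \<longlongrightarrow> 0) (at_left 0)"
    by (rule Lim_transform_eventually[OF tendsto_const])
      (auto simp: eventually_at_filter flat_exp_def)
  have "flat_exp ([:0,0,1:] * (P - pderiv P)) 0 = 0" by (simp add: flat_exp_def)
  then show ?thesis using filterlim_split_at[OF L R] equal by (simp add: DERIV_def)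
qed

lemma Ck_fun_flat_exp: "Ck_fun n (flat_exp P)"
proof (induction n arbitrary: P)
  case 0
  then show ?case
    using flat_exp_has_derivative by (auto intro!: continuous_at_imp_continuous_on DERIV_isCont)
next
  case (Suc n)
  show ?case
  proof (rule Ck_fun_SucI[OF flat_exp_has_derivative[unfolded has_field_derivative_def]])
    fix b :: real assume "b \<in> Basis"
    then have "b = 1" by simp
    then show "Ck_fun n (\<lambda>z. flat_exp ([:0,0,1:] * (P - pderiv P)) z * b)"
      by (simp only: mult_1_right Suc.IH)
  qed
qed

text \<open>Radial symmetry does two jobs: it makes the kernel symmetric in its two arguments
  (\<open>mollifier_swap\<close>) and invariant under linear isometries
  (\<open>convolve_odd\<close>). The scale is recorded only through the support, so kernels at
  different scales need not be dilates of one another.\<close>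

definition mollifier :: "real \<Rightarrow> ('a::euclidean_space \<Rightarrow> real) \<Rightarrow> bool" where
  "mollifier e \<rho> \<longleftrightarrow> (\<forall>n. Ck_fun n \<rho>) \<and> (\<forall>z. 0 \<le> \<rho> z) \<and> (\<forall>z. e \<le> norm z \<longrightarrow> \<rho> z = 0)
     \<and> (\<forall>z z'. norm z = norm z' \<longrightarrow> \<rho> z = \<rho> z') \<and> integrable lborel \<rho> \<and> (LINT z|lborel. \<rho> z) = 1"

lemma mollifier_exists:
  assumes "e > 0"
  shows "\<exists>\<rho>::'a::euclidean_space \<Rightarrow> real. mollifier e \<rho>"
proof -
  \<comment> \<open>The squared norm is spelled out in coordinates so that the closure rules for
    sums, products and linear functionals apply.\<close>
  define h :: "'a \<Rightarrow> real" where "h z = flat_exp 1 (e\<^sup>2 + (- 1) * (\<Sum>b\<in>Basis. (z \<bullet> b) * (z \<bullet> b)))" for z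
  have Ck: "Ck_fun n h" for n
    unfolding h_def
    by (intro Ck_fun_compose[OF Ck_fun_flat_exp] Ck_fun_add Ck_fun_const Ck_fun_mult Ck_fun_sum Ck_fun_linear)
  have h: "h z = flat_exp 1 (e\<^sup>2 - (norm z)\<^sup>2)" for z
    unfolding h_def by (simp add: euclidean_inner[symmetric] dot_square_norm)
  have nn: "h z \<ge> 0" for z by (simp add: h flat_exp_def)
  have supp: "h z = 0" if "e \<le> norm z" for z
  proof -
    have "e\<^sup>2 \<le> (norm z)\<^sup>2" using that assms by (intro power_mono) auto
    then show ?thesis unfolding h flat_exp_def by simp
  qed
  have pos: "h z > 0" if "z \<in> ball 0 e" for z
    using that assms by (simp add: h flat_exp_def power_strict_mono)
  have "integrable lborel (\<lambda>x. indicator (cball 0 e) x *\<^sub>R h x)"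
    by (rule borel_integrable_compact)
      (auto intro: continuous_on_subset[OF Ck_fun_imp_continuous[OF Ck[of 0]]])
  also have "(\<lambda>x. indicator (cball 0 e) x *\<^sub>R h x) = h"
    using supp by (auto simp: indicator_def fun_eq_iff)
  finally have int: "integrable lborel h" .
  have "(LINT z|lborel. h z) \<noteq> 0"
  proof
    assume "(LINT z|lborel. h z) = 0"
    then have "AE z in lborel. h z = 0"
      using integral_nonneg_eq_0_iff_AE[OF int] nn by auto
    then have "AE z::'a in lborel. z \<notin> ball 0 e" by eventually_elim (use pos in force)
    then have "ball (0::'a) e \<in> null_sets lborel" by (simp add: AE_iff_null_sets)
    then have "negligible (ball (0::'a) e)"
      by (simp add: negligible_iff_null_sets null_sets_completionI)
    then show False using assms open_not_negligible[of "ball (0::'a) e"] by auto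
  qed
  then have I: "(LINT z|lborel. h z) > 0" (is "?I > 0")
    using nn by (simp add: order_less_le integral_nonneg)
  have "mollifier e (\<lambda>z. h z * (1 / ?I))"
    unfolding mollifier_def
  proof (intro conjI allI impI)
    show "h z * (1 / ?I) = h z' * (1 / ?I)" if "norm z = norm z'" for z z'
      using that by (simp add: h)
    show "Ck_fun n (\<lambda>z. h z * (1 / ?I))" for n
      by (intro Ck_fun_mult Ck Ck_fun_const)
  qed (use I nn supp int in auto)
  then show ?thesis by blast
qed

lemma mollifierD:
  assumes "mollifier e \<rho>"
  shows "Ck_fun n \<rho>" "0 \<le> \<rho> z" "e \<le> norm z \<Longrightarrow> \<rho> z = 0" "norm z = norm z' \<Longrightarrow> \<rho> z = \<rho> z'"
    "integrable lborel \<rho>" "(LINT z|lborel. \<rho> z) = 1"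
  using assms unfolding mollifier_def by blast+

lemma mollifier_continuous: "mollifier e \<rho> \<Longrightarrow> continuous_on S \<rho>"
  using Ck_fun_imp_continuous[OF mollifierD(1)[of e \<rho> 0]] continuous_on_subset by blast

lemma mollifier_measurable: "mollifier e \<rho> \<Longrightarrow> \<rho> \<in> borel_measurable borel"
  by (rule borel_measurable_continuous_onI) (rule mollifier_continuous)

lemma mollifier_swap: "mollifier e \<rho> \<Longrightarrow> \<rho> (x - y) = \<rho> (y - x)"
  by (rule mollifierD(4)) (auto simp: norm_minus_commute)

section \<open>Kernels and convolutions: basic estimates\<close>

lemma lborel_integral_reflect_shift:
  fixes f :: "'a::euclidean_space \<Rightarrow> 'b::{banach, second_countable_topology}"
  assumes [measurable]: "f \<in> borel_measurable borel"
  shows "(LINT x|lborel. f (a - x)) = (LINT x|lborel. f x)"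
    and "integrable lborel (\<lambda>x. f (a - x)) \<longleftrightarrow> integrable lborel f"
proof -
  have *: "lborel = distr lborel borel (\<lambda>x. a - x)"
    using lborel_affine[of "-1" a] by (simp add: density_1)
  show "(LINT x|lborel. f (a - x)) = (LINT x|lborel. f x)"
    by (subst (2) *) (simp add: integral_distr)
  show "integrable lborel (\<lambda>x. f (a - x)) \<longleftrightarrow> integrable lborel f"
    by (subst (2) *) (simp add: integrable_distr_eq)
qed

lemma mollifier_shift:
  assumes "mollifier e \<rho>"
  shows "integrable lborel (\<lambda>y. \<rho> (x - y))" "(LINT y|lborel. \<rho> (x - y)) = 1"
  using lborel_integral_reflect_shift[OF mollifier_measurable[OF assms], of x] mollifierD(5,6)[OF assms]
  by auto

lemma mollifier_nn_integral:
  assumes "mollifier e \<rho>"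
  shows "(\<integral>\<^sup>+y. ennreal (\<rho> (x - y)) \<partial>lborel) = 1"
  using mollifier_shift[OF assms] mollifierD(2)[OF assms] by (subst nn_integral_eq_integral) auto

lemma vanishing_outside_ball_bounded:
  fixes f :: "'a::euclidean_space \<Rightarrow> real"
  assumes "continuous_on UNIV f" "\<And>z. e \<le> norm z \<Longrightarrow> f z = 0"
  obtains M where "M > 0" "\<And>z. \<bar>f z\<bar> \<le> M"
proof -
  have "compact (f ` cball 0 e)"
    by (intro compact_continuous_image continuous_on_subset[OF assms(1)]) auto
  then obtain M where M: "M > 0" "\<And>z. z \<in> cball 0 e \<Longrightarrow> norm (f z) \<le> M"
    using bounded_pos compact_imp_bounded by (metis imageI)
  have "\<bar>f z\<bar> \<le> M" for z
    using M(2)[of z] assms(2)[of z] M(1) by (cases "norm z \<le> e") auto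
  with M(1) show thesis by (rule that)
qed

lemma mollifier_bounded:
  assumes "mollifier e \<rho>"
  obtains M where "M > 0" "\<And>z. \<bar>\<rho> z\<bar> \<le> M"
  using vanishing_outside_ball_bounded[OF mollifier_continuous[OF assms] mollifierD(3)[OF assms]] by blast

text \<open>\<open>U\<close> may be vector-valued, so that a function and its weak gradient are
  smoothed by the same operator.\<close>

definition convolve :: "('a::euclidean_space \<Rightarrow> real) \<Rightarrow> ('a \<Rightarrow> 'b::euclidean_space) \<Rightarrow> 'a \<Rightarrow> 'b" where
  "convolve \<rho> U x = (LINT y|lborel. \<rho> (x - y) *\<^sub>R U y)"

lemma integrable_bounded_scaleR:
  fixes U :: "'a::euclidean_space \<Rightarrow> 'b::euclidean_space"
  assumes "integrable lborel U" "f \<in> borel_measurable borel" "\<And>z. \<bar>f z\<bar> \<le> M"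
  shows "integrable lborel (\<lambda>y. f y *\<^sub>R U y)"
proof (rule Bochner_Integration.integrable_bound)
  show "integrable lborel (\<lambda>y. M *\<^sub>R U y)" using assms(1) by simp
  have "U \<in> borel_measurable borel" using assms(1) by simp
  then show "(\<lambda>y. f y *\<^sub>R U y) \<in> borel_measurable lborel" using assms(2) by simp
  show "AE y in lborel. norm (f y *\<^sub>R U y) \<le> norm (M *\<^sub>R U y)"
  proof (intro AE_I2)
    fix y show "norm (f y *\<^sub>R U y) \<le> norm (M *\<^sub>R U y)"
      using mult_right_mono[OF assms(3)[of y], of "norm (U y)"] assms(3)[of y] by auto
  qed
qed

lemma convolve_integrable:
  fixes U :: "'a::euclidean_space \<Rightarrow> 'b::euclidean_space"
  assumes "mollifier e \<rho>" "integrable lborel U"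
  shows "integrable lborel (\<lambda>y. \<rho> (x - y) *\<^sub>R U y)"
proof -
  obtain M where M: "M > 0" "\<And>z. \<bar>\<rho> z\<bar> \<le> M" using mollifier_bounded[OF assms(1)] by blast
  show ?thesis
    using M mollifier_measurable[OF assms(1)]
    by (intro integrable_bounded_scaleR[OF assms(2), where M = M]) auto
qed

lemma convolve_measurable:
  fixes U :: "'a::euclidean_space \<Rightarrow> 'b::euclidean_space"
  assumes "mollifier e \<rho>" "U \<in> borel_measurable borel"
  shows "convolve \<rho> U \<in> borel_measurable borel"
proof -
  note [measurable] = assms(2) mollifier_measurable[OF assms(1)]
  show ?thesis unfolding convolve_def by measurable
qed

text \<open>Tonelli: integrated first in \<open>x\<close>, the kernel has mass one.\<close>

lemma convolve_nn_integral:
  assumes "mollifier e \<rho>" and [measurable]: "U \<in> borel_measurable borel"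
  shows "(\<integral>\<^sup>+x. (\<integral>\<^sup>+y. ennreal (\<rho> (x - y)) * U y \<partial>lborel) \<partial>lborel) = (\<integral>\<^sup>+y. U y \<partial>lborel)"
proof -
  note [measurable] = mollifier_measurable[OF assms(1)]
  have "(\<integral>\<^sup>+x. (\<integral>\<^sup>+y. ennreal (\<rho> (x - y)) * U y \<partial>lborel) \<partial>lborel)
    = (\<integral>\<^sup>+y. (\<integral>\<^sup>+x. ennreal (\<rho> (x - y)) * U y \<partial>lborel) \<partial>lborel)"
    by (rule lborel_pair.Fubini') measurable
  also have "\<dots> = (\<integral>\<^sup>+y. (\<integral>\<^sup>+x. ennreal (\<rho> (x - y)) \<partial>lborel) * U y \<partial>lborel)"
    by (subst nn_integral_multc) simp_all
  also have "\<dots> = (\<integral>\<^sup>+y. U y \<partial>lborel)"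
    by (subst mollifier_swap[OF assms(1)], subst mollifier_nn_integral[OF assms(1)]) simp
  finally show ?thesis .
qed

lemma convolve_norm_le:
  fixes U :: "'a::euclidean_space \<Rightarrow> 'b::euclidean_space"
  assumes "mollifier e \<rho>" "integrable lborel U"
  shows "norm (convolve \<rho> U x) \<le> (LINT y|lborel. \<rho> (x - y) * norm (U y))"
proof -
  have "norm (convolve \<rho> U x) \<le> (LINT y|lborel. norm (\<rho> (x - y) *\<^sub>R U y))"
    unfolding convolve_def by (rule integral_norm_bound)
  then show ?thesis using mollifierD(2)[OF assms(1)] by simp
qed

lemma convolve_L1_le:
  fixes U :: "'a::euclidean_space \<Rightarrow> 'b::euclidean_space"
  assumes "mollifier e \<rho>" "integrable lborel U"
  shows "(\<integral>\<^sup>+x. norm (convolve \<rho> U x) \<partial>lborel) \<le> (\<integral>\<^sup>+x. norm (U x) \<partial>lborel)"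
proof -
  have [measurable]: "U \<in> borel_measurable borel" using assms(2) by simp
  note [measurable] = mollifier_measurable[OF assms(1)]
  have "ennreal (norm (convolve \<rho> U x)) \<le> (\<integral>\<^sup>+y. ennreal (\<rho> (x - y)) * norm (U y) \<partial>lborel)" for x
  proof -
    have "ennreal (norm (convolve \<rho> U x)) \<le> (LINT y|lborel. \<rho> (x - y) * norm (U y))"
      using convolve_norm_le[OF assms, of x] by (simp add: ennreal_leI)
    also have "\<dots> = (\<integral>\<^sup>+y. ennreal (\<rho> (x - y) * norm (U y)) \<partial>lborel)"
      using convolve_integrable[OF assms(1) integrable_norm[OF assms(2)], of x] mollifierD(2)[OF assms(1)]
      by (subst nn_integral_eq_integral) auto
    also have "\<dots> = (\<integral>\<^sup>+y. ennreal (\<rho> (x - y)) * norm (U y) \<partial>lborel)"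
      by (simp add: ennreal_mult mollifierD(2)[OF assms(1)])
    finally show ?thesis .
  qed
  then have "(\<integral>\<^sup>+x. norm (convolve \<rho> U x) \<partial>lborel) \<le> (\<integral>\<^sup>+x. (\<integral>\<^sup>+y. ennreal (\<rho> (x - y)) * norm (U y) \<partial>lborel) \<partial>lborel)"
    by (intro nn_integral_mono)
  also have "\<dots> = (\<integral>\<^sup>+x. norm (U x) \<partial>lborel)"
    by (rule convolve_nn_integral[OF assms(1)]) simp
  finally show ?thesis .
qed

text \<open>Young's inequality for \<open>h * a powr (p - 1)\<close> with conjugate exponents
  \<open>p\<close> and \<open>q\<close>. This tangent-line form of convexity serves twice: as the
  source of Jensen's inequality for convolutions and as the pointwise step of the one-dimensional
  inequality.\<close>

lemma powr_tangent_le: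
  fixes a h :: real
  assumes "p > 1" "a \<ge> 0" "h \<ge> 0"
  shows "a powr p + p * a powr (p - 1) * (h - a) \<le> h powr p"
proof -
  define q where "q = p / (p - 1)"
  have q: "q > 1" "1 / p + 1 / q = 1" "(p - 1) * q = p" "p / q = p - 1"
    using assms(1) by (auto simp: q_def field_simps)
  have "a powr p = a powr (p - 1) * a"
    using powr_add[of a "p - 1" 1] assms(2) by (cases "a = 0") auto
  moreover have "h * a powr (p - 1) \<le> h powr p / p + (a powr (p - 1)) powr q / q"
    by (rule Youngs_inequality) (use assms q in auto)
  then have "p * (h * a powr (p - 1)) \<le> p * (h powr p / p + a powr p / q)"
    using assms(1) by (intro mult_left_mono) (auto simp: powr_powr q)
  then have "p * (h * a powr (p - 1)) \<le> h powr p + p / q * a powr p"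
    using assms(1) by (simp add: distrib_left)
  ultimately show ?thesis using q(4) by (simp add: algebra_simps)
qed

text \<open>Jensen's inequality for the probability density \<open>\<rho> (x - y)\<close>: use the
  tangent at the mean \<open>a\<close> of \<open>norm (U y)\<close>; its linear term integrates to
  zero.\<close>

lemma convolve_powr_le:
  fixes U :: "'a::euclidean_space \<Rightarrow> 'b::euclidean_space"
  assumes "mollifier e \<rho>" "integrable lborel U" "integrable lborel (\<lambda>x. norm (U x) powr p)" "p > 1"
  shows "norm (convolve \<rho> U x) powr p \<le> (LINT y|lborel. \<rho> (x - y) * norm (U y) powr p)"
proof -
  define a where "a = (LINT y|lborel. \<rho> (x - y) * norm (U y))"
  have le: "norm (convolve \<rho> U x) \<le> a" unfolding a_def by (rule convolve_norm_le[OF assms(1,2)])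
  note nn = mollifierD(2)[OF assms(1)]
  note i1 = convolve_integrable[OF assms(1) integrable_norm[OF assms(2)], of x, simplified]
  note i2 = convolve_integrable[OF assms(1) assms(3), of x, simplified]
  note i3 = mollifier_shift[OF assms(1), of x]
  show ?thesis
  proof (cases "a > 0")
    case False
    then have "norm (convolve \<rho> U x) = 0" using le norm_ge_zero[of "convolve \<rho> U x"] by linarith
    then show ?thesis using nn by (simp add: integral_nonneg)
  next
    case True
    have "norm (convolve \<rho> U x) powr p \<le> a powr p"
      using le assms(4) by (intro powr_mono2) auto
    also have "\<dots> = (LINT y|lborel. (a powr p - p * a powr (p - 1) * a) * \<rho> (x - y)
        + p * a powr (p - 1) * (\<rho> (x - y) * norm (U y)))"
      using i1 i3 by (simp add: a_def[symmetric] integral_add)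
    also have "\<dots> \<le> (LINT y|lborel. \<rho> (x - y) * norm (U y) powr p)"
    proof (rule integral_mono)
      fix y
      have "\<rho> (x - y) * (a powr p + p * a powr (p - 1) * (norm (U y) - a)) \<le> \<rho> (x - y) * norm (U y) powr p"
        by (intro mult_left_mono powr_tangent_le nn) (use assms True in auto)
      then show "(a powr p - p * a powr (p - 1) * a) * \<rho> (x - y)
        + p * a powr (p - 1) * (\<rho> (x - y) * norm (U y)) \<le> \<rho> (x - y) * norm (U y) powr p"
        by (simp add: algebra_simps)
    qed (use i1 i2 i3 in \<open>auto intro!: integrable_add\<close>)
    finally show ?thesis .
  qed
qed

lemma convolve_nn_integral_powr_le:
  fixes U :: "'a::euclidean_space \<Rightarrow> 'b::euclidean_space"
  assumes "mollifier e \<rho>" "integrable lborel U" "integrable lborel (\<lambda>x. norm (U x) powr p)" "p > 1"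
  shows "(\<integral>\<^sup>+x. norm (convolve \<rho> U x) powr p \<partial>lborel) \<le> (LINT x|lborel. norm (U x) powr p)"
proof -
  have [measurable]: "U \<in> borel_measurable borel" using assms(2) by simp
  note [measurable] = mollifier_measurable[OF assms(1)]
  have "ennreal (norm (convolve \<rho> U x) powr p) \<le> (\<integral>\<^sup>+y. ennreal (\<rho> (x - y)) * norm (U y) powr p \<partial>lborel)" for x
  proof -
    have "ennreal (norm (convolve \<rho> U x) powr p) \<le> (LINT y|lborel. \<rho> (x - y) * norm (U y) powr p)"
      using convolve_powr_le[OF assms, of x] by (simp add: ennreal_leI)
    also have "\<dots> = (\<integral>\<^sup>+y. ennreal (\<rho> (x - y) * norm (U y) powr p) \<partial>lborel)"
      using convolve_integrable[OF assms(1,3), of x] mollifierD(2)[OF assms(1)]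
      by (subst nn_integral_eq_integral) auto
    also have "\<dots> = (\<integral>\<^sup>+y. ennreal (\<rho> (x - y)) * norm (U y) powr p \<partial>lborel)"
      by (simp add: ennreal_mult mollifierD(2)[OF assms(1)])
    finally show ?thesis .
  qed
  then have "(\<integral>\<^sup>+x. norm (convolve \<rho> U x) powr p \<partial>lborel)
     \<le> (\<integral>\<^sup>+x. (\<integral>\<^sup>+y. ennreal (\<rho> (x - y)) * norm (U y) powr p \<partial>lborel) \<partial>lborel)"
    by (intro nn_integral_mono)
  also have "\<dots> = (\<integral>\<^sup>+x. norm (U x) powr p \<partial>lborel)"
    by (rule convolve_nn_integral[OF assms(1)]) simp
  also have "\<dots> = (LINT x|lborel. norm (U x) powr p)"
    using assms(3) by (subst nn_integral_eq_integral) auto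
  finally show ?thesis .
qed

text \<open>The bound uniform in \<open>z\<close> comes from compact support; it supplies the
  dominating function when differentiating under the integral.\<close>

lemma mollifier_derivative:
  fixes \<rho> :: "'a::euclidean_space \<Rightarrow> real"
  assumes "mollifier e \<rho>"
  obtains \<rho>' M where "\<And>z. (\<rho> has_derivative \<rho>' z) (at z)" "\<And>h. continuous_on UNIV (\<lambda>z. \<rho>' z h)"
    "M > 0" "\<And>z h. \<bar>\<rho>' z h\<bar> \<le> M * norm h"
proof -
  obtain \<rho>' where \<rho>': "\<And>z. (\<rho> has_derivative \<rho>' z) (at z)"
    "\<And>b. b \<in> Basis \<Longrightarrow> Ck_fun 0 (\<lambda>z. \<rho>' z b)"
    using Ck_fun_SucE[OF mollifierD(1)[OF assms, of "Suc 0"]] by blast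
  have expand: "\<rho>' z h = (\<Sum>b\<in>Basis. (h \<bullet> b) * \<rho>' z b)" for z h
  proof -
    have lin: "linear (\<rho>' z)" using \<rho>'(1) by (rule has_derivative_linear)
    have "\<rho>' z h = \<rho>' z (\<Sum>b\<in>Basis. (h \<bullet> b) *\<^sub>R b)" by (simp add: euclidean_representation)
    then show ?thesis by (simp only: linear_sum[OF lin] linear_cmul[OF lin] real_scaleR_def)
  qed
  \<comment> \<open>The margin 1 keeps \<open>z\<close> off the sphere of radius \<open>e\<close>:
    beyond it, \<open>\<rho>\<close> vanishes on a whole neighbourhood of \<open>z\<close>.\<close>
  have zero: "\<rho>' z b = 0" if "e + 1 \<le> norm z" for z b
  proof -
    have "(\<rho> has_derivative (\<lambda>h. 0)) (at z)"
    proof (rule has_derivative_transform_within_open[of "\<lambda>z. 0" "\<lambda>h. 0" z UNIV "- cball 0 e"])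
      show "0 = \<rho> x" if "x \<in> - cball 0 e" for x
        using that mollifierD(3)[OF assms, of x] by simp
    qed (use that in auto)
    then have "\<rho>' z = (\<lambda>h. 0)" using \<rho>'(1) has_derivative_unique by blast
    then show ?thesis by simp
  qed
  have "\<exists>M>0. \<forall>z. \<bar>\<rho>' z b\<bar> \<le> M" if "b \<in> Basis" for b
  proof -
    have "continuous_on UNIV (\<lambda>z. \<rho>' z b)" using \<rho>'(2)[OF that] by simp
    from vanishing_outside_ball_bounded[OF this zero] show ?thesis by metis
  qed
  then obtain Mb where Mb: "\<And>b. b \<in> Basis \<Longrightarrow> Mb b > 0" "\<And>b z. b \<in> Basis \<Longrightarrow> \<bar>\<rho>' z b\<bar> \<le> Mb b"
    by metis
  have "\<bar>\<rho>' z h\<bar> \<le> sum Mb Basis * norm h" for z h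
  proof -
    have "\<bar>\<rho>' z h\<bar> \<le> (\<Sum>b\<in>Basis. \<bar>(h \<bullet> b) * \<rho>' z b\<bar>)" unfolding expand[of z h] by (rule sum_abs)
    also have "\<dots> \<le> (\<Sum>b\<in>Basis. norm h * Mb b)"
      unfolding abs_mult by (intro sum_mono mult_mono Mb Basis_le_norm) auto
    finally show ?thesis by (simp add: sum_distrib_left mult.commute)
  qed
  moreover have "sum Mb Basis > 0" using Mb(1) by (intro sum_pos) auto
  moreover have "continuous_on UNIV (\<lambda>z. \<rho>' z h)" for h
    using \<rho>'(2) by (subst expand) (auto intro!: continuous_intros)
  ultimately show thesis using that \<rho>'(1) by blast
qed

text \<open>Dominated convergence along sequences of increments. The remainder quotient
  \<open>F\<close> is at most 2M, one M from the Lipschitz bound for \<open>\<rho>\<close> and one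
  from the bound on its derivative, so \<open>U\<close> only has to be integrable.\<close>

lemma convolve_has_derivative:
  fixes U :: "'a::euclidean_space \<Rightarrow> real"
  assumes "mollifier e \<rho>" "\<And>z. (\<rho> has_derivative \<rho>' z) (at z)" and U: "integrable lborel U"
  shows "(convolve \<rho> U has_derivative (\<lambda>h. LINT y|lborel. \<rho>' (x - y) h * U y)) (at x)"
proof -
  obtain \<rho>2 M where \<rho>2: "\<And>z. (\<rho> has_derivative \<rho>2 z) (at z)" "\<And>h. continuous_on UNIV (\<lambda>z. \<rho>2 z h)"
    and M: "M > 0" "\<And>z h. \<bar>\<rho>2 z h\<bar> \<le> M * norm h"
    using mollifier_derivative[OF assms(1)] by blast
  \<comment> \<open>Uniqueness of derivatives transfers continuity and the bound to the derivative
    named in the statement.\<close>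
  have "\<rho>2 = \<rho>'" using \<rho>2(1) assms(2) has_derivative_unique by blast
  then have cont: "\<And>h. continuous_on UNIV (\<lambda>z. \<rho>' z h)" and bound: "\<And>z h. \<bar>\<rho>' z h\<bar> \<le> M * norm h"
    using \<rho>2 M by auto
  have [measurable]: "U \<in> borel_measurable borel" using U by simp
  note [measurable] = mollifier_measurable[OF assms(1)]
  have [measurable]: "(\<lambda>z. \<rho>' z h) \<in> borel_measurable borel" for h
    using cont by (rule borel_measurable_continuous_onI)
  have int': "integrable lborel (\<lambda>y. \<rho>' (x - y) h * U y)" for h
    using integrable_bounded_scaleR[OF U, of "\<lambda>y. \<rho>' (x - y) h" "M * norm h"] bound by simp
  have int: "integrable lborel (\<lambda>y. \<rho> (x - y) * U y)" for x
    using convolve_integrable[OF assms(1) U] by simp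
  have lin: "linear (\<rho>' z)" for z using assms(2) by (rule has_derivative_linear)
  have lip: "\<bar>\<rho> z' - \<rho> z\<bar> \<le> M * norm (z' - z)" for z z'
  proof -
    have "norm (\<rho> z' - \<rho> z) \<le> M * norm (z' - z)"
    proof (rule differentiable_bound[of UNIV \<rho> \<rho>'])
      show "onorm (\<rho>' x) \<le> M" for x
        by (rule onorm_le) (use bound in simp)
    qed (use assms(2) in auto)
    then show ?thesis by simp
  qed
  have "linear (\<lambda>h. LINT y|lborel. \<rho>' (x - y) h * U y)"
    by (intro linearI)
      (simp_all add: linear_add[OF lin] linear_cmul[OF lin] distrib_right int' mult.assoc)
  then have bl: "bounded_linear (\<lambda>h. LINT y|lborel. \<rho>' (x - y) h * U y)"
    by (simp add: linear_conv_bounded_linear)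
  show ?thesis
    unfolding has_derivative_at tendsto_at_iff_sequentially comp_def
  proof (intro conjI bl allI impI)
    fix X :: "nat \<Rightarrow> 'a" assume X0: "\<forall>i. X i \<in> UNIV - {0}" and X: "X \<longlonglongrightarrow> 0"
    then have nz: "X i \<noteq> 0" for i by auto
    define F where "F i y = (\<rho> (x + X i - y) - \<rho> (x - y) - \<rho>' (x - y) (X i)) / norm (X i)" for i y
    have F: "(convolve \<rho> U (x + X i) - convolve \<rho> U x - (LINT y|lborel. \<rho>' (x - y) (X i) * U y)) / norm (X i)
      = (LINT y|lborel. F i y * U y)" for i
    proof -
      have "(LINT y|lborel. F i y * U y) = (LINT y|lborel. (\<rho> (x + X i - y) * U y - \<rho> (x - y) * U y - \<rho>' (x - y) (X i) * U y) / norm (X i))"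
        by (rule Bochner_Integration.integral_cong) (auto simp: F_def algebra_simps diff_divide_distrib)
      then show ?thesis unfolding convolve_def using int int' by simp
    qed
    have Fb: "\<bar>F i y\<bar> \<le> 2 * M" for i y
    proof -
      have "\<bar>\<rho> (x + X i - y) - \<rho> (x - y) - \<rho>' (x - y) (X i)\<bar> \<le> M * norm (X i) + M * norm (X i)"
        using lip[of "x + X i - y" "x - y"] bound[of "x - y" "X i"] by simp
      then show ?thesis using nz[of i] by (simp add: F_def divide_le_eq)
    qed
    have Flim: "(\<lambda>i. F i y) \<longlonglongrightarrow> 0" for y
    proof -
      have "(\<lambda>h. norm (\<rho> (x - y + h) - \<rho> (x - y) - \<rho>' (x - y) h) / norm h) \<midarrow>0\<rightarrow> 0"
        using assms(2)[of "x - y"] unfolding has_derivative_at by blast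
      then have "(\<lambda>i. norm (\<rho> (x - y + X i) - \<rho> (x - y) - \<rho>' (x - y) (X i)) / norm (X i)) \<longlonglongrightarrow> 0"
        using X0 X unfolding tendsto_at_iff_sequentially comp_def by blast
      then have "(\<lambda>i. norm (F i y)) \<longlonglongrightarrow> 0" unfolding F_def by (simp add: algebra_simps)
      then show ?thesis by (simp add: tendsto_rabs_zero_iff)
    qed
    have "(\<lambda>i. LINT y|lborel. F i y * U y) \<longlonglongrightarrow> (LINT y|lborel. 0 * U y)"
    proof (rule integral_dominated_convergence[where w = "\<lambda>y. 2 * M * \<bar>U y\<bar>"])
      show "AE y in lborel. (\<lambda>i. F i y * U y) \<longlonglongrightarrow> 0 * U y"
        by (intro AE_I2 tendsto_mult Flim tendsto_const)
      show "AE y in lborel. norm (F i y * U y) \<le> 2 * M * \<bar>U y\<bar>" for i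
        using Fb by (intro AE_I2) (simp add: abs_mult mult_right_mono)
    qed (use U in \<open>auto simp: F_def\<close>)
    then have "(\<lambda>i. norm (LINT y|lborel. F i y * U y)) \<longlonglongrightarrow> 0"
      by (simp add: tendsto_rabs_zero_iff)
    then show "(\<lambda>i. norm (convolve \<rho> U (x + X i) - convolve \<rho> U x - (LINT y|lborel. \<rho>' (x - y) (X i) * U y)) / norm (X i)) \<longlonglongrightarrow> 0"
      by (subst (asm) F[symmetric]) simp
  qed
qed

lemma convolve_continuous:
  fixes U :: "'a::euclidean_space \<Rightarrow> 'b::euclidean_space"
  assumes "mollifier e \<rho>" "integrable lborel U"
  shows "continuous_on S (convolve \<rho> U)"
proof -
  obtain \<rho>' where d: "\<And>z. (\<rho> has_derivative \<rho>' z) (at z)"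
    using mollifier_derivative[OF assms(1)] by metis
  have "continuous_on S (\<lambda>x. convolve \<rho> U x \<bullet> b)" for b
  proof -
    have "(\<lambda>x. convolve \<rho> U x \<bullet> b) = convolve \<rho> (\<lambda>y. U y \<bullet> b)"
      using integral_inner_left[OF convolve_integrable[OF assms]]
      by (auto simp: convolve_def fun_eq_iff)
    moreover have "continuous (at x within S) (convolve \<rho> (\<lambda>y. U y \<bullet> b))" for x
      using convolve_has_derivative[OF assms(1) d integrable_inner_left[OF assms(2)]]
      by (meson continuous_at_imp_continuous_at_within has_derivative_continuous)
    ultimately show ?thesis by (simp add: continuous_on_eq_continuous_within)
  qed
  then show ?thesis by (subst continuous_on_componentwise) auto
qed

text \<open>Two dominated limits. Clipping the values and cutting off the domain at level
  \<open>m\<close> costs little for large \<open>m\<close>; then \<open>U\<close> is replaced by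
  continuous functions converging to it almost everywhere, which after the same clipping and cutting
  are dominated by a multiple of the indicator of a ball.\<close>

lemma integrable_approx_continuous:
  fixes U :: "'a::euclidean_space \<Rightarrow> real"
  assumes U: "integrable lborel U" and "\<epsilon> > 0"
  obtains f R where "continuous_on UNIV f" "\<And>x. R \<le> norm x \<Longrightarrow> f x = 0" "R > 0" "integrable lborel f"
    "(LINT x|lborel. \<bar>U x - f x\<bar>) < \<epsilon>"
proof -
  have [measurable]: "U \<in> borel_measurable borel" using U by simp
  define clip where "clip m x = max (- real m) (min (real m) x)" for m :: nat and x
  define cut where "cut m x = max 0 (min 1 (real m + 1 - norm x))" for m :: nat and x :: 'a
  have cut: "0 \<le> cut m x" "cut m x \<le> 1" "real m + 1 \<le> norm x \<Longrightarrow> cut m x = 0" for m x by (auto simp: cut_def)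
  have clip: "\<bar>clip m x\<bar> \<le> real m" for m x by (auto simp: clip_def)
  have ccut: "continuous_on UNIV (cut m)" for m unfolding cut_def by (intro continuous_intros)
  have cclip: "continuous_on UNIV (clip m)" for m unfolding clip_def by (intro continuous_intros)
  have [measurable]: "cut m \<in> borel_measurable borel" "clip m \<in> borel_measurable borel" for m
    using ccut cclip by (auto intro: borel_measurable_continuous_onI)
  have "(\<lambda>m. LINT x|lborel. \<bar>U x - clip m (U x) * cut m x\<bar>) \<longlonglongrightarrow> (LINT x::'a|lborel. 0)"
  proof (rule integral_dominated_convergence[where w = "\<lambda>x. \<bar>U x\<bar>"])
    show "AE x in lborel. (\<lambda>m. \<bar>U x - clip m (U x) * cut m x\<bar>) \<longlonglongrightarrow> 0"
    proof (intro AE_I2 tendsto_eventually)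
      fix x
      show "\<forall>\<^sub>F m in sequentially. \<bar>U x - clip m (U x) * cut m x\<bar> = 0"
        using eventually_ge_at_top[of "nat \<lceil>norm x\<rceil>"] eventually_ge_at_top[of "nat \<lceil>\<bar>U x\<bar>\<rceil>"]
      proof eventually_elim
        case (elim m)
        then have "norm x \<le> m" "\<bar>U x\<bar> \<le> m" by linarith+
        then show ?case by (auto simp: clip_def cut_def)
      qed
    qed
    show "AE x in lborel. norm \<bar>U x - clip m (U x) * cut m x\<bar> \<le> \<bar>U x\<bar>" for m
    proof (intro AE_I2)
      fix x
      \<comment> \<open>Clipping multiplies by a factor in [0,1], and so does the cutoff; hence the
        error is a fraction of \<open>\<bar>U x\<bar>\<close>, which dominates.\<close>
      have "\<exists>c. clip m (U x) = c * U x \<and> 0 \<le> c \<and> c \<le> 1"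
        using clip[of m "U x"]
        by (intro exI[of _ "if U x = 0 then 0 else clip m (U x) / U x"])
          (auto simp: clip_def divide_simps min_def max_def)
      then obtain c where c: "clip m (U x) = c * U x" "0 \<le> c" "c \<le> 1" by blast
      have "U x - clip m (U x) * cut m x = (1 - c * cut m x) * U x" by (simp add: c algebra_simps)
      moreover have "0 \<le> c * cut m x" "c * cut m x \<le> 1" using c cut[of m x] by (auto intro: mult_le_one)
      ultimately show "norm \<bar>U x - clip m (U x) * cut m x\<bar> \<le> \<bar>U x\<bar>"
        by (simp add: abs_mult mult_left_le_one_le)
    qed
  qed (use U in auto)
  then have "\<forall>\<^sub>F m in sequentially. (LINT x|lborel. \<bar>U x - clip m (U x) * cut m x\<bar>) < \<epsilon> / 2"
    using \<open>\<epsilon> > 0\<close> by (intro order_tendstoD(2)[where y = 0]) auto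
  then obtain m where m: "(LINT x|lborel. \<bar>U x - clip m (U x) * cut m x\<bar>) < \<epsilon> / 2"
    using eventually_happens'[OF sequentially_bot] by blast
  \<comment> \<open>This notion of measurability is by definition almost everywhere approximation by
    continuous functions.\<close>
  have "U measurable_on UNIV"
    by (subst measurable_on_iff_borel_measurable) (auto simp: lebesgue_on_UNIV_eq measurable_completion)
  then obtain N g where N: "negligible N" and g: "\<And>n. continuous_on UNIV (g n)"
    "\<And>x. x \<notin> N \<Longrightarrow> (\<lambda>n. g n x) \<longlonglongrightarrow> U x"
    unfolding measurable_on_def by auto
  have [measurable]: "g n \<in> borel_measurable borel" for n
    using g(1) by (rule borel_measurable_continuous_onI)
  have aeN: "AE x in lborel. x \<notin> N"
    using AE_not_in[of N lebesgue] N by (simp add: negligible_iff_null_sets AE_completion_iff)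
  have cf: "continuous_on UNIV (\<lambda>x. clip m (g n x) * cut m x)" for n
    by (intro continuous_intros ccut continuous_on_compose2[OF cclip g(1)]) auto
  have intb: "integrable lborel (\<lambda>x::'a. c * indicator (cball 0 (real m + 1)) x :: real)" for c
    by (intro integrable_mult_right integrable_real_indicator emeasure_bounded_finite) auto
  have bnd: "\<bar>clip m y * cut m x\<bar> \<le> real m * indicator (cball 0 (real m + 1)) x" for x y
  proof (cases "real m + 1 \<le> norm x")
    case True then show ?thesis using cut(3)[OF True] by (auto simp: indicator_def)
  next
    case False
    then show ?thesis using mult_mono[OF clip[of m y] cut(2)[of m x]] cut[of m x] by (simp add: abs_mult)
  qed
  have intf: "integrable lborel (\<lambda>x. clip m (g n x) * cut m x)" "integrable lborel (\<lambda>x. clip m (U x) * cut m x)" for n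
    using bnd by (auto intro!: Bochner_Integration.integrable_bound[OF intb[of "real m"]] simp: abs_mult)
  have "(\<lambda>n. LINT x|lborel. \<bar>clip m (U x) * cut m x - clip m (g n x) * cut m x\<bar>) \<longlonglongrightarrow> (LINT x::'a|lborel. 0)"
  proof (rule integral_dominated_convergence[where w = "\<lambda>x. 2 * real m * indicator (cball 0 (real m + 1)) x"])
    show "AE x in lborel. (\<lambda>n. \<bar>clip m (U x) * cut m x - clip m (g n x) * cut m x\<bar>) \<longlonglongrightarrow> 0"
      using aeN
    proof eventually_elim
      case (elim x)
      have "(\<lambda>n. clip m (g n x)) \<longlonglongrightarrow> clip m (U x)"
        using cclip[of m] g(2)[OF elim] by (metis continuous_on_tendsto_compose UNIV_I eventually_sequentiallyI)
      then have "(\<lambda>n. \<bar>clip m (U x) * cut m x - clip m (g n x) * cut m x\<bar>) \<longlonglongrightarrow> \<bar>clip m (U x) * cut m x - clip m (U x) * cut m x\<bar>"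
        by (intro tendsto_intros)
      then show ?case by simp
    qed
    show "AE x in lborel. norm \<bar>clip m (U x) * cut m x - clip m (g n x) * cut m x\<bar> \<le> 2 * real m * indicator (cball 0 (real m + 1)) x" for n
    proof (intro AE_I2)
      fix x show "norm \<bar>clip m (U x) * cut m x - clip m (g n x) * cut m x\<bar> \<le> 2 * real m * indicator (cball 0 (real m + 1)) x"
        using bnd[of "U x" x] bnd[of "g n x" x] by (simp add: abs_le_iff)
    qed
  qed (use intb[of "2 * real m"] in auto)
  then have "\<forall>\<^sub>F n in sequentially. (LINT x|lborel. \<bar>clip m (U x) * cut m x - clip m (g n x) * cut m x\<bar>) < \<epsilon> / 2"
    using \<open>\<epsilon> > 0\<close> by (intro order_tendstoD(2)[where y = 0]) auto
  then obtain n where n: "(LINT x|lborel. \<bar>clip m (U x) * cut m x - clip m (g n x) * cut m x\<bar>) < \<epsilon> / 2"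
    using eventually_happens'[OF sequentially_bot] by blast
  have "(LINT x|lborel. \<bar>U x - clip m (g n x) * cut m x\<bar>)
    \<le> (LINT x|lborel. \<bar>U x - clip m (U x) * cut m x\<bar> + \<bar>clip m (U x) * cut m x - clip m (g n x) * cut m x\<bar>)"
    using U intf by (intro integral_mono) auto
  also have "\<dots> = (LINT x|lborel. \<bar>U x - clip m (U x) * cut m x\<bar>) + (LINT x|lborel. \<bar>clip m (U x) * cut m x - clip m (g n x) * cut m x\<bar>)"
    using U intf by (intro Bochner_Integration.integral_add) auto
  also have "\<dots> < \<epsilon>" using m n by simp
  finally show thesis
    by (intro that[of "\<lambda>x. clip m (g n x) * cut m x" "real m + 1"] cf intf(1)) (auto simp: cut(3))
qed

lemma convolve_compact_support_L1:
  fixes f :: "'a::euclidean_space \<Rightarrow> real"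
  assumes f: "continuous_on UNIV f" "\<And>x. R \<le> norm x \<Longrightarrow> f x = 0" "R > 0" "integrable lborel f" and "\<epsilon> > 0"
  obtains d where "d > 0" "\<And>e \<rho>. e < d \<Longrightarrow> mollifier e \<rho> \<Longrightarrow>
    (\<integral>\<^sup>+x. \<bar>convolve \<rho> f x - f x\<bar> \<partial>lborel) \<le> ennreal \<epsilon>"
proof -
  define V where "V = measure lborel (cball (0::'a) (R + 1))"
  \<comment> \<open>With \<open>V + 1\<close> in place of \<open>V\<close>, positivity follows from
    \<open>V \<ge> 0\<close> alone, and \<open>\<epsilon>' * V \<le> \<epsilon>\<close> still
    holds.\<close>
  define \<epsilon>' where "\<epsilon>' = \<epsilon> / (V + 1)"
  have V: "V \<ge> 0" "emeasure lborel (cball (0::'a) (R + 1)) = ennreal V"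
    unfolding V_def using emeasure_bounded_finite[of "cball (0::'a) (R + 1)"]
    by (auto intro!: emeasure_eq_ennreal_measure)
  have \<epsilon>': "\<epsilon>' > 0" "\<epsilon>' * V \<le> \<epsilon>" using \<open>\<epsilon> > 0\<close> V by (auto simp: \<epsilon>'_def field_simps)
  \<comment> \<open>Kernels have radius below 1. If one of two points at distance less than 1 lies
    outside the ball of radius \<open>R + 2\<close>, both lie outside the ball of radius
    \<open>R\<close>, where \<open>f\<close> vanishes; for the same reason the error is supported in
    the ball of radius \<open>R + 1\<close>.\<close>
  have "uniformly_continuous_on (cball 0 (R + 2)) f"
    by (intro compact_uniformly_continuous continuous_on_subset[OF f(1)]) auto
  then obtain d where d: "d > 0"
    "\<And>x y. x \<in> cball 0 (R + 2) \<Longrightarrow> y \<in> cball 0 (R + 2) \<Longrightarrow> dist y x < d \<Longrightarrow> dist (f y) (f x) < \<epsilon>'"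
    using \<epsilon>' unfolding uniformly_continuous_on_def by metis
  show thesis
  proof (rule that[of "min d 1"])
    show "min d 1 > 0" using d by simp
    fix e \<rho> assume e: "e < min d 1" and \<rho>: "mollifier e (\<rho> :: 'a \<Rightarrow> real)"
    note [measurable] = mollifier_measurable[OF \<rho>]
    have close: "\<bar>f y - f x\<bar> \<le> \<epsilon>'" if "norm (x - y) < e" for x y
    proof (cases "x \<in> cball 0 (R + 2) \<and> y \<in> cball 0 (R + 2)")
      case True
      then show ?thesis using d(2)[of x y] that e by (simp add: dist_norm norm_minus_commute less_imp_le)
    next
      case False
      then have "R \<le> norm x" "R \<le> norm y"
        using that e norm_triangle_ineq2[of x y] norm_triangle_ineq2[of y x] by (auto simp: norm_minus_commute)
      then show ?thesis using f(2) \<epsilon>' by simp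
    qed
    have "\<bar>convolve \<rho> f x - f x\<bar> \<le> \<epsilon>' * indicator (cball 0 (R + 1)) x" for x
    proof -
      have i: "integrable lborel (\<lambda>y. \<rho> (x - y) * f y)" "integrable lborel (\<lambda>y. \<rho> (x - y))"
        using convolve_integrable[OF \<rho> f(4)] mollifier_shift[OF \<rho>] by auto
      have "convolve \<rho> f x - f x = (LINT y|lborel. \<rho> (x - y) * f y) - (LINT y|lborel. \<rho> (x - y) * f x)"
        using mollifier_shift[OF \<rho>] by (simp add: convolve_def)
      also have "\<dots> = (LINT y|lborel. \<rho> (x - y) * f y - \<rho> (x - y) * f x)"
        using i by (subst Bochner_Integration.integral_diff) auto
      also have "\<dots> = (LINT y|lborel. \<rho> (x - y) * (f y - f x))" by (simp add: right_diff_distrib)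
      finally have "\<bar>convolve \<rho> f x - f x\<bar> \<le> (LINT y|lborel. \<bar>\<rho> (x - y) * (f y - f x)\<bar>)"
        by simp
      also have "\<dots> \<le> (LINT y|lborel. \<epsilon>' * indicator (cball 0 (R + 1)) x * \<rho> (x - y))"
      proof (rule integral_mono)
        show "integrable lborel (\<lambda>y. \<bar>\<rho> (x - y) * (f y - f x)\<bar>)"
          using i by (auto simp: right_diff_distrib)
        show "integrable lborel (\<lambda>y. \<epsilon>' * indicator (cball 0 (R + 1)) x * \<rho> (x - y))"
          using i by simp
        fix y
        show "\<bar>\<rho> (x - y) * (f y - f x)\<bar> \<le> \<epsilon>' * indicator (cball 0 (R + 1)) x * \<rho> (x - y)"
        proof (cases "norm (x - y) < e")
          case False
          then show ?thesis using mollifierD(3)[OF \<rho>] by simp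
        next
          case True
          show ?thesis
          proof (cases "x \<in> cball 0 (R + 1)")
            case True
            then show ?thesis using close[OF \<open>norm (x - y) < e\<close>] mollifierD(2)[OF \<rho>, of "x - y"]
              by (simp add: abs_mult mult.commute[of \<epsilon>'] mult_left_mono)
          next
            case False
            then have "R \<le> norm x" "R \<le> norm y"
              using True e norm_triangle_ineq2[of x y] by auto
            then show ?thesis
              using f(2) by (simp add: mollifierD(2)[OF \<rho>] less_imp_le[OF \<epsilon>'(1)])
          qed
        qed
      qed
      also have "\<dots> = \<epsilon>' * indicator (cball 0 (R + 1)) x" using mollifier_shift[OF \<rho>] by simp
      finally show ?thesis .
    qed
    then have "ennreal \<bar>convolve \<rho> f x - f x\<bar> \<le> ennreal (\<epsilon>' * indicator (cball 0 (R + 1)) x)" for x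
      by (rule ennreal_leI)
    then have "(\<integral>\<^sup>+x. \<bar>convolve \<rho> f x - f x\<bar> \<partial>lborel)
      \<le> (\<integral>\<^sup>+x. ennreal \<epsilon>' * indicator (cball (0::'a) (R + 1)) x \<partial>lborel)"
      using \<epsilon>'(1) by (intro nn_integral_mono) (simp add: ennreal_mult ennreal_indicator)
    also have "\<dots> = ennreal (\<epsilon>' * V)" using V \<epsilon>' by (simp add: nn_integral_cmult_indicator ennreal_mult)
    also have "\<dots> \<le> ennreal \<epsilon>" using \<epsilon>' by (simp add: ennreal_leI)
    finally show "(\<integral>\<^sup>+x. \<bar>convolve \<rho> f x - f x\<bar> \<partial>lborel) \<le> ennreal \<epsilon>" .
  qed
qed

text \<open>A three-term split through a continuous \<open>f\<close>: convolution is an L1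
  contraction, so exchanging \<open>U\<close> for \<open>f\<close> inside it costs at most
  \<epsilon> / 3 whatever the kernel.\<close>

lemma convolve_L1_approx:
  fixes U :: "'a::euclidean_space \<Rightarrow> real"
  assumes U: "integrable lborel U" and "\<epsilon> > 0"
  obtains d where "d > 0" "\<And>e \<rho>. e < d \<Longrightarrow> mollifier e \<rho> \<Longrightarrow>
    (\<integral>\<^sup>+x. \<bar>convolve \<rho> U x - U x\<bar> \<partial>lborel) \<le> ennreal \<epsilon>"
proof -
  obtain f R where f: "continuous_on UNIV f" "\<And>x. R \<le> norm x \<Longrightarrow> f x = 0" "R > 0" "integrable lborel f"
    "(LINT x|lborel. \<bar>U x - f x\<bar>) < \<epsilon> / 3"
    using integrable_approx_continuous[OF U, of "\<epsilon> / 3"] \<open>\<epsilon> > 0\<close> by auto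
  obtain d where d: "d > 0" "\<And>e \<rho>. e < d \<Longrightarrow> mollifier e \<rho> \<Longrightarrow>
    (\<integral>\<^sup>+x. \<bar>convolve \<rho> f x - f x\<bar> \<partial>lborel) \<le> ennreal (\<epsilon> / 3)"
    using convolve_compact_support_L1[OF f(1-4), of "\<epsilon> / 3"] \<open>\<epsilon> > 0\<close> by auto
  have Uf: "(\<integral>\<^sup>+x. \<bar>U x - f x\<bar> \<partial>lborel) \<le> ennreal (\<epsilon> / 3)"
    using f(4,5) U by (subst nn_integral_eq_integral) (auto intro!: ennreal_leI)
  have [measurable]: "U \<in> borel_measurable borel" "f \<in> borel_measurable borel" using U f(4) by auto
  show thesis
  proof (rule that[OF d(1)])
    fix e \<rho> assume e: "e < d" and \<rho>: "mollifier e (\<rho> :: 'a \<Rightarrow> real)"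
    have [measurable]: "convolve \<rho> U \<in> borel_measurable borel" "convolve \<rho> f \<in> borel_measurable borel"
      by (auto intro!: convolve_measurable[OF \<rho>])
    have diff: "convolve \<rho> (\<lambda>x. U x - f x) x = convolve \<rho> U x - convolve \<rho> f x" for x
      using convolve_integrable[OF \<rho> U, of x] convolve_integrable[OF \<rho> f(4), of x]
      by (simp add: convolve_def right_diff_distrib)
    have "(\<integral>\<^sup>+x. \<bar>convolve \<rho> (\<lambda>x. U x - f x) x\<bar> \<partial>lborel) \<le> (\<integral>\<^sup>+x. \<bar>U x - f x\<bar> \<partial>lborel)"
      using convolve_L1_le[OF \<rho>, of "\<lambda>x. U x - f x"] U f(4) by simp
    then have cUf: "(\<integral>\<^sup>+x. \<bar>convolve \<rho> U x - convolve \<rho> f x\<bar> \<partial>lborel) \<le> ennreal (\<epsilon> / 3)"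
      using Uf by (simp add: diff)
    have "(\<integral>\<^sup>+x. \<bar>convolve \<rho> U x - U x\<bar> \<partial>lborel)
      \<le> (\<integral>\<^sup>+x. ennreal \<bar>convolve \<rho> U x - convolve \<rho> f x\<bar> + ennreal \<bar>convolve \<rho> f x - f x\<bar> + ennreal \<bar>U x - f x\<bar> \<partial>lborel)"
      by (intro nn_integral_mono) (auto simp flip: ennreal_plus intro!: ennreal_leI)
    also have "\<dots> = (\<integral>\<^sup>+x. \<bar>convolve \<rho> U x - convolve \<rho> f x\<bar> \<partial>lborel)
      + (\<integral>\<^sup>+x. \<bar>convolve \<rho> f x - f x\<bar> \<partial>lborel) + (\<integral>\<^sup>+x. \<bar>U x - f x\<bar> \<partial>lborel)"
      by (simp add: nn_integral_add)
    also have "\<dots> \<le> ennreal (\<epsilon> / 3) + ennreal (\<epsilon> / 3) + ennreal (\<epsilon> / 3)"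
      by (intro add_mono cUf Uf d(2)[OF e \<rho>])
    also have "\<dots> = ennreal \<epsilon>" using \<open>\<epsilon> > 0\<close> by (simp flip: ennreal_plus)
    finally show "(\<integral>\<^sup>+x. \<bar>convolve \<rho> U x - U x\<bar> \<partial>lborel) \<le> ennreal \<epsilon>" .
  qed
qed

lemma Ck_fun_reflect_shift: "Ck_fun n f \<Longrightarrow> Ck_fun n (\<lambda>y. f (x - y))"
proof (induction n arbitrary: f)
  case 0
  then show ?case by (auto intro!: continuous_on_compose2[of UNIV f] continuous_intros)
next
  case (Suc n)
  obtain f' where f: "\<And>z. (f has_derivative f' z) (at z)"
    "\<And>b. b \<in> Basis \<Longrightarrow> Ck_fun n (\<lambda>z. f' z b)" using Ck_fun_SucE[OF Suc.prems(1)] by blast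
  have "((\<lambda>y. x - y) has_derivative (\<lambda>h. - h)) (at z)" for z
    by (auto intro!: derivative_eq_intros)
  then have d: "((\<lambda>y. f (x - y)) has_derivative (\<lambda>h. f' (x - z) (- h))) (at z)" for z
    using f(1) by (rule has_derivative_compose)
  have "f' z (- h) = (- 1) * f' z h" for z h
    using linear_neg[OF has_derivative_linear[OF f(1)]] by simp
  then show ?case
    by (intro Ck_fun_SucI[OF d]) (simp only: Ck_fun_mult Ck_fun_const Suc.IH[OF f(2)])
qed

text \<open>Sobolev functions are only Lebesgue measurable, while the convolution estimates are set
  over \<open>lborel\<close>; this provides the Borel representatives.\<close>

lemma completion_ex_borel_measurable_euclidean:
  fixes g :: "'a::euclidean_space \<Rightarrow> 'b::euclidean_space"
  assumes "g \<in> borel_measurable lebesgue"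
  obtains G where "G \<in> borel_measurable borel" "AE x in lborel. g x = G x"
proof -
  have "\<exists>G\<in>borel_measurable lborel. AE x in lborel. g x \<bullet> b = G x" for b
    by (rule completion_ex_borel_measurable_real) (use assms in measurable)
  then obtain G where G: "\<And>b. G b \<in> borel_measurable lborel" "\<And>b. AE x in lborel. g x \<bullet> b = G b x"
    by metis
  note [measurable] = G(1)
  have "AE x in lborel. \<forall>b\<in>Basis. g x \<bullet> b = G b x"
    using G(2) by (subst AE_finite_all) auto
  then have "AE x in lborel. g x = (\<Sum>b\<in>Basis. G b x *\<^sub>R b)"
  proof eventually_elim
    case (elim x)
    then have "(\<Sum>b\<in>Basis. G b x *\<^sub>R b) = (\<Sum>b\<in>Basis. (g x \<bullet> b) *\<^sub>R b)" by simp
    then show ?case by (simp add: euclidean_representation)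
  qed
  moreover have "(\<lambda>x. \<Sum>b\<in>Basis. G b x *\<^sub>R b) \<in> borel_measurable borel"
    using G(1) by measurable
  ultimately show thesis using that by blast
qed

section \<open>Mollification of Sobolev functions\<close>

text \<open>Differentiation under the integral puts the derivative on the kernel, and the weak
  gradient moves it over to \<open>g\<close>. The ball condition on \<open>z\<close> keeps the
  kernel inside \<open>K\<close>, where \<open>U\<close> and \<open>G\<close> are representatives of
  \<open>u\<close> and \<open>g\<close>.\<close>

lemma weak_gradient_convolve:
  fixes D :: "'a::euclidean_space set"
  assumes D: "open D" "weak_gradient D u g"
    and K: "compact K" "K \<subseteq> D"
    and U: "integrable lborel U" "AE x in lborel. indicator K x *\<^sub>R u x = U x"
    and G: "integrable lborel G" "AE x in lborel. indicator K x *\<^sub>R g x = G x"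
    and \<rho>: "mollifier e \<rho>" "e < e'" "cball z e' \<subseteq> K"
  shows "(convolve \<rho> U has_derivative (\<lambda>h. convolve \<rho> G z \<bullet> h)) (at z)"
proof -
  obtain \<rho>' where d: "\<And>x. (\<rho> has_derivative \<rho>' x) (at x)" "\<And>h. continuous_on UNIV (\<lambda>x. \<rho>' x h)"
    using mollifier_derivative[OF \<rho>(1)] by metis
  note mea = mollifier_measurable[OF \<rho>(1)]
  have mea': "(\<lambda>x. \<rho>' x h) \<in> borel_measurable borel" for h
    using d(2) by (rule borel_measurable_continuous_onI)
  note [measurable] = mea mea'
  have [measurable]: "U \<in> borel_measurable borel" "G \<in> borel_measurable borel" using U G by auto
  have [measurable]: "(\<lambda>y. \<rho>' (z - y) h) \<in> borel_measurable lebesgue" for h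
    by (rule measurable_completion) measurable
  have [measurable]: "(\<lambda>y. \<rho> (z - y)) \<in> borel_measurable lebesgue"
    "U \<in> borel_measurable lebesgue" "G \<in> borel_measurable lebesgue"
    by (rule measurable_completion, measurable)+
  have out: "e' < norm (z - y)" if "y \<notin> K" for y
    using that \<rho>(3) by (force simp: dist_norm)
  have \<rho>0: "\<rho> (z - y) = 0" if "y \<notin> K" for y
    using out[OF that] \<rho>(2) mollifierD(3)[OF \<rho>(1)] by simp
  have \<rho>'0: "\<rho>' (z - y) h = 0" if "y \<notin> K" for y h
  proof -
    have "(\<rho> has_derivative (\<lambda>h. 0)) (at (z - y))"
    proof (rule has_derivative_transform_within_open[of "\<lambda>z. 0" "\<lambda>h. 0" _ UNIV "- cball 0 e"])
      show "0 = \<rho> x" if "x \<in> - cball 0 e" for x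
        using that mollifierD(3)[OF \<rho>(1), of x] by simp
    qed (use out[OF that] \<rho>(2) in auto)
    then have "\<rho>' (z - y) = (\<lambda>h. 0)" using d(1) has_derivative_unique by blast
    then show ?thesis by simp
  qed
  have intu: "integrable lebesgue (\<lambda>x. indicator K x *\<^sub>R u x)" "integrable lebesgue (\<lambda>x. indicator K x *\<^sub>R g x)"
    using D(2) K unfolding weak_gradient_def locally_integrable_def set_integrable_def by auto
  have [measurable]: "(\<lambda>x. indicator K x *\<^sub>R u x) \<in> borel_measurable lebesgue"
    "(\<lambda>x. indicator K x *\<^sub>R g x) \<in> borel_measurable lebesgue"
    using intu by auto
  \<comment> \<open>The kernel centred at \<open>z\<close>, read as a function of \<open>y\<close>,
    is the test function. The minus sign from the reflection cancels the one from integration by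
    parts.\<close>
  define \<phi> where "\<phi> y = \<rho> (z - y)" for y
  have d\<phi>: "(\<phi> has_derivative (\<lambda>h. - \<rho>' (z - y) h)) (at y)" for y
  proof -
    have "((\<lambda>y. z - y) has_derivative (\<lambda>h. - h)) (at y)"
      by (auto intro!: derivative_eq_intros)
    then have "(\<phi> has_derivative (\<lambda>h. \<rho>' (z - y) (- h))) (at y)"
      unfolding \<phi>_def using d(1) by (rule has_derivative_compose)
    then show ?thesis using linear_neg[OF has_derivative_linear[OF d(1)]] by simp
  qed
  have fr: "frechet_derivative \<phi> (at y) b = - \<rho>' (z - y) b" for y b
    using frechet_derivative_at[OF d\<phi>[of y]] by metis
  have "test_function D \<phi>"
    unfolding test_function_def
  proof (intro conjI allI exI[of _ K] K impI)
    show "Ck_fun n \<phi>" for n unfolding \<phi>_def by (intro Ck_fun_reflect_shift mollifierD(1)[OF \<rho>(1)])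
    show "\<phi> y = 0" if "y \<notin> K" for y using \<rho>0[OF that] by (simp add: \<phi>_def)
  qed
  then have weak: "(LINT y|lebesgue_on D. u y * frechet_derivative \<phi> (at y) b)
      = - (LINT y|lebesgue_on D. (g y \<bullet> b) * \<phi> y)" if "b \<in> Basis" for b
    using D(2) that unfolding weak_gradient_def by blast
  have Dm: "D \<inter> space lebesgue \<in> sets lebesgue" using D(1) by auto
  have bas: "(LINT y|lborel. \<rho>' (z - y) b * U y) = convolve \<rho> G z \<bullet> b" if b: "b \<in> Basis" for b
  proof -
    have "(LINT y|lebesgue_on D. u y * frechet_derivative \<phi> (at y) b)
      = (LINT y|lebesgue. indicator D y *\<^sub>R (u y * - \<rho>' (z - y) b))"
      unfolding fr by (rule integral_restrict_space[OF Dm])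
    also have "\<dots> = (LINT y|lebesgue. - (\<rho>' (z - y) b * (indicator K y *\<^sub>R u y)))"
      using \<rho>'0 K(2) by (intro Bochner_Integration.integral_cong) (auto simp: indicator_def)
    also have "\<dots> = (LINT y|lebesgue. - (\<rho>' (z - y) b * U y))"
    proof (rule integral_cong_AE)
      show "AE y in lebesgue. - (\<rho>' (z - y) b * (indicator K y *\<^sub>R u y)) = - (\<rho>' (z - y) b * U y)"
        using AE_completion[OF U(2)] by eventually_elim simp
    qed measurable
    also have "\<dots> = - (LINT y|lborel. \<rho>' (z - y) b * U y)"
      by (subst integral_completion) auto
    finally have 1: "(LINT y|lborel. \<rho>' (z - y) b * U y) = (LINT y|lebesgue_on D. (g y \<bullet> b) * \<phi> y)"
      using weak[OF b] by simp
    also have "\<dots> = (LINT y|lebesgue. indicator D y *\<^sub>R ((g y \<bullet> b) * \<phi> y))"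
      by (rule integral_restrict_space[OF Dm])
    also have "\<dots> = (LINT y|lebesgue. (\<rho> (z - y) *\<^sub>R (indicator K y *\<^sub>R g y)) \<bullet> b)"
      using \<rho>0 K(2) by (intro Bochner_Integration.integral_cong) (auto simp: indicator_def \<phi>_def)
    also have "\<dots> = (LINT y|lebesgue. (\<rho> (z - y) *\<^sub>R G y) \<bullet> b)"
    proof (rule integral_cong_AE)
      show "AE y in lebesgue. (\<rho> (z - y) *\<^sub>R (indicator K y *\<^sub>R g y)) \<bullet> b = (\<rho> (z - y) *\<^sub>R G y) \<bullet> b"
        using AE_completion[OF G(2)] by eventually_elim simp
    qed measurable
    also have "\<dots> = (LINT y|lborel. (\<rho> (z - y) *\<^sub>R G y) \<bullet> b)"
      by (subst integral_completion) auto
    also have "\<dots> = convolve \<rho> G z \<bullet> b"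
      unfolding convolve_def using convolve_integrable[OF \<rho>(1) G(1)] by (rule integral_inner_left)
    finally show ?thesis .
  qed
  have D': "(convolve \<rho> U has_derivative (\<lambda>h. LINT y|lborel. \<rho>' (z - y) h * U y)) (at z)"
    by (rule convolve_has_derivative[OF \<rho>(1) d(1) U(1)])
  \<comment> \<open>The weak gradient gives the identity in basis directions; linearity gives it in
    all directions.\<close>
  have "(\<lambda>h. LINT y|lborel. \<rho>' (z - y) h * U y) = (\<lambda>h. convolve \<rho> G z \<bullet> h)"
    by (rule linear_eq_stdbasis[OF has_derivative_linear[OF D']])
      (auto intro: bounded_linear.linear bounded_linear_inner_right bas)
  then show ?thesis using D' by simp
qed

lemma convolve_integrable_lborel:
  fixes U :: "'a::euclidean_space \<Rightarrow> 'b::euclidean_space"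
  assumes "mollifier e \<rho>" "integrable lborel U"
  shows "integrable lborel (convolve \<rho> U)"
proof (rule integrableI_bounded)
  show "convolve \<rho> U \<in> borel_measurable lborel"
    using convolve_measurable[OF assms(1), of U] assms(2) by simp
  have "(\<integral>\<^sup>+x. norm (convolve \<rho> U x) \<partial>lborel) \<le> (\<integral>\<^sup>+x. norm (U x) \<partial>lborel)"
    by (rule convolve_L1_le[OF assms])
  also have "\<dots> < \<infinity>" using assms(2) by (simp add: integrable_iff_bounded)
  finally show "(\<integral>\<^sup>+x. norm (convolve \<rho> U x) \<partial>lborel) < \<infinity>" .
qed

lemma convolve_AE_subseq:
  fixes U :: "'a::euclidean_space \<Rightarrow> real"
  assumes U: "integrable lborel U" and \<rho>: "\<And>n. mollifier (e n) (\<rho> n)" and e: "e \<longlonglongrightarrow> 0"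
  obtains r where "strict_mono (r :: nat \<Rightarrow> nat)"
    "AE x in lborel. (\<lambda>n. convolve (\<rho> (r n)) U x) \<longlonglongrightarrow> U x"
proof -
  have int: "integrable lborel (\<lambda>x. convolve (\<rho> n) U x - U x)" for n
    using convolve_integrable_lborel[OF \<rho> U] U by simp
  have "(\<lambda>n. LINT x|lborel. norm (convolve (\<rho> n) U x - U x)) \<longlonglongrightarrow> 0"
  proof (rule LIMSEQ_I)
    fix \<epsilon> :: real assume "\<epsilon> > 0"
    then obtain d where d: "d > 0" "\<And>e \<rho>. e < d \<Longrightarrow> mollifier e \<rho> \<Longrightarrow>
      (\<integral>\<^sup>+x. \<bar>convolve \<rho> U x - U x\<bar> \<partial>lborel) \<le> ennreal (\<epsilon> / 2)"
      using convolve_L1_approx[OF U, of "\<epsilon> / 2"] by auto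
    obtain N where N: "\<And>n. n \<ge> N \<Longrightarrow> e n < d"
      using order_tendstoD(2)[OF e d(1)] unfolding eventually_sequentially by auto
    have "norm ((LINT x|lborel. norm (convolve (\<rho> n) U x - U x)) - 0) < \<epsilon>" if "n \<ge> N" for n
    proof -
      have "ennreal (LINT x|lborel. norm (convolve (\<rho> n) U x - U x)) = (\<integral>\<^sup>+x. \<bar>convolve (\<rho> n) U x - U x\<bar> \<partial>lborel)"
        using int by (subst nn_integral_eq_integral) auto
      also have "\<dots> \<le> ennreal (\<epsilon> / 2)" by (rule d(2)[OF N[OF that] \<rho>])
      finally have "(LINT x|lborel. norm (convolve (\<rho> n) U x - U x)) \<le> \<epsilon> / 2"
        using \<open>\<epsilon> > 0\<close> by (simp add: ennreal_le_iff)
      moreover have "(LINT x|lborel. norm (convolve (\<rho> n) U x - U x)) \<ge> 0"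
        by (rule Bochner_Integration.integral_nonneg) simp
      ultimately show ?thesis using \<open>\<epsilon> > 0\<close> by simp
    qed
    then show "\<exists>N. \<forall>n\<ge>N. norm ((LINT x|lborel. norm (convolve (\<rho> n) U x - U x)) - 0) < \<epsilon>" by blast
  qed
  from tendsto_L1_AE_subseq[OF int this] obtain r where r: "strict_mono r"
    "AE x in lborel. (\<lambda>n. convolve (\<rho> (r n)) U x - U x) \<longlonglongrightarrow> 0" by blast
  have "AE x in lborel. (\<lambda>n. convolve (\<rho> (r n)) U x) \<longlonglongrightarrow> U x"
    using r(2) by eventually_elim (simp add: LIM_zero_cancel)
  with r(1) show thesis by (rule that)
qed

text \<open>Substituting \<open>\<sigma> y\<close> for \<open>y\<close> leaves the radial kernel
  unchanged, since \<open>\<sigma>\<close> is a linear isometry. The hypothesis holds almost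
  everywhere, the conclusion at every point; this makes it possible to evaluate on the axis of
  symmetry.\<close>

lemma convolve_odd:
  fixes U :: "'a::euclidean_space \<Rightarrow> real"
  assumes \<rho>: "mollifier e \<rho>" and U: "integrable lborel U"
    and \<sigma>: "linear \<sigma>" "\<And>x. norm (\<sigma> x) = norm x" "distr lborel borel \<sigma> = lborel"
    and odd: "AE x in lborel. U (\<sigma> x) = - U x"
  shows "convolve \<rho> U (\<sigma> x) = - convolve \<rho> U x"
proof -
  note [measurable] = mollifier_measurable[OF \<rho>]
  have [measurable]: "U \<in> borel_measurable borel" using U by simp
  have "continuous_on UNIV \<sigma>" using \<sigma>(1) by (simp add: linear_continuous_on linear_conv_bounded_linear)
  then have [measurable]: "\<sigma> \<in> borel_measurable borel" by (rule borel_measurable_continuous_onI)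
  have "convolve \<rho> U (\<sigma> x) = (LINT y|distr lborel borel \<sigma>. \<rho> (\<sigma> x - y) *\<^sub>R U y)"
    unfolding \<sigma>(3) convolve_def ..
  also have "\<dots> = (LINT y|lborel. \<rho> (\<sigma> x - \<sigma> y) *\<^sub>R U (\<sigma> y))"
    by (subst integral_distr) auto
  also have "\<dots> = (LINT y|lborel. - (\<rho> (x - y) *\<^sub>R U y))"
  proof (rule integral_cong_AE)
    have "\<rho> (\<sigma> x - \<sigma> y) = \<rho> (x - y)" for y
      by (rule mollifierD(4)[OF \<rho>]) (simp add: linear_diff[OF \<sigma>(1), symmetric] \<sigma>(2))
    then show "AE y in lborel. \<rho> (\<sigma> x - \<sigma> y) *\<^sub>R U (\<sigma> y) = - (\<rho> (x - y) *\<^sub>R U y)"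
      using odd by (auto elim: eventually_mono)
  qed measurable
  finally show ?thesis by (simp add: convolve_def)
qed

text \<open>A transfer principle: an inequality known for continuously differentiable odd functions
  on \<open>K\<close> passes to Sobolev functions. The right side grows from \<open>K\<close> to
  \<open>D\<close> because averaging brings in values of \<open>g\<close> near \<open>K\<close>;
  this fixed bound is what Fatou's lemma is run against.\<close>

lemma sobolev_odd_inequality_from_smooth:
  fixes D :: "'a::euclidean_space set"
  assumes D: "open D" and sob: "sobolev p D u g" and p: "p > 1"
    and K: "compact K" "K \<subseteq> D"
    and \<sigma>: "linear \<sigma>" "\<And>x. norm (\<sigma> x) = norm x" "distr lborel borel \<sigma> = lborel"
      "\<And>x. \<sigma> (\<sigma> x) = x" "\<sigma> ` K \<subseteq> K"
    and odd: "AE z in lebesgue_on D. u (\<sigma> z) = - u z"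
    and smooth: "\<And>v G. (\<And>z. z \<in> K \<Longrightarrow> (v has_derivative (\<lambda>h. G z \<bullet> h)) (at z)) \<Longrightarrow>
      continuous_on K v \<Longrightarrow> continuous_on K G \<Longrightarrow> (\<And>z. v (\<sigma> z) = - v z) \<Longrightarrow>
      (\<integral>\<^sup>+z. ennreal (C * \<bar>v z\<bar> powr p) * indicator K z \<partial>lborel)
        \<le> (\<integral>\<^sup>+z. ennreal (norm (G z) powr p) * indicator K z \<partial>lborel)"
  shows "(\<integral>\<^sup>+z. ennreal (C * \<bar>u z\<bar> powr p) * indicator K z \<partial>lebesgue)
        \<le> (\<integral>\<^sup>+z. ennreal (norm (g z) powr p) * indicator D z \<partial>lebesgue)" (is "_ \<le> ?B")
proof -
  obtain \<eta> where \<eta>: "\<eta> > 0" "(\<Union>x\<in>K. cball x \<eta>) \<subseteq> D"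
    using compact_subset_open_imp_cball_epsilon_subset[OF K(1) D K(2)] by blast
  \<comment> \<open>Kernels of radius below \<open>\<eta>\<close> centred in \<open>K\<close> see
    only \<open>K'\<close>. Cutting off there makes \<open>U\<close> and \<open>G\<close> integrable
    on the whole space.\<close>
  define K' where "K' = (\<Union>x\<in>K. cball x \<eta>)"
  have K': "compact K'" "K' \<subseteq> D" "K \<subseteq> K'"
    using compact_minkowski_sum_cball[OF K(1)] \<eta> by (auto simp: K'_def)
  have wg: "weak_gradient D u g" using sob unfolding sobolev_def by blast
  have intu: "integrable lebesgue (\<lambda>x. indicator K' x *\<^sub>R u x)" "integrable lebesgue (\<lambda>x. indicator K' x *\<^sub>R g x)"
    using wg K' unfolding weak_gradient_def locally_integrable_def set_integrable_def by auto
  obtain U where U: "U \<in> borel_measurable borel" "AE x in lborel. indicator K' x *\<^sub>R u x = U x"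
    using completion_ex_borel_measurable_euclidean[OF borel_measurable_integrable[OF intu(1)]] by blast
  obtain G where G: "G \<in> borel_measurable borel" "AE x in lborel. indicator K' x *\<^sub>R g x = G x"
    using completion_ex_borel_measurable_euclidean[OF borel_measurable_integrable[OF intu(2)]] by blast
  note [measurable] = U(1) G(1)
  have iU: "integrable lborel U"
  proof -
    have "integrable lebesgue U"
      using intu(1) by (rule Bochner_Integration.integrable_cong_AE_imp)
        (use AE_completion[OF U(2)] U(1) in \<open>auto intro: measurable_completion\<close>)
    then show ?thesis using U(1) by (simp add: integrable_completion)
  qed
  have iG: "integrable lborel G"
  proof -
    have "integrable lebesgue G"
      using intu(2) by (rule Bochner_Integration.integrable_cong_AE_imp)
        (use AE_completion[OF G(2)] G(1) in \<open>auto intro: measurable_completion\<close>)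
    then show ?thesis using G(1) by (simp add: integrable_completion)
  qed
  have GB: "(\<integral>\<^sup>+x. ennreal (norm (G x) powr p) \<partial>lborel) \<le> ?B"
  proof -
    have "(\<integral>\<^sup>+x. ennreal (norm (G x) powr p) \<partial>lborel) = (\<integral>\<^sup>+x. ennreal (norm (G x) powr p) \<partial>lebesgue)"
      by (simp add: nn_integral_completion)
    also have "\<dots> \<le> ?B"
    proof (rule nn_integral_mono_AE)
      show "AE x in lebesgue. ennreal (norm (G x) powr p) \<le> ennreal (norm (g x) powr p) * indicator D x"
        using AE_completion[OF G(2)]
      proof eventually_elim
        case (elim x)
        then show ?case using K'(2) by (cases "x \<in> K'") (auto simp: elim[symmetric])
      qed
    qed
    finally show ?thesis .
  qed
  have Dm: "D \<inter> space lebesgue \<in> sets lebesgue" using D by auto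
  have "?B < \<infinity>"
  proof -
    have "integrable (lebesgue_on D) (\<lambda>z. norm (g z) powr p)"
      using sob unfolding sobolev_def Lp_fun_def by blast
    then have "(\<integral>\<^sup>+z. ennreal (norm (norm (g z) powr p)) \<partial>lebesgue_on D) < \<infinity>"
      by (simp only: integrable_iff_bounded)
    then show ?thesis by (simp add: nn_integral_restrict_space[OF Dm])
  qed
  with GB have fin: "(\<integral>\<^sup>+x. ennreal (norm (G x) powr p) \<partial>lborel) < \<infinity>" by (rule order.strict_trans1)
  have iGp: "integrable lborel (\<lambda>x. norm (G x) powr p)"
    by (rule integrableI_bounded) (use fin in auto)
  then have LG: "ennreal (LINT x|lborel. norm (G x) powr p) \<le> ?B"
    using GB by (subst nn_integral_eq_integral[symmetric]) auto
  \<comment> \<open>The offset 2 makes the radius strictly smaller than \<open>\<eta>\<close>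
    already for \<open>n = 0\<close>.\<close>
  define e where "e n = \<eta> / real (n + 2)" for n :: nat
  have e: "e n > 0" "e n < \<eta>" for n using \<eta>(1) by (auto simp: e_def field_simps add_pos_nonneg)
  have elim: "e \<longlonglongrightarrow> 0"
    unfolding e_def using LIMSEQ_ignore_initial_segment[OF lim_const_over_n[of \<eta>], of 2] by simp
  obtain \<rho> where \<rho>: "\<And>n. mollifier (e n) (\<rho> n :: 'a \<Rightarrow> real)"
    using mollifier_exists[OF e(1)] by metis
  obtain r where r: "strict_mono (r :: nat \<Rightarrow> nat)"
    "AE x in lborel. (\<lambda>n. convolve (\<rho> (r n)) U x) \<longlonglongrightarrow> U x"
    using convolve_AE_subseq[OF iU \<rho> elim] by blast
  \<comment> \<open>Invariance of the cutoff region is what lets \<open>U\<close> inherit the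
    oddness of \<open>u\<close>.\<close>
  have \<sigma>K': "\<sigma> x \<in> K' \<longleftrightarrow> x \<in> K'" for x
  proof -
    have imp: "\<sigma> x \<in> K'" if "x \<in> K'" for x
    proof -
      from that obtain k where k: "k \<in> K" "dist k x \<le> \<eta>" by (auto simp: K'_def)
      have "dist (\<sigma> k) (\<sigma> x) = dist k x"
        by (simp add: dist_norm linear_diff[OF \<sigma>(1), symmetric] \<sigma>(2))
      then show ?thesis using k \<sigma>(5) by (auto simp: K'_def intro!: bexI[of _ "\<sigma> k"])
    qed
    from imp[of x] imp[of "\<sigma> x"] show ?thesis by (auto simp: \<sigma>(4))
  qed
  have oddU: "AE x in lborel. U (\<sigma> x) = - U x"
  proof -
    have "continuous_on UNIV \<sigma>" using \<sigma>(1) by (simp add: linear_continuous_on linear_conv_bounded_linear)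
    then have "\<sigma> \<in> borel_measurable lborel" by (simp add: borel_measurable_continuous_onI)
    \<comment> \<open>\<open>\<sigma>\<close> preserves Lebesgue measure, so the exceptional null
      set of \<open>U\<close> pulls back to a null set.\<close>
    then have "AE x in lborel. indicator K' (\<sigma> x) *\<^sub>R u (\<sigma> x) = U (\<sigma> x)"
      by (rule AE_distrD) (subst \<sigma>(3), rule U(2))
    moreover have "AE x in lborel. x \<in> D \<longrightarrow> u (\<sigma> x) = - u x"
      using odd by (simp add: AE_restrict_space_iff[OF Dm] AE_completion_iff)
    ultimately show ?thesis using U(2)
    proof eventually_elim
      case (elim x)
      show ?case
      proof (cases "x \<in> K'")
        case True
        then have "x \<in> D" "\<sigma> x \<in> K'" using K'(2) \<sigma>K' by auto
        then show ?thesis using True elim by auto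
      next
        case False
        then have "\<sigma> x \<notin> K'" using \<sigma>K' by auto
        then show ?thesis using False elim by auto
      qed
    qed
  qed
  have bound: "(\<integral>\<^sup>+z. ennreal (C * \<bar>convolve (\<rho> n) U z\<bar> powr p) * indicator K z \<partial>lborel) \<le> ?B" for n
  proof -
    have "(\<integral>\<^sup>+z. ennreal (C * \<bar>convolve (\<rho> n) U z\<bar> powr p) * indicator K z \<partial>lborel)
      \<le> (\<integral>\<^sup>+z. ennreal (norm (convolve (\<rho> n) G z) powr p) * indicator K z \<partial>lborel)"
    proof (rule smooth)
      show "(convolve (\<rho> n) U has_derivative (\<lambda>h. convolve (\<rho> n) G z \<bullet> h)) (at z)" if "z \<in> K" for z
        using that by (intro weak_gradient_convolve[OF D wg K'(1,2) iU U(2) iG G(2) \<rho> e(2)]) (auto simp: K'_def)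
      show "convolve (\<rho> n) U (\<sigma> z) = - convolve (\<rho> n) U z" for z
        by (rule convolve_odd[OF \<rho> iU \<sigma>(1-3) oddU])
    qed (intro convolve_continuous[OF \<rho>] iU iG)+
    also have "\<dots> \<le> (\<integral>\<^sup>+z. ennreal (norm (convolve (\<rho> n) G z) powr p) \<partial>lborel)"
      by (intro nn_integral_mono) (auto simp: indicator_def)
    also have "\<dots> \<le> ennreal (LINT x|lborel. norm (G x) powr p)"
      by (rule convolve_nn_integral_powr_le[OF \<rho> iG iGp p])
    finally show ?thesis using LG by (rule order_trans)
  qed
  have [measurable]: "convolve (\<rho> n) U \<in> borel_measurable borel" for n
    by (rule convolve_measurable[OF \<rho>]) simp
  have [measurable]: "K \<in> sets borel" using K(1) by (simp add: borel_compact)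
  have "(\<integral>\<^sup>+z. ennreal (C * \<bar>u z\<bar> powr p) * indicator K z \<partial>lebesgue)
    = (\<integral>\<^sup>+z. ennreal (C * \<bar>U z\<bar> powr p) * indicator K z \<partial>lborel)"
  proof -
    have "(\<integral>\<^sup>+z. ennreal (C * \<bar>u z\<bar> powr p) * indicator K z \<partial>lebesgue)
      = (\<integral>\<^sup>+z. ennreal (C * \<bar>U z\<bar> powr p) * indicator K z \<partial>lebesgue)"
    proof (rule nn_integral_cong_AE)
      show "AE z in lebesgue. ennreal (C * \<bar>u z\<bar> powr p) * indicator K z = ennreal (C * \<bar>U z\<bar> powr p) * indicator K z"
        using AE_completion[OF U(2)]
      proof eventually_elim
        case (elim z)
        then show ?case using K'(3) by (auto simp: indicator_def split: if_splits)
      qed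
    qed
    then show ?thesis by (simp add: nn_integral_completion)
  qed
  also have "\<dots> = (\<integral>\<^sup>+z. liminf (\<lambda>n. ennreal (C * \<bar>convolve (\<rho> (r n)) U z\<bar> powr p) * indicator K z) \<partial>lborel)"
  proof (rule nn_integral_cong_AE)
    show "AE z in lborel. ennreal (C * \<bar>U z\<bar> powr p) * indicator K z
      = liminf (\<lambda>n. ennreal (C * \<bar>convolve (\<rho> (r n)) U z\<bar> powr p) * indicator K z)"
      using r(2)
    proof eventually_elim
      case (elim z)
      have "(\<lambda>n. ennreal (C * \<bar>convolve (\<rho> (r n)) U z\<bar> powr p)) \<longlonglongrightarrow> ennreal (C * \<bar>U z\<bar> powr p)"
        using p by (intro tendsto_ennrealI tendsto_intros tendsto_powr2 elim) auto
      then have "(\<lambda>n. ennreal (C * \<bar>convolve (\<rho> (r n)) U z\<bar> powr p) * indicator K z) \<longlonglongrightarrow> ennreal (C * \<bar>U z\<bar> powr p) * indicator K z"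
        by (cases "z \<in> K") auto
      then show ?case using lim_imp_Liminf[OF sequentially_bot] by metis
    qed
  qed
  also have "\<dots> \<le> liminf (\<lambda>n. \<integral>\<^sup>+z. ennreal (C * \<bar>convolve (\<rho> (r n)) U z\<bar> powr p) * indicator K z \<partial>lborel)"
    by (rule nn_integral_liminf) measurable
  also have "\<dots> \<le> liminf (\<lambda>n::nat. ?B)"
    by (intro Liminf_mono always_eventually allI bound)
  also have "\<dots> = ?B" by (simp add: Liminf_const)
  finally show ?thesis .
qed

section \<open>The weighted one-dimensional inequality\<close>

text \<open>At 0 the difference quotient has absolute value |h|^(p-1), which tends to 0 because p >
  1. This allows differentiating |v|^p across zeros of v.\<close>

lemma has_real_derivative_abs_powr:
  fixes x :: real
  assumes "p > 1"
  shows "((\<lambda>x. \<bar>x\<bar> powr p) has_real_derivative p * \<bar>x\<bar> powr (p - 1) * sgn x) (at x)"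
proof (cases x "0::real" rule: linorder_cases)
  case less
  have "((\<lambda>x. (- x) powr p) has_real_derivative p * \<bar>x\<bar> powr (p - 1) * sgn x) (at x)"
    using less by (auto intro!: derivative_eq_intros simp: powr_diff)
  then show ?thesis
    by (rule has_field_derivative_transform_within_open[where S = "{..<0}"]) (use less in auto)
next
  case greater
  have "((\<lambda>x. x powr p) has_real_derivative p * \<bar>x\<bar> powr (p - 1) * sgn x) (at x)"
    using greater by (auto intro!: derivative_eq_intros simp: powr_diff)
  then show ?thesis
    by (rule has_field_derivative_transform_within_open[where S = "{0<..}"]) (use greater in auto)
next
  case equal
  have "((\<lambda>h::real. \<bar>h\<bar> powr (p - 1)) \<longlongrightarrow> \<bar>0\<bar> powr (p - 1)) (at 0)"
    using assms by (intro tendsto_powr2 tendsto_intros) auto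
  then have "((\<lambda>h::real. \<bar>h\<bar> powr (p - 1)) \<longlongrightarrow> 0) (at 0)" using assms by simp
  moreover have "\<forall>\<^sub>F h in at 0. \<bar>h\<bar> powr (p - 1) = \<bar>\<bar>h\<bar> powr p / h\<bar>"
    by (auto simp: eventually_at_filter powr_diff abs_divide intro!: always_eventually)
  ultimately have "((\<lambda>h::real. \<bar>\<bar>h\<bar> powr p / h\<bar>) \<longlongrightarrow> 0) (at 0)"
    by (rule Lim_transform_eventually)
  then have "((\<lambda>h::real. \<bar>h\<bar> powr p / h) \<longlongrightarrow> 0) (at 0)"
    by (simp only: tendsto_rabs_zero_iff)
  then show ?thesis using equal by (simp add: DERIV_def)
qed

lemma continuous_on_abs_powr:
  fixes f :: "'a::topological_space \<Rightarrow> real"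
  assumes "p > 1" "continuous_on S f"
  shows "continuous_on S (\<lambda>x. \<bar>f x\<bar> powr p)"
proof (rule continuous_on_compose2[OF _ assms(2)])
  show "continuous_on UNIV (\<lambda>x::real. \<bar>x\<bar> powr p)"
    using DERIV_isCont[OF has_real_derivative_abs_powr[OF assms(1)]]
    by (intro continuous_at_imp_continuous_on) auto
qed simp

text \<open>Integrate the derivative \<open>g\<close> of \<open>G\<close>, which is at most the
  difference of the two integrands. The boundary terms have the right sign: \<open>G a = 0\<close>
  since \<open>v\<close> vanishes and \<open>T\<close> is positive there, and
  \<open>G b \<ge> 0\<close>.\<close>

lemma weighted_inequality_vanishing_left:
  fixes v v' w w' T :: "real \<Rightarrow> real"
  assumes p: "p > 1" and ab: "a \<le> b"
    and v: "\<And>x. x \<in> {a..b} \<Longrightarrow> (v has_real_derivative v' x) (at x within {a..b})"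
      "continuous_on {a..b} v'" "v a = 0"
    and w: "\<And>x. x \<in> {a..b} \<Longrightarrow> (w has_real_derivative w' x) (at x within {a..b})"
      "\<And>x. x \<in> {a..b} \<Longrightarrow> w x \<ge> 0" "\<And>x. x \<in> {a..b} \<Longrightarrow> w' x \<le> 0"
    and T: "\<And>x. x \<in> {a..b} \<Longrightarrow> (T has_real_derivative 1 + lam * T x powr p / (p - 1)) (at x within {a..b})"
      "\<And>x. x \<in> {a..b} \<Longrightarrow> T x > 0"
  shows "integral {a..b} (\<lambda>x. lam * \<bar>v x\<bar> powr p * w x) \<le> integral {a..b} (\<lambda>x. \<bar>v' x\<bar> powr p * w x)"
proof -
  define G where "G x = T x powr (1 - p) * \<bar>v x\<bar> powr p * w x" for x
  define g where "g x = (((1 - p) * T x powr (- p) * (1 + lam * T x powr p / (p - 1))) * \<bar>v x\<bar> powr p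
      + T x powr (1 - p) * (p * \<bar>v x\<bar> powr (p - 1) * sgn (v x) * v' x)) * w x
      + T x powr (1 - p) * \<bar>v x\<bar> powr p * w' x" for x
  have cv: "continuous_on {a..b} v" "continuous_on {a..b} w"
    by (rule DERIV_continuous_on, rule v(1), simp) (rule DERIV_continuous_on, rule w(1), simp)
  have cp: "continuous_on {a..b} (\<lambda>x. \<bar>v x\<bar> powr p)" "continuous_on {a..b} (\<lambda>x. \<bar>v' x\<bar> powr p)"
    by (intro continuous_on_abs_powr[OF p] cv v(2))+
  have G: "(G has_real_derivative g x) (at x within {a..b})" if x: "x \<in> {a..b}" for x
  proof -
    have 1: "((\<lambda>x. T x powr (1 - p)) has_real_derivative
      (1 - p) * T x powr (- p) * (1 + lam * T x powr p / (p - 1))) (at x within {a..b})"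
      using DERIV_chain2[OF has_real_derivative_powr[OF T(2)[OF x], of "1 - p"] T(1)[OF x]] by simp
    have 2: "((\<lambda>x. \<bar>v x\<bar> powr p) has_real_derivative p * \<bar>v x\<bar> powr (p - 1) * sgn (v x) * v' x) (at x within {a..b})"
      using DERIV_chain2[OF has_real_derivative_abs_powr[OF p] v(1)[OF x]] by simp
    show ?thesis unfolding G_def g_def
      using DERIV_mult[OF DERIV_mult[OF 1 2] w(1)[OF x]] by (simp add: algebra_simps)
  qed
  have "(g has_integral (G b - G a)) {a..b}"
    using G ab by (intro fundamental_theorem_of_calculus) (auto simp: has_real_derivative_iff_has_vector_derivative)
  moreover have "((\<lambda>x. (\<bar>v' x\<bar> powr p - lam * \<bar>v x\<bar> powr p) * w x) has_integral
    integral {a..b} (\<lambda>x. (\<bar>v' x\<bar> powr p - lam * \<bar>v x\<bar> powr p) * w x)) {a..b}"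
    by (intro integrable_integral integrable_continuous_interval continuous_intros cp cv)
  moreover have "g x \<le> (\<bar>v' x\<bar> powr p - lam * \<bar>v x\<bar> powr p) * w x" if x: "x \<in> {a..b}" for x
  proof -
    \<comment> \<open>The tangent point for Young's inequality. If v is a multiple of the function f
      with T = f / f', then B = |v'| and the inequality is an equality.\<close>
    define B where "B = \<bar>v x\<bar> / T x"
    have Tx: "T x > 0" using T(2)[OF x] .
    have vB: "\<bar>v x\<bar> = B * T x" "B \<ge> 0" using Tx by (auto simp: B_def)
    have young: "B powr p + p * B powr (p - 1) * (\<bar>v' x\<bar> - B) \<le> \<bar>v' x\<bar> powr p"
      by (rule powr_tangent_le) (use p vB in auto)
    have Bp: "B powr p = B powr (p - 1) * B"
      using powr_add[of B "p - 1" 1] vB(2) by (cases "B = 0") auto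
    have e1: "T x powr (- p) * \<bar>v x\<bar> powr p = B powr p"
      using Tx vB by (simp add: powr_mult powr_minus)
    have e2: "T x powr (1 - p) * \<bar>v x\<bar> powr (p - 1) = B powr (p - 1)"
      using Tx vB powr_add[of "T x" "1 - p" "p - 1"] by (simp add: powr_mult)
    have e3: "T x powr (- p) * T x powr p = 1" using Tx powr_add[of "T x" "- p" p] by simp
    have "((1 - p) * T x powr (- p) * (1 + lam * T x powr p / (p - 1))) * \<bar>v x\<bar> powr p
      = (1 - p) * (T x powr (- p) * \<bar>v x\<bar> powr p) - lam * (T x powr (- p) * T x powr p) * \<bar>v x\<bar> powr p"
      using p by (simp add: field_simps)
    then have h1: "((1 - p) * T x powr (- p) * (1 + lam * T x powr p / (p - 1))) * \<bar>v x\<bar> powr p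
      = (1 - p) * B powr p - lam * \<bar>v x\<bar> powr p" by (simp add: e1 e3)
    have "T x powr (1 - p) * (p * \<bar>v x\<bar> powr (p - 1) * sgn (v x) * v' x)
      = p * (T x powr (1 - p) * \<bar>v x\<bar> powr (p - 1)) * (sgn (v x) * v' x)" by simp
    also have "\<dots> \<le> p * B powr (p - 1) * \<bar>v' x\<bar>"
      unfolding e2 using p by (intro mult_left_mono) (auto simp: sgn_if)
    finally have h2: "T x powr (1 - p) * (p * \<bar>v x\<bar> powr (p - 1) * sgn (v x) * v' x) \<le> p * B powr (p - 1) * \<bar>v' x\<bar>" .
    have "(1 - p) * B powr p - lam * \<bar>v x\<bar> powr p + p * B powr (p - 1) * \<bar>v' x\<bar> \<le> \<bar>v' x\<bar> powr p - lam * \<bar>v x\<bar> powr p"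
      using young Bp by (simp add: algebra_simps)
    then have "(((1 - p) * T x powr (- p) * (1 + lam * T x powr p / (p - 1))) * \<bar>v x\<bar> powr p
      + T x powr (1 - p) * (p * \<bar>v x\<bar> powr (p - 1) * sgn (v x) * v' x)) * w x
      \<le> (\<bar>v' x\<bar> powr p - lam * \<bar>v x\<bar> powr p) * w x"
      using h1 h2 by (intro mult_right_mono w(2) x) linarith
    \<comment> \<open>The monotone weight enters here: its derivative contributes a term that may be
      discarded.\<close>
    moreover have "T x powr (1 - p) * \<bar>v x\<bar> powr p * w' x \<le> 0"
      using w(3)[OF x] by (intro mult_nonneg_nonpos) auto
    ultimately show ?thesis unfolding g_def by linarith
  qed
  ultimately have "G b - G a \<le> integral {a..b} (\<lambda>x. (\<bar>v' x\<bar> powr p - lam * \<bar>v x\<bar> powr p) * w x)"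
    by (rule has_integral_le)
  moreover have "G a = 0" using v(3) by (simp add: G_def)
  moreover have "G b \<ge> 0" using w(2)[of b] ab by (simp add: G_def)
  ultimately have "0 \<le> integral {a..b} (\<lambda>x. \<bar>v' x\<bar> powr p * w x - lam * \<bar>v x\<bar> powr p * w x)"
    by (simp add: left_diff_distrib)
  also have "\<dots> = integral {a..b} (\<lambda>x. \<bar>v' x\<bar> powr p * w x) - integral {a..b} (\<lambda>x. lam * \<bar>v x\<bar> powr p * w x)"
    by (intro Henstock_Kurzweil_Integration.integral_diff integrable_continuous_interval continuous_intros cp cv)
  finally show ?thesis by simp
qed

section \<open>The value of \<open>pi_p\<close> and the function \<open>T\<close>\<close>

lemma Gamma_reflection_real:
  fixes x :: real
  shows "Gamma x * Gamma (1 - x) = pi / sin (pi * x)"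
proof -
  have "complex_of_real (Gamma x * Gamma (1 - x)) = Gamma (of_real x) * Gamma (1 - of_real x)"
    by (simp add: Gamma_complex_of_real[symmetric])
  also have "\<dots> = of_real pi / sin (of_real pi * of_real x)" by (rule Gamma_reflection_complex)
  also have "\<dots> = complex_of_real (pi / sin (pi * x))"
    by (simp add: sin_of_real[symmetric])
  finally show ?thesis by (simp only: of_real_eq_iff)
qed

definition pi_p_integrand :: "real \<Rightarrow> real \<Rightarrow> real" where
  "pi_p_integrand p s = 1 / (1 + 1 / (p - 1) * s powr p)"

text \<open>The substitution s^p / (p - 1) = t / (1 - t), that is s = h(t), maps (0,1) onto the
  positive half-line and turns the integrand into 1 - t. What remains is a Beta integral with
  parameters 1/p and 1 - 1/p, evaluated by the reflection formula for Gamma.\<close>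

lemma pi_p_integrand_integral:
  assumes p: "p > 1"
  shows "pi_p_integrand p absolutely_integrable_on {0..}"
    and "integral {0..} (pi_p_integrand p) = pi * ((p - 1) powr (1 / p) / (p * sin (pi / p)))"
proof -
  define c where "c = (p - 1) powr (1 / p)"
  have c: "c > 0" "c powr p = p - 1" using p by (auto simp: c_def powr_powr)
  define h where "h t = c * (t / (1 - t)) powr (1 / p)" for t :: real
  define h' where "h' t = c * (1 / p * (t / (1 - t)) powr (1 / p - 1) * (1 / (1 - t)\<^sup>2))" for t :: real
  have dh: "(h has_field_derivative h' t) (at t within {0<..<1})" if t: "t \<in> {0<..<1}" for t
  proof -
    have 1: "((\<lambda>t. t / (1 - t)) has_real_derivative 1 / (1 - t)\<^sup>2) (at t within {0<..<1})"
      using t by (auto intro!: derivative_eq_intros simp: field_simps power2_eq_square)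
    have "((\<lambda>t. (t / (1 - t)) powr (1 / p)) has_real_derivative
        1 / p * (t / (1 - t)) powr (1 / p - 1) * (1 / (1 - t)\<^sup>2)) (at t within {0<..<1})"
      by (rule DERIV_chain2[OF has_real_derivative_powr 1]) (use t in auto)
    then show ?thesis unfolding h_def h'_def by (rule DERIV_cmult)
  qed
  have hp: "h t powr p = (p - 1) * (t / (1 - t))" if t: "t \<in> {0<..<1}" for t
    using t c p by (simp add: h_def powr_mult powr_powr)
  have inj: "inj_on h {0<..<1}"
  proof (rule inj_onI)
    fix s t :: real assume st: "s \<in> {0<..<1}" "t \<in> {0<..<1}" "h s = h t"
    have "(p - 1) * (s / (1 - s)) = (p - 1) * (t / (1 - t))"
      using hp[OF st(1)] hp[OF st(2)] st(3) by simp
    then have "s / (1 - s) = t / (1 - t)" using p by (subst (asm) mult_left_cancel) auto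
    then show "s = t" using st by (simp add: field_simps)
  qed
  have img: "h ` {0<..<1} = {0<..}"
  proof (intro equalityI subsetI)
    fix s :: real assume s: "s \<in> {0<..}"
    define z where "z = (s / c) powr p"
    have z: "z > 0" using s c by (simp add: z_def)
    have "z / (1 + z) / (1 - z / (1 + z)) = z" using z by (simp add: field_simps)
    then have "h (z / (1 + z)) = c * z powr (1 / p)" by (simp add: h_def)
    also have "\<dots> = s" using s c p by (simp add: z_def powr_powr)
    finally show "s \<in> h ` {0<..<1}" using z by (intro image_eqI[of _ _ "z / (1 + z)"]) auto
  qed (use c in \<open>auto simp: h_def\<close>)
  \<comment> \<open>The exponent \<open>1 - 1 / p - 1\<close> is left unsimplified to match the
    shape b - 1 of the Beta integrand.\<close>
  have eq: "\<bar>h' t\<bar> * pi_p_integrand p (h t) = c / p * (t powr (1 / p - 1) * (1 - t) powr (1 - 1 / p - 1))"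
    if t: "t \<in> {0<..<1}" for t
  proof -
    have "1 / (p - 1) * h t powr p = t / (1 - t)" unfolding hp[OF t] using p by simp
    then have "pi_p_integrand p (h t) = 1 / (1 + t / (1 - t))" by (simp only: pi_p_integrand_def)
    then have A: "pi_p_integrand p (h t) = 1 - t" using t by (simp add: field_simps)
    have B: "(t / (1 - t)) powr (1 / p - 1) * (1 / (1 - t)\<^sup>2) * (1 - t)
      = t powr (1 / p - 1) * (1 - t) powr (1 - 1 / p - 1)"
    proof -
      have "(1 - t) powr (1 - 1 / p - 1) = (1 - t) powr (- (1 / p - 1)) * (1 - t) powr (- 1)"
      proof -
        have "1 - 1 / p - 1 = - (1 / p - 1) + (- 1)" by simp
        then show ?thesis by (simp only: powr_add)
      qed
      also have "\<dots> = (1 - t) powr (- (1 / p - 1)) * (1 / (1 - t)\<^sup>2 * (1 - t))"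
      proof -
        have "(1 - t) powr (- 1) = 1 / (1 - t)\<^sup>2 * (1 - t)"
          using t by (simp add: powr_minus_divide power2_eq_square)
        then show ?thesis by (simp only:)
      qed
      finally have "(1 - t) powr (1 - 1 / p - 1) = (1 - t) powr (- (1 / p - 1)) * (1 / (1 - t)\<^sup>2 * (1 - t))" .
      moreover have "(t / (1 - t)) powr (1 / p - 1) = t powr (1 / p - 1) * (1 - t) powr (- (1 / p - 1))"
        using t by (subst powr_minus_divide) (simp add: powr_divide)
      ultimately show ?thesis by (simp only: mult_ac)
    qed
    have "\<bar>h' t\<bar> * pi_p_integrand p (h t)
      = c / p * ((t / (1 - t)) powr (1 / p - 1) * (1 / (1 - t)\<^sup>2) * (1 - t))"
      using c p unfolding A by (simp add: h'_def)
    then show ?thesis by (simp only: B)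
  qed
  have "((\<lambda>t. t powr (1 / p - 1) * (1 - t) powr (1 - 1 / p - 1)) has_integral Beta (1 / p) (1 - 1 / p)) {0..1}"
    by (rule has_integral_Beta_real) (use p in auto)
  then have "((\<lambda>t. c / p * (t powr (1 / p - 1) * (1 - t) powr (1 - 1 / p - 1))) has_integral c / p * Beta (1 / p) (1 - 1 / p)) {0<..<1}"
    by (intro has_integral_mult_right) (simp add: has_integral_Icc_iff_Ioo)
  then have HI: "((\<lambda>t. \<bar>h' t\<bar> * pi_p_integrand p (h t)) has_integral c / p * Beta (1 / p) (1 - 1 / p)) {0<..<1}"
    by (subst has_integral_cong[OF eq]) auto
  \<comment> \<open>The change of variables asks for absolute integrability, which for a nonnegative
    integrand is the same as integrability.\<close>
  have AI: "(\<lambda>t. \<bar>h' t\<bar> * pi_p_integrand p (h t)) absolutely_integrable_on {0<..<1}"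
  proof (rule nonnegative_absolutely_integrable_1)
    show "(\<lambda>t. \<bar>h' t\<bar> * pi_p_integrand p (h t)) integrable_on {0<..<1}" using HI by blast
    show "0 \<le> \<bar>h' t\<bar> * pi_p_integrand p (h t)" for t
      using p by (simp add: pi_p_integrand_def add_nonneg_nonneg)
  qed
  have res: "pi_p_integrand p absolutely_integrable_on {0<..} \<and>
    integral {0<..} (pi_p_integrand p) = c / p * Beta (1 / p) (1 - 1 / p)"
    using has_absolute_integral_change_of_variables_1'[of "{0<..<1}" h h' "pi_p_integrand p", OF _ dh inj]
      AI HI img by (auto simp: integral_unique)
  have neg: "negligible (sym_diff {0<..} {0::real..})"
    by (rule negligible_subset[of "{0}"]) auto
  show "pi_p_integrand p absolutely_integrable_on {0..}"
    using res absolutely_integrable_spike_set_eq[OF negligible_subset[OF neg] negligible_subset[OF neg]] by blast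
  have "integral {0..} (pi_p_integrand p) = integral {0<..} (pi_p_integrand p)"
    by (rule integral_spike_set) (auto intro: negligible_subset[OF neg])
  also have "\<dots> = c / p * Beta (1 / p) (1 - 1 / p)" using res by blast
  also have "Beta (1 / p) (1 - 1 / p) = pi / sin (pi / p)"
    using Gamma_reflection_real[of "1 / p"] by (simp add: Beta_def)
  finally show "integral {0..} (pi_p_integrand p) = pi * ((p - 1) powr (1 / p) / (p * sin (pi / p)))"
    by (simp add: c_def)
qed

lemma pi_p_eq_integral: "pi_p p = 2 * integral {0..} (pi_p_integrand p)"
  by (simp add: pi_p_def pi_p_integrand_def[abs_def])

lemma pi_p_eq:
  assumes "p > 1"
  shows "pi_p p = 2 * pi * ((p - 1) powr (1 / p) / (p * sin (pi / p)))"
  using pi_p_integrand_integral(2)[OF assms] by (simp add: pi_p_eq_integral)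

lemma pi_p_pos:
  assumes "p > 1"
  shows "pi_p p > 0"
proof -
  have "sin (pi / p) > 0" using assms by (intro sin_gt_zero) (auto simp: field_simps)
  then show ?thesis using assms by (simp add: pi_p_eq)
qed

text \<open>The solution of \<open>T' = 1 + T\<^sup>p / (p - 1)\<close> is the inverse of the integral defining \<open>pi_p\<close>.\<close>

lemma generalized_tangent_exists:
  assumes p: "p > 1"
  obtains T where "\<And>y. 0 < y \<Longrightarrow> y < pi_p p / 2 \<Longrightarrow> T y > 0"
    "\<And>y. 0 < y \<Longrightarrow> y < pi_p p / 2 \<Longrightarrow> (T has_real_derivative 1 + T y powr p / (p - 1)) (at y)"
proof -
  let ?f = "pi_p_integrand p"
  define F where "F x = integral {0..x} ?f" for x
  have f_pos: "?f x > 0" for x using p by (simp add: pi_p_integrand_def add_pos_nonneg)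
  have den: "1 + 1 / (p - 1) * x powr p \<noteq> 0" for x :: real
    using p by (metis add_pos_nonneg divide_nonneg_pos diff_gt_0_iff_gt less_irrefl mult_nonneg_nonneg powr_ge_zero zero_less_one zero_le_one)
  have cont: "continuous_on {0..b} ?f" for b
    unfolding pi_p_integrand_def[abs_def] using p den
    by (intro continuous_intros continuous_on_powr') auto
  have dF': "(F has_real_derivative ?f x) (at x within {0..b})" if "x \<in> {0..b}" for x b
    unfolding F_def by (rule integral_has_real_derivative[OF cont that])
  have dF: "(F has_real_derivative ?f x) (at x)" if "x > 0" for x
    using dF'[of x "x + 1"] that by (simp add: at_within_Icc_at)
  have F_less: "F x < F y" if "0 < x" "x < y" for x y
    using that dF f_pos by (intro DERIV_pos_imp_increasing[OF that(2)]) (metis less_le_trans)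
  have inj: "inj_on F {0<..}"
    by (rule linorder_inj_onI) (use F_less in force, auto)
  \<comment> \<open>\<open>F\<close> increases to \<open>pi_p p / 2\<close> at infinity, so its
    inverse \<open>T\<close> is defined on the whole interval from 0 to
    \<open>pi_p p / 2\<close>.\<close>
  have "((\<lambda>b. set_lebesgue_integral lebesgue {0..b} ?f) \<longlongrightarrow> set_lebesgue_integral lebesgue {0..} ?f) at_top"
    using pi_p_integrand_integral(1)[OF p] by (intro tendsto_set_lebesgue_integral_at_top) auto
  moreover have "set_lebesgue_integral lebesgue {0..b} ?f = F b" for b
    unfolding F_def
    by (intro set_lebesgue_integral_eq_integral set_integrable_subset[OF pi_p_integrand_integral(1)[OF p]]) auto
  moreover have "set_lebesgue_integral lebesgue {0..} ?f = pi_p p / 2"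
    using set_lebesgue_integral_eq_integral(2)[OF pi_p_integrand_integral(1)[OF p]] by (simp add: pi_p_eq_integral)
  ultimately have lim: "(F \<longlongrightarrow> pi_p p / 2) at_top" by simp
  define T where "T = inv_into {0<..} F"
  have TF: "T (F x) = x" if "x > 0" for x
    unfolding T_def using that by (simp add: inv_into_f_f[OF inj])
  have ex: "y \<in> F ` {0<..}" if y: "0 < y" "y < pi_p p / 2" for y
  proof -
    have "\<forall>\<^sub>F b in at_top. y < F b" using lim y(2) by (rule order_tendstoD)
    then obtain b where b: "b > 0" "y < F b"
      using eventually_happens'[OF trivial_limit_at_top_linorder eventually_conj[OF _ eventually_gt_at_top[of 0]]] by blast
    have F0: "F 0 = 0" by (simp add: F_def)
    have "\<exists>x\<ge>0. x \<le> b \<and> F x = y"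
      using b y F0 by (intro IVT' DERIV_continuous_on[OF dF']) auto
    then obtain x where "0 \<le> x" "F x = y" by blast
    then show ?thesis using F0 y by (intro image_eqI[of _ _ x]) (auto simp: less_le)
  qed
  have T: "T y > 0" "F (T y) = y" if "0 < y" "y < pi_p p / 2" for y
    using inv_into_into[OF ex[OF that]] f_inv_into_f[OF ex[OF that]] by (auto simp: T_def)
  show thesis
  proof (rule that)
    show "T y > 0" if "0 < y" "y < pi_p p / 2" for y using T(1)[OF that] .
    show "(T has_real_derivative 1 + T y powr p / (p - 1)) (at y)" if y: "0 < y" "y < pi_p p / 2" for y
    proof -
      \<comment> \<open>The inverse function rule presupposes continuity of the inverse. The radius
        \<open>T y / 2\<close> keeps \<open>z\<close> positive, where \<open>T\<close> inverts
        \<open>F\<close>.\<close>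
      have "isCont T (F (T y))"
      proof (rule isCont_inverse_function[where f = F and g = T and x = "T y" and d = "T y / 2"])
        fix z assume "\<bar>z - T y\<bar> \<le> T y / 2"
        then have "z > 0" using T(1)[OF y] by linarith
        then show "T (F z) = z" "isCont F z" using TF DERIV_isCont[OF dF] by auto
      qed (use T(1)[OF y] in simp)
      then have "isCont T y" using T(2)[OF y] by simp
      then have "(T has_real_derivative inverse (?f (T y))) (at y)"
        by (intro DERIV_inverse_function[OF dF[OF T(1)[OF y]] _ y T(2)]) (use f_pos[of "T y"] in auto)
      then show ?thesis by (simp add: pi_p_integrand_def)
    qed
  qed
qed

lemma integral_reflect_about:
  fixes f :: "real \<Rightarrow> real"
  assumes "continuous_on {a..b} f"
  shows "integral {a..b} f = integral {c - b..c - a} (\<lambda>x. f (c - x))"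
proof -
  have "(f has_integral integral {a..b} f) (cbox a b)"
    using integrable_integral[OF integrable_continuous_interval[OF assms]] by simp
  from has_integral_affinity[OF this, of "-1" c]
  have "((\<lambda>x. f (c - x)) has_integral integral {a..b} f) ((\<lambda>x. c - x) ` {a..b})"
    by simp
  then show ?thesis by (simp add: integral_unique)
qed

text \<open>Each half starts at a zero of \<open>v\<close>: the right half directly, the left half
  after the reflection \<open>L - x\<close>, under which the weight is invariant. Only the right
  half therefore needs a monotone weight.\<close>

lemma weighted_odd_inequality:
  fixes v v' w w' :: "real \<Rightarrow> real"
  assumes p: "p > 1" and L: "0 < e" "e < L / 2"
    and v: "\<And>x. x \<in> {e..L - e} \<Longrightarrow> (v has_real_derivative v' x) (at x within {e..L - e})"
      "continuous_on {e..L - e} v'" "v (L / 2) = 0"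
    and w: "\<And>x. x \<in> {e..L - e} \<Longrightarrow> (w has_real_derivative w' x) (at x within {e..L - e})"
      "\<And>x. x \<in> {e..L - e} \<Longrightarrow> w x \<ge> 0" "\<And>x. x \<in> {L / 2..L - e} \<Longrightarrow> w' x \<le> 0"
      "\<And>x. x \<in> {e..L - e} \<Longrightarrow> w (L - x) = w x"
  shows "integral {e..L - e} (\<lambda>x. (pi_p p / L) powr p * \<bar>v x\<bar> powr p * w x)
    \<le> integral {e..L - e} (\<lambda>x. \<bar>v' x\<bar> powr p * w x)"
proof -
  define \<mu> where "\<mu> = pi_p p / L"
  have \<mu>: "\<mu> > 0" "\<mu> * L = pi_p p" using pi_p_pos[OF p] L by (auto simp: \<mu>_def)
  obtain T where T: "\<And>y. 0 < y \<Longrightarrow> y < pi_p p / 2 \<Longrightarrow> T y > 0"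
    "\<And>y. 0 < y \<Longrightarrow> y < pi_p p / 2 \<Longrightarrow> (T has_real_derivative 1 + T y powr p / (p - 1)) (at y)"
    using generalized_tangent_exists[OF p] by blast
  \<comment> \<open>The shift by \<open>e / 2\<close> sends the half interval to the range from
    \<mu> e / 2 to \<mu> (L - e) / 2, strictly inside (0, pi_p / 2): \<open>T\<close> is neither
    zero nor infinite there.\<close>
  define \<theta> where "\<theta> x = \<mu> * (x - L / 2 + e / 2)" for x
  have \<theta>: "0 < \<theta> x" "\<theta> x < pi_p p / 2" if "x \<in> {L / 2..L - e}" for x
  proof -
    show "0 < \<theta> x" using that \<mu>(1) L unfolding \<theta>_def by (intro mult_pos_pos) auto
    have "\<theta> x < \<mu> * (L / 2)" using that \<mu>(1) L unfolding \<theta>_def by (intro mult_strict_left_mono) auto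
    then show "\<theta> x < pi_p p / 2" using \<mu>(2) by simp
  qed
  \<comment> \<open>Dividing by \<open>\<mu>\<close> cancels the inner derivative of
    \<open>\<theta>\<close>, so the equation acquires the factor \<open>\<mu> powr p\<close> and
    nothing else changes.\<close>
  define S where "S x = T (\<theta> x) / \<mu>" for x
  have S: "S x > 0" "(S has_real_derivative 1 + \<mu> powr p * S x powr p / (p - 1)) (at x within X)"
    if x: "x \<in> {L / 2..L - e}" for x X
  proof -
    show "S x > 0" using T(1)[OF \<theta>[OF x]] \<mu>(1) by (simp add: S_def)
    have "(\<theta> has_real_derivative \<mu>) (at x)"
      unfolding \<theta>_def[abs_def] by (auto intro!: derivative_eq_intros)
    from DERIV_cdivide[OF DERIV_chain2[OF T(2)[OF \<theta>[OF x]] this], of \<mu>]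
    have "(S has_real_derivative 1 + T (\<theta> x) powr p / (p - 1)) (at x)"
      using \<mu>(1) by (simp add: S_def[abs_def])
    moreover have "T (\<theta> x) powr p = \<mu> powr p * S x powr p"
      using \<mu>(1) T(1)[OF \<theta>[OF x]] by (simp add: S_def powr_divide)
    ultimately show "(S has_real_derivative 1 + \<mu> powr p * S x powr p / (p - 1)) (at x within X)"
      by (simp add: has_field_derivative_at_within)
  qed
  have sub: "{L / 2..L - e} \<subseteq> {e..L - e}" "{e..L / 2} \<subseteq> {e..L - e}" using L by auto
  have wR: "(w has_real_derivative w' x) (at x within {L / 2..L - e})" if "x \<in> {L / 2..L - e}" for x
    using that sub by (intro DERIV_subset[OF w(1)]) auto
  have R: "integral {L / 2..L - e} (\<lambda>x. \<mu> powr p * \<bar>v x\<bar> powr p * w x)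
    \<le> integral {L / 2..L - e} (\<lambda>x. \<bar>v' x\<bar> powr p * w x)"
  proof (rule weighted_inequality_vanishing_left[where T = S and w' = w', OF p])
    show "(v has_real_derivative v' x) (at x within {L / 2..L - e})" if "x \<in> {L / 2..L - e}" for x
      using that sub by (intro DERIV_subset[OF v(1)]) auto
      show "L / 2 \<le> L - e" using L by simp
    show "0 \<le> w x" if "x \<in> {L / 2..L - e}" for x using that sub by (intro w(2)) auto
    show "continuous_on {L / 2..L - e} v'" by (rule continuous_on_subset[OF v(2) sub(1)])
  qed (fact wR w(3) S v(3))+
  have Lft: "integral {L / 2..L - e} (\<lambda>x. \<mu> powr p * \<bar>v (L - x)\<bar> powr p * w x)
    \<le> integral {L / 2..L - e} (\<lambda>x. \<bar>- v' (L - x)\<bar> powr p * w x)"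
  proof (rule weighted_inequality_vanishing_left[where T = S and w' = w', OF p])
    show "((\<lambda>x. v (L - x)) has_real_derivative - v' (L - x)) (at x within {L / 2..L - e})"
      if "x \<in> {L / 2..L - e}" for x
    proof -
      have "L - x \<in> {e..L - e}" using that L by auto
      note dv = v(1)[OF this]
      have "((-) L has_real_derivative - 1) (at x within {L / 2..L - e})"
        by (auto intro!: derivative_eq_intros)
      moreover have "(v has_real_derivative v' (L - x)) (at (L - x) within (-) L ` {L / 2..L - e})"
        by (rule DERIV_subset[OF dv]) (use L in auto)
      ultimately show ?thesis using DERIV_image_chain[of v "v' (L - x)" "(-) L" x "{L / 2..L - e}" "- 1"]
        by (simp add: o_def)
    qed
    show "continuous_on {L / 2..L - e} (\<lambda>x. - v' (L - x))"
      by (intro continuous_intros continuous_on_compose2[OF v(2)]) (use L in auto)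
      show "L / 2 \<le> L - e" "v (L - L / 2) = 0" using L v(3) by auto
    show "0 \<le> w x" if "x \<in> {L / 2..L - e}" for x using that sub by (intro w(2)) auto
  qed (fact wR w(3) S)+
  have cont: "continuous_on {e..L - e} (\<lambda>x. \<mu> powr p * \<bar>v x\<bar> powr p * w x)"
    "continuous_on {e..L - e} (\<lambda>x. \<bar>v' x\<bar> powr p * w x)"
  proof -
    have "continuous_on {e..L - e} v" "continuous_on {e..L - e} w"
      by (rule DERIV_continuous_on, rule v(1), simp) (rule DERIV_continuous_on, rule w(1), simp)
    then show "continuous_on {e..L - e} (\<lambda>x. \<mu> powr p * \<bar>v x\<bar> powr p * w x)"
      "continuous_on {e..L - e} (\<lambda>x. \<bar>v' x\<bar> powr p * w x)"
      by (intro continuous_intros continuous_on_abs_powr[OF p] v(2); simp)+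
  qed
  have split: "integral {e..L - e} f = integral {L / 2..L - e} (\<lambda>x. f (L - x)) + integral {L / 2..L - e} f"
    if "continuous_on {e..L - e} f" for f :: "real \<Rightarrow> real"
  proof -
    have "integral {e..L - e} f = integral {e..L / 2} f + integral {L / 2..L - e} f"
      using L by (intro Henstock_Kurzweil_Integration.integral_combine[symmetric] integrable_continuous_interval that) auto
    also have "integral {e..L / 2} f = integral {L - L / 2..L - e} (\<lambda>x. f (L - x))"
      by (rule integral_reflect_about) (rule continuous_on_subset[OF that sub(2)])
    finally show ?thesis by simp
  qed
  have wL: "w (L - x) = w x" if "x \<in> {L / 2..L - e}" for x using w(4) sub that by auto
  have "integral {L / 2..L - e} (\<lambda>x. \<mu> powr p * \<bar>v (L - x)\<bar> powr p * w (L - x))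
      \<le> integral {L / 2..L - e} (\<lambda>x. \<bar>v' (L - x)\<bar> powr p * w (L - x))"
  proof -
    have "integral {L / 2..L - e} (\<lambda>x. f x * w (L - x)) = integral {L / 2..L - e} (\<lambda>x. f x * w x)" for f
      by (rule Henstock_Kurzweil_Integration.integral_cong) (simp add: wL del: atLeastAtMost_iff)
    then show ?thesis using Lft by simp
  qed
  then show ?thesis
    unfolding \<mu>_def[symmetric] split[OF cont(1)] split[OF cont(2)] using R by (rule add_mono)
qed

section \<open>Change of variables in the plane\<close>

lemma nn_integral_compact_continuous:
  fixes f :: "'a::euclidean_space \<Rightarrow> real"
  assumes "compact K" "continuous_on K f" "\<And>x. x \<in> K \<Longrightarrow> f x \<ge> 0"
  shows "(\<integral>\<^sup>+x. ennreal (f x) * indicator K x \<partial>lborel) = ennreal (integral K f)"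
proof -
  have si: "set_integrable lborel K f"
    unfolding set_integrable_def by (rule borel_integrable_compact[OF assms(1,2)])
  have "(\<integral>\<^sup>+x. ennreal (f x) * indicator K x \<partial>lborel) = (\<integral>\<^sup>+x. ennreal (indicator K x *\<^sub>R f x) \<partial>lborel)"
    by (intro nn_integral_cong) (auto simp: indicator_def)
  also have "\<dots> = ennreal (LINT x|lborel. indicator K x *\<^sub>R f x)"
    using si assms(3) unfolding set_integrable_def
    by (intro nn_integral_eq_integral) (auto simp: indicator_def)
  also have "(LINT x|lborel. indicator K x *\<^sub>R f x) = integral K f"
    using set_borel_integral_eq_integral(2)[OF si] by (simp add: set_lebesgue_integral_def)
  finally show ?thesis .
qed

text \<open>The change of variables theorem of the library is available only for \<open>real^'n\<close>.\<close>

definition pair_of_vec :: "real^2 \<Rightarrow> real \<times> real" where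
  "pair_of_vec v = (v $ 1, v $ 2)"

definition vec_of_pair :: "real \<times> real \<Rightarrow> real^2" where
  "vec_of_pair z = (\<chi> i. if i = 1 then fst z else snd z)"

lemma vec_of_pair_nth [simp]: "vec_of_pair z $ 1 = fst z" "vec_of_pair z $ 2 = snd z"
  by (simp_all add: vec_of_pair_def)

lemma pair_of_vec_inverse [simp]: "vec_of_pair (pair_of_vec v) = v" "pair_of_vec (vec_of_pair z) = z"
  by (auto simp: vec_eq_iff forall_2 pair_of_vec_def)

lemma bounded_linear_pair_of_vec: "bounded_linear pair_of_vec"
  unfolding linear_conv_bounded_linear[symmetric] by (rule linearI) (auto simp: pair_of_vec_def)

lemma bounded_linear_vec_of_pair: "bounded_linear vec_of_pair"
  unfolding linear_conv_bounded_linear[symmetric] by (rule linearI) (auto simp: vec_eq_iff forall_2)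

lemma continuous_on_pair_of_vec: "continuous_on S pair_of_vec"
  by (rule linear_continuous_on[OF bounded_linear_pair_of_vec])

lemma continuous_on_vec_of_pair: "continuous_on S vec_of_pair"
  by (rule linear_continuous_on[OF bounded_linear_vec_of_pair])

lemma measurable_pair_of_vec: "pair_of_vec \<in> borel_measurable borel"
  using continuous_on_pair_of_vec by (rule borel_measurable_continuous_onI)

text \<open>Lebesgue measure is determined by its values on boxes, and relabelling coordinates keeps
  the side lengths of a box.\<close>

lemma distr_lborel_pair_of_vec: "distr lborel borel pair_of_vec = lborel"
proof (rule lborel_eqI[symmetric])
  fix l u :: "real \<times> real" assume le: "\<And>b. b \<in> Basis \<Longrightarrow> l \<bullet> b \<le> u \<bullet> b"
  have le': "fst l \<le> fst u" "snd l \<le> snd u" using le[of "(1, 0)"] le[of "(0, 1)"]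
    by (auto simp: Basis_prod_def inner_prod_def)
  have [measurable]: "pair_of_vec \<in> borel_measurable lborel" using measurable_pair_of_vec by simp
  have B2: "(Basis :: (real^2) set) = {axis 1 1, axis 2 1}" by (auto simp: Basis_vec_def UNIV_2)
  have ne: "axis 1 1 \<noteq> (axis 2 1 :: real^2)" by (simp add: axis_eq_axis)
  have Bp: "(Basis :: (real \<times> real) set) = {(1, 0), (0, 1)}" by (auto simp: Basis_prod_def)
  have "pair_of_vec -` box l u = box (vec_of_pair l) (vec_of_pair u)"
    by (auto simp: pair_of_vec_def mem_box B2 Bp inner_axis inner_prod_def)
  then have "emeasure (distr lborel borel pair_of_vec) (box l u) = emeasure lborel (box (vec_of_pair l) (vec_of_pair u))"
    by (subst emeasure_distr) auto
  also have "\<dots> = ennreal (\<Prod>b\<in>Basis. (vec_of_pair u - vec_of_pair l) \<bullet> b)"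
    by (rule emeasure_lborel_box) (auto simp: B2 inner_axis le')
  also have "(\<Prod>b\<in>Basis. (vec_of_pair u - vec_of_pair l) \<bullet> b) = (\<Prod>b\<in>Basis. (u - l) \<bullet> b)"
    by (simp add: B2 Bp ne inner_axis inner_prod_def)
  finally show "emeasure (distr lborel borel pair_of_vec) (box l u) = (\<Prod>b\<in>Basis. (u - l) \<bullet> b)" .
qed simp

lemma nn_integral_prod_eq_integral_vec:
  fixes f :: "real \<times> real \<Rightarrow> real"
  assumes "compact K" "continuous_on K f" "\<And>x. x \<in> K \<Longrightarrow> f x \<ge> 0"
  shows "(\<integral>\<^sup>+z. ennreal (f z) * indicator K z \<partial>lborel)
    = ennreal (integral (vec_of_pair ` K) (\<lambda>v. f (pair_of_vec v)))"
proof -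
  have [measurable]: "K \<in> sets borel" using assms(1) by (simp add: borel_compact)
  have fK: "(\<lambda>x. indicator K x *\<^sub>R f x) \<in> borel_measurable borel"
    by (rule borel_measurable_continuous_on_indicator) (use assms in auto)
  have "(\<lambda>z. ennreal (f z) * indicator K z) = (\<lambda>z. ennreal (indicator K z *\<^sub>R f z))"
    by (auto simp: indicator_def)
  then have [measurable]: "(\<lambda>z. ennreal (f z) * indicator K z) \<in> borel_measurable borel"
    using fK by simp
  have "(\<integral>\<^sup>+z. ennreal (f z) * indicator K z \<partial>lborel)
    = (\<integral>\<^sup>+z. ennreal (f z) * indicator K z \<partial>distr lborel borel pair_of_vec)"
    by (simp add: distr_lborel_pair_of_vec)
  also have "\<dots> = (\<integral>\<^sup>+v. ennreal (f (pair_of_vec v)) * indicator K (pair_of_vec v) \<partial>lborel)"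
    by (subst nn_integral_distr) (use measurable_pair_of_vec in auto)
  also have "\<dots> = (\<integral>\<^sup>+v. ennreal (f (pair_of_vec v)) * indicator (vec_of_pair ` K) v \<partial>lborel)"
  proof (rule nn_integral_cong)
    fix v
    have "pair_of_vec v \<in> K \<longleftrightarrow> v \<in> vec_of_pair ` K" by (metis image_iff pair_of_vec_inverse)
    then show "ennreal (f (pair_of_vec v)) * indicator K (pair_of_vec v)
      = ennreal (f (pair_of_vec v)) * indicator (vec_of_pair ` K) v" by (simp add: indicator_def)
  qed
  also have "\<dots> = ennreal (integral (vec_of_pair ` K) (\<lambda>v. f (pair_of_vec v)))"
  proof (rule nn_integral_compact_continuous)
    show "compact (vec_of_pair ` K)"
      by (intro compact_continuous_image continuous_on_vec_of_pair assms)
    show "continuous_on (vec_of_pair ` K) (\<lambda>v. f (pair_of_vec v))"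
      by (rule continuous_on_compose2[OF assms(2) continuous_on_pair_of_vec]) auto
  qed (use assms(3) in auto)
  finally show ?thesis .
qed

text \<open>Conjugates \<open>\<Psi>\<close> with the two coordinate conversions, which preserve
  measure. The determinant is spelled out through the images of (1,0) and (0,1), the columns of the
  matrix.\<close>

lemma nn_integral_change_of_variables_prod:
  fixes \<Psi> :: "real \<times> real \<Rightarrow> real \<times> real" and f :: "real \<times> real \<Rightarrow> real"
  assumes S: "compact S" "inj_on \<Psi> S"
    and d: "\<And>z. z \<in> S \<Longrightarrow> (\<Psi> has_derivative \<Psi>' z) (at z within S)"
    and J: "\<And>z. z \<in> S \<Longrightarrow> \<bar>fst (\<Psi>' z (1, 0)) * snd (\<Psi>' z (0, 1)) - fst (\<Psi>' z (0, 1)) * snd (\<Psi>' z (1, 0))\<bar> = J z"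
      "continuous_on S J"
    and f: "continuous_on (\<Psi> ` S) f" "\<And>z. z \<in> \<Psi> ` S \<Longrightarrow> f z \<ge> 0"
  shows "(\<integral>\<^sup>+z. ennreal (f z) * indicator (\<Psi> ` S) z \<partial>lborel) = ennreal (integral S (\<lambda>z. J z * f (\<Psi> z)))"
proof -
  define g where "g v = vec_of_pair (\<Psi> (pair_of_vec v))" for v
  define g' where "g' v h = vec_of_pair (\<Psi>' (pair_of_vec v) (pair_of_vec h))" for v h
  \<comment> \<open>Values in \<open>real^1\<close> fit the vector-valued form of the change of
    variables; component 1 recovers the scalar integral.\<close>
  define F :: "real^2 \<Rightarrow> real^1" where "F v = vec (f (pair_of_vec v))" for v
  define S2 where "S2 = vec_of_pair ` S"
  have cS2: "compact S2" unfolding S2_def by (intro compact_continuous_image continuous_on_vec_of_pair S)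
  have gS2: "g ` S2 = vec_of_pair ` \<Psi> ` S" by (auto simp: g_def S2_def image_image)
  have cont\<Psi>: "continuous_on S \<Psi>" using d by (intro differentiable_imp_continuous_on) (auto simp: differentiable_on_def differentiable_def)
  have c\<Psi>S: "compact (\<Psi> ` S)" by (rule compact_continuous_image[OF cont\<Psi> S(1)])
  have dg: "(g has_derivative g' v) (at v within S2)" if "v \<in> S2" for v
  proof -
    have pv: "pair_of_vec v \<in> S" "pair_of_vec ` S2 = S" using that by (auto simp: S2_def image_image)
    have "(pair_of_vec has_derivative pair_of_vec) (at v within S2)"
      by (rule bounded_linear_imp_has_derivative[OF bounded_linear_pair_of_vec])
    moreover have "(\<Psi> has_derivative \<Psi>' (pair_of_vec v)) (at (pair_of_vec v) within pair_of_vec ` S2)"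
      using d[OF pv(1)] pv(2) by simp
    ultimately have "((\<lambda>v. \<Psi> (pair_of_vec v)) has_derivative (\<lambda>h. \<Psi>' (pair_of_vec v) (pair_of_vec h))) (at v within S2)"
      by (rule has_derivative_in_compose)
    from bounded_linear.has_derivative[OF bounded_linear_vec_of_pair this]
    show ?thesis unfolding g_def g'_def .
  qed
  have inj: "inj_on g S2"
    unfolding g_def S2_def by (rule inj_onI) (metis (no_types, lifting) S(2) image_iff inj_onD pair_of_vec_inverse)
  have det: "\<bar>det (matrix (g' v))\<bar> = J (pair_of_vec v)" if "v \<in> S2" for v
  proof -
    have ax: "pair_of_vec (axis 1 1) = (1, 0)" "pair_of_vec (axis 2 1) = (0, 1)"
      by (auto simp: pair_of_vec_def axis_def)
    have "pair_of_vec v \<in> S" using that by (auto simp: S2_def)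
    from J(1)[OF this] show ?thesis
      by (simp add: det_2 matrix_def g'_def ax)
  qed
  have cF: "continuous_on (g ` S2) (\<lambda>v. f (pair_of_vec v))"
    unfolding gS2 by (rule continuous_on_compose2[OF f(1) continuous_on_pair_of_vec]) auto
  have "compact (g ` S2)" unfolding gS2
    by (intro compact_continuous_image continuous_on_vec_of_pair c\<Psi>S)
  have "continuous_on (g ` S2) F"
    unfolding F_def by (subst continuous_on_componentwise) (auto simp: Basis_vec_def inner_axis cF)
  then have "F absolutely_integrable_on (g ` S2)"
  proof -
    have "set_integrable lborel (g ` S2) F"
      unfolding set_integrable_def by (rule borel_integrable_compact) fact+
    then show ?thesis unfolding set_integrable_def
      by (subst integrable_completion) auto
  qed
  then have AI: "(\<lambda>v. \<bar>det (matrix (g' v))\<bar> *\<^sub>R F (g v)) absolutely_integrable_on S2"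
    and eq: "integral (g ` S2) F = integral S2 (\<lambda>v. \<bar>det (matrix (g' v))\<bar> *\<^sub>R F (g v))"
    using has_absolute_integral_change_of_variables_compact[OF cS2 dg inj, of F] by blast+
  have "integral (g ` S2) (\<lambda>v. f (pair_of_vec v)) = integral (g ` S2) F $ 1"
    using integral_component_eq_cart[OF set_lebesgue_integral_eq_integral(1)[OF \<open>F absolutely_integrable_on (g ` S2)\<close>], of 1]
    by (simp add: F_def)
  also have "\<dots> = integral S2 (\<lambda>v. (\<bar>det (matrix (g' v))\<bar> *\<^sub>R F (g v)) $ 1)"
    unfolding eq by (rule integral_component_eq_cart[OF set_lebesgue_integral_eq_integral(1)[OF AI], symmetric])
  also have "\<dots> = integral S2 (\<lambda>v. J (pair_of_vec v) * f (\<Psi> (pair_of_vec v)))"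
    by (rule Henstock_Kurzweil_Integration.integral_cong) (simp add: det F_def g_def)
  finally have eq2: "integral (vec_of_pair ` \<Psi> ` S) (\<lambda>v. f (pair_of_vec v))
    = integral (vec_of_pair ` S) (\<lambda>v. J (pair_of_vec v) * f (\<Psi> (pair_of_vec v)))"
    unfolding gS2 by (simp add: S2_def)
  have J0: "J z \<ge> 0" if "z \<in> S" for z using J(1)[OF that] by auto
  have cJf: "continuous_on S (\<lambda>z. J z * f (\<Psi> z))"
    by (intro continuous_intros J(2) continuous_on_compose2[OF f(1) cont\<Psi>]) auto
  have "(\<integral>\<^sup>+z. ennreal (f z) * indicator (\<Psi> ` S) z \<partial>lborel)
    = ennreal (integral (vec_of_pair ` S) (\<lambda>v. J (pair_of_vec v) * f (\<Psi> (pair_of_vec v))))"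
    unfolding eq2[symmetric] by (rule nn_integral_prod_eq_integral_vec[OF c\<Psi>S f(1,2)])
  also have "\<dots> = (\<integral>\<^sup>+z. ennreal (J z * f (\<Psi> z)) * indicator S z \<partial>lborel)"
    by (rule nn_integral_prod_eq_integral_vec[OF S(1) cJf, symmetric]) (use J0 f(2) in auto)
  also have "\<dots> = ennreal (integral S (\<lambda>z. J z * f (\<Psi> z)))"
    by (rule nn_integral_compact_continuous[OF S(1) cJf]) (use J0 f(2) in auto)
  finally show ?thesis .
qed

section \<open>Geometry of the strip\<close>

lemma at_within_Icc_nontrivial:
  fixes s L :: real
  assumes "L > 0" "s \<in> {0..L}"
  shows "at s within {0..L} \<noteq> bot"
  using assms by (simp add: trivial_limit_within islimpt_Icc)

lemma curve_deriv_eqI: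
  fixes f :: "real \<Rightarrow> 'a::real_normed_vector"
  assumes "L > 0" "s \<in> {0..L}" "(f has_vector_derivative D) (at s within {0..L})"
  shows "curve_deriv L f s = D"
  unfolding curve_deriv_def
  by (rule vector_derivative_within[OF at_within_Icc_nontrivial[OF assms(1,2)] assms(3)])

text \<open>Smoothness is stated for the iterated vector derivative of the plane curve, curvature
  through iterated derivatives of the two coordinates. The families \<open>X n\<close> and
  \<open>Y n\<close> reconcile the two; the agreement is needed only on \<open>{0..L}\<close>, hence
  the transformations within that set.\<close>

lemma curve_derivatives_of_smooth_curve:
  fixes \<gamma> :: "real \<Rightarrow> real \<times> real"
  assumes L: "L > 0" and smooth: "smooth_curve L \<gamma>"
  obtains X Y where "\<And>s. X 0 s = fst (\<gamma> s)" "\<And>s. Y 0 s = snd (\<gamma> s)"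
    "\<And>n s. s \<in> {0..L} \<Longrightarrow> (X n has_real_derivative X (Suc n) s) (at s within {0..L})"
    "\<And>n s. s \<in> {0..L} \<Longrightarrow> (Y n has_real_derivative Y (Suc n) s) (at s within {0..L})"
    "\<And>s. s \<in> {0..L} \<Longrightarrow> curve_deriv L \<gamma> s = (X 1 s, Y 1 s)"
    "\<And>s. s \<in> {0..L} \<Longrightarrow> curve_deriv L (\<lambda>t. fst (\<gamma> t)) s = X 1 s"
    "\<And>s. s \<in> {0..L} \<Longrightarrow> curve_deriv L (\<lambda>t. snd (\<gamma> t)) s = Y 1 s"
    "\<And>s. s \<in> {0..L} \<Longrightarrow> signed_curvature L \<gamma> s = X 1 s * Y 2 s - X 2 s * Y 1 s"
proof -
  define g where "g n = (curve_deriv L ^^ n) \<gamma>" for n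
  define X where "X n s = fst (g n s)" for n s
  define Y where "Y n s = snd (g n s)" for n s
  have dg: "(g n has_vector_derivative g (Suc n) s) (at s within {0..L})" if "s \<in> {0..L}" for n s
    using smooth that unfolding smooth_curve_def g_def
    by (simp add: vector_derivative_works curve_deriv_def)
  have dX: "(X n has_real_derivative X (Suc n) s) (at s within {0..L})" if "s \<in> {0..L}" for n s
    unfolding X_def[abs_def] has_real_derivative_iff_has_vector_derivative
    using bounded_linear.has_vector_derivative[OF bounded_linear_fst dg[OF that, of n]] .
  have dY: "(Y n has_real_derivative Y (Suc n) s) (at s within {0..L})" if "s \<in> {0..L}" for n s
    unfolding Y_def[abs_def] has_real_derivative_iff_has_vector_derivative
    using bounded_linear.has_vector_derivative[OF bounded_linear_snd dg[OF that, of n]] .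
  have X0: "X 0 s = fst (\<gamma> s)" and Y0: "Y 0 s = snd (\<gamma> s)" for s by (auto simp: X_def Y_def g_def)
  have cx: "curve_deriv L (\<lambda>t. fst (\<gamma> t)) s = X 1 s" if "s \<in> {0..L}" for s
    using dX[OF that, of 0] by (intro curve_deriv_eqI[OF L that])
      (simp add: X0[symmetric] has_real_derivative_iff_has_vector_derivative)
  have cy: "curve_deriv L (\<lambda>t. snd (\<gamma> t)) s = Y 1 s" if "s \<in> {0..L}" for s
    using dY[OF that, of 0] by (intro curve_deriv_eqI[OF L that])
      (simp add: Y0[symmetric] has_real_derivative_iff_has_vector_derivative)
  have cx2: "curve_deriv L (curve_deriv L (\<lambda>t. fst (\<gamma> t))) s = X 2 s" if "s \<in> {0..L}" for s
  proof (rule curve_deriv_eqI[OF L that])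
    show "(curve_deriv L (\<lambda>t. fst (\<gamma> t)) has_vector_derivative X 2 s) (at s within {0..L})"
    proof (rule has_vector_derivative_transform[OF that])
      show "(X 1 has_vector_derivative X 2 s) (at s within {0..L})"
        using dX[OF that, of 1] unfolding has_real_derivative_iff_has_vector_derivative
        by (simp only: Suc_1)
    qed (rule cx)
  qed
  have cy2: "curve_deriv L (curve_deriv L (\<lambda>t. snd (\<gamma> t))) s = Y 2 s" if "s \<in> {0..L}" for s
  proof (rule curve_deriv_eqI[OF L that])
    show "(curve_deriv L (\<lambda>t. snd (\<gamma> t)) has_vector_derivative Y 2 s) (at s within {0..L})"
    proof (rule has_vector_derivative_transform[OF that])
      show "(Y 1 has_vector_derivative Y 2 s) (at s within {0..L})"
        using dY[OF that, of 1] unfolding has_real_derivative_iff_has_vector_derivative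
        by (simp only: Suc_1)
    qed (rule cy)
  qed
  show thesis
  proof (rule that[of X Y])
    show "curve_deriv L \<gamma> s = (X 1 s, Y 1 s)" if "s \<in> {0..L}" for s
      by (simp add: X_def Y_def g_def)
    show "signed_curvature L \<gamma> s = X 1 s * Y 2 s - X 2 s * Y 1 s" if "s \<in> {0..L}" for s
      using cx[OF that] cy[OF that] cx2[OF that] cy2[OF that] by (simp add: signed_curvature_def)
  qed (use X0 Y0 dX dY cx cy in auto)
qed

text \<open>The chain rule applied to the symmetry, with c = 1 for functions even about L / 2 and c
  = -1 for odd ones. It includes the endpoints, where reflection exchanges the two one-sided
  derivatives.\<close>

lemma reflected_derivative:
  fixes f f' :: "real \<Rightarrow> real"
  assumes L: "L > 0" and d: "\<And>s. s \<in> {0..L} \<Longrightarrow> (f has_real_derivative f' s) (at s within {0..L})"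
    and sym: "\<And>s. s \<in> {0..L} \<Longrightarrow> f (L - s) = c * f s" and s: "s \<in> {0..L}"
  shows "f' (L - s) = - c * f' s"
proof -
  have Ls: "L - s \<in> {0..L}" using s by auto
  have img: "(-) L ` {0..L} = {0..L}" by (auto simp: image_iff intro!: bexI[of _ "L - _"])
  have "((-) L has_real_derivative - 1) (at s within {0..L})"
    by (auto intro!: derivative_eq_intros)
  from DERIV_image_chain[of f "f' (L - s)" "(-) L" s "{0..L}" "- 1", OF _ this]
  have "((\<lambda>t. f (L - t)) has_real_derivative - f' (L - s)) (at s within {0..L})"
    using d[OF Ls] by (simp add: img o_def)
  then have "((\<lambda>t. c * f t) has_real_derivative - f' (L - s)) (at s within {0..L})"
    by (rule has_field_derivative_transform_within[where d = 1]) (use s sym in auto)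
  moreover have "((\<lambda>t. c * f t) has_real_derivative c * f' s) (at s within {0..L})"
    by (rule DERIV_cmult[OF d[OF s]])
  ultimately have "- f' (L - s) = c * f' s"
    using vector_derivative_unique_within[OF at_within_Icc_nontrivial[OF L s]]
    by (auto simp: has_real_derivative_iff_has_vector_derivative)
  then show ?thesis by simp
qed

text \<open>The point \<open>s\<close> lies between \<open>L - t\<close> and \<open>t\<close>, where
  \<open>k\<close> takes the same value, and a concave function is at least that value in
  between.\<close>

lemma concave_reflected_antimono:
  fixes k :: "real \<Rightarrow> real"
  assumes conc: "concave_on {0..L} k" and sym: "\<And>s. s \<in> {0..L} \<Longrightarrow> k (L - s) = k s"
    and st: "L / 2 \<le> s" "s < t" "t \<le> L"
  shows "k t \<le> k s"
proof -
  \<comment> \<open>The position of \<open>s\<close> on the segment from \<open>L - t\<close> to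
    \<open>t\<close>.\<close>
  define u where "u = (s + t - L) / (2 * t - L)"
  have u: "0 \<le> u" "u \<le> 1" using st by (auto simp: u_def divide_simps)
  have "u * (2 * t - L) = s + t - L" using st by (simp add: u_def)
  then have "(1 - u) *\<^sub>R (L - t) + u *\<^sub>R t = s" by (simp add: algebra_simps)
  moreover have "k ((1 - u) *\<^sub>R (L - t) + u *\<^sub>R t) \<ge> (1 - u) * k (L - t) + u * k t"
    using u st by (intro concave_onD[OF conc]) auto
  moreover have "k (L - t) = k t" using st by (intro sym) auto
  ultimately have "(1 - u) * k t + u * k t \<le> k s" by simp
  then show ?thesis by (simp add: left_diff_distrib)
qed

text \<open>The analytic content of the hypotheses on the curve. The equations for \<open>x'\<close>
  and \<open>y'\<close> are the Frenet equations; they make the s-derivative of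
  \<open>\<Psi>\<close> equal to (1 + r k) times the unit tangent.\<close>

locale symmetric_strip =
  fixes L \<delta> :: real and x y x' y' k k' :: "real \<Rightarrow> real" and \<Psi> :: "real \<times> real \<Rightarrow> real \<times> real"
  assumes L_pos: "L > 0" and \<delta>_pos: "\<delta> > 0"
    and dx: "\<And>s. s \<in> {0..L} \<Longrightarrow> (x has_real_derivative x' s) (at s within {0..L})"
    and dy: "\<And>s. s \<in> {0..L} \<Longrightarrow> (y has_real_derivative y' s) (at s within {0..L})"
    and unit_speed: "\<And>s. s \<in> {0..L} \<Longrightarrow> (x' s)\<^sup>2 + (y' s)\<^sup>2 = 1"
    and dx': "\<And>s. s \<in> {0..L} \<Longrightarrow> (x' has_real_derivative - k s * y' s) (at s within {0..L})"
    and dy': "\<And>s. s \<in> {0..L} \<Longrightarrow> (y' has_real_derivative k s * x' s) (at s within {0..L})"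
    and dk: "\<And>s. s \<in> {0..L} \<Longrightarrow> (k has_real_derivative k' s) (at s within {0..L})"
    and x_sym: "\<And>s. s \<in> {0..L} \<Longrightarrow> x (L - s) = - x s"
    and y_sym: "\<And>s. s \<in> {0..L} \<Longrightarrow> y (L - s) = y s"
    and k_concave: "concave_on {0..L} k"
    and k_pos: "\<And>s r. s \<in> {0..L} \<Longrightarrow> r \<in> {0..\<delta>} \<Longrightarrow> 1 + r * k s > 0"
    and \<Psi>: "\<And>s r. s \<in> {0..L} \<Longrightarrow> \<Psi> (s, r) = (x s + r * y' s, y s - r * x' s)"
    and \<Psi>_inj: "inj_on \<Psi> ({0..L} \<times> {0..\<delta>})"
begin

lemma x'_sym: "s \<in> {0..L} \<Longrightarrow> x' (L - s) = x' s"
  using reflected_derivative[of L x x' "- 1" s] L_pos dx x_sym by simp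

lemma y'_sym: "s \<in> {0..L} \<Longrightarrow> y' (L - s) = - y' s"
  using reflected_derivative[of L y y' 1 s] L_pos dy y_sym by simp

lemma k_sym:
  assumes s: "s \<in> {0..L}"
  shows "k (L - s) = k s"
proof -
  have a: "k (L - s) * y' s = k s * y' s"
    using reflected_derivative[of L x' "\<lambda>s. - k s * y' s" 1 s] L_pos dx' x'_sym y'_sym s by simp
  have b: "k (L - s) * x' s = k s * x' s"
    using reflected_derivative[of L y' "\<lambda>s. k s * x' s" "- 1" s] L_pos dy' x'_sym y'_sym s by simp
  \<comment> \<open>Neither \<open>x' s\<close> nor \<open>y' s\<close> can be cancelled alone,
    since either may vanish; their squares add up to 1.\<close>
  have "k (L - s) * ((x' s)\<^sup>2 + (y' s)\<^sup>2) = (k (L - s) * x' s) * x' s + (k (L - s) * y' s) * y' s"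
    by (simp add: algebra_simps power2_eq_square)
  also have "\<dots> = k s * ((x' s)\<^sup>2 + (y' s)\<^sup>2)"
    unfolding a b by (simp add: algebra_simps power2_eq_square)
  finally show ?thesis using unit_speed[OF s] by simp
qed

lemma k'_nonpos:
  assumes s: "L / 2 \<le> s" "s < L"
  shows "k' s \<le> 0"
proof (cases "s = L / 2")
  case True
  \<comment> \<open>The midpoint is not interior to \<open>{L / 2..L}\<close>, so monotonicity there
    gives way to symmetry: \<open>k'\<close> is odd about it.\<close>
  have "k' (L - s) = - 1 * k' s"
    by (rule reflected_derivative[of L k]) (use L_pos dk k_sym s in auto)
  moreover have "L - s = s" using True by simp
  ultimately show ?thesis by simp
next
  case False
  have "mono_on {L / 2..L} (\<lambda>s. - k s)"
  proof (rule mono_onI)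
    fix s t assume "s \<in> {L / 2..L}" "t \<in> {L / 2..L}" "s \<le> t"
    then show "- k s \<le> - k t"
      using concave_reflected_antimono[OF k_concave k_sym, of s t] by (cases "s = t") auto
  qed
  moreover have "(k has_real_derivative k' s) (at s)"
    using dk[of s] s L_pos by (simp add: at_within_Icc_at)
  then have "((\<lambda>s. - k s) has_real_derivative - k' s) (at s)" by (rule DERIV_minus)
  moreover have "s \<in> interior {L / 2..L}" using s False by simp
  ultimately have "- k' s \<ge> 0" by (rule mono_on_imp_deriv_nonneg)
  then show ?thesis by simp
qed

lemma \<Psi>_has_derivative:
  assumes z: "z \<in> {0..L} \<times> {0..\<delta>}"
  shows "(\<Psi> has_derivative (\<lambda>h.
      (x' (fst z) * (1 + snd z * k (fst z)) * fst h + y' (fst z) * snd h,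
       y' (fst z) * (1 + snd z * k (fst z)) * fst h - x' (fst z) * snd h)))
    (at z within {0..L} \<times> {0..\<delta>})" (is "(_ has_derivative ?D) (at z within ?S)")
proof -
  have comp: "((\<lambda>z. f (fst z)) has_derivative (\<lambda>h. D * fst h)) (at z within ?S)"
    if "(f has_real_derivative D) (at (fst z) within {0..L})" for f D
  proof -
    have "(f has_derivative (*) D) (at (fst z) within fst ` ?S)"
      using that unfolding has_field_derivative_def by (rule has_derivative_subset) auto
    from has_derivative_in_compose[OF has_derivative_fst[OF has_derivative_ident] this]
    show ?thesis .
  qed
  have fz: "fst z \<in> {0..L}" using z by auto
  have "((\<lambda>z. (x (fst z) + snd z * y' (fst z), y (fst z) - snd z * x' (fst z))) has_derivative ?D) (at z within ?S)"
    by (rule derivative_eq_intros comp dx[OF fz] dy[OF fz] dx'[OF fz] dy'[OF fz] refl)+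
      (auto simp: algebra_simps)
  then show ?thesis
    by (rule has_derivative_transform_within[where d = 1]) (use z \<Psi> in auto)
qed

text \<open>Both the area density of \<open>\<Psi>\<close> and the length of its
  s-derivative.\<close>

definition width :: "real \<times> real \<Rightarrow> real" where
  "width z = 1 + snd z * k (fst z)"

lemma k_continuous: "continuous_on {0..L} k"
  by (rule DERIV_continuous_on[OF dk])

lemma width_continuous: "continuous_on ({0..L} \<times> {0..\<delta>}) width"
  unfolding width_def by (intro continuous_intros continuous_on_compose2[OF k_continuous]) auto

lemma width_pos: "z \<in> {0..L} \<times> {0..\<delta>} \<Longrightarrow> width z > 0"
  unfolding width_def using k_pos by (cases z) auto

lemma \<Psi>_continuous: "continuous_on ({0..L} \<times> {0..\<delta>}) \<Psi>"
  using \<Psi>_has_derivative by (rule has_derivative_continuous_on)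

text \<open>The tangent and the normal used by \<open>\<Psi>\<close> form a negatively oriented
  orthonormal frame, so the Jacobian determinant is minus \<open>width\<close>.\<close>

lemma nn_integral_strip_image:
  assumes "compact S" "S \<subseteq> {0..L} \<times> {0..\<delta>}" "continuous_on (\<Psi> ` S) f" "\<And>z. z \<in> \<Psi> ` S \<Longrightarrow> f z \<ge> 0"
  shows "(\<integral>\<^sup>+z. ennreal (f z) * indicator (\<Psi> ` S) z \<partial>lborel) = ennreal (integral S (\<lambda>z. width z * f (\<Psi> z)))"
proof (rule nn_integral_change_of_variables_prod[OF assms(1) inj_on_subset[OF \<Psi>_inj assms(2)]
      has_derivative_subset[OF \<Psi>_has_derivative assms(2)] _ continuous_on_subset[OF width_continuous assms(2)] assms(3,4)])
  fix z assume z: "z \<in> S"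
  then have z': "z \<in> {0..L} \<times> {0..\<delta>}" using assms(2) by auto
  have "x' (fst z) * width z * x' (fst z) + y' (fst z) * (y' (fst z) * width z)
    = ((x' (fst z))\<^sup>2 + (y' (fst z))\<^sup>2) * width z" by (simp add: algebra_simps power2_eq_square)
  also have "\<dots> = width z" using unit_speed[of "fst z"] z' by (auto simp: mem_Times_iff)
  finally show "\<bar>fst (x' (fst z) * (1 + snd z * k (fst z)) * fst (1::real, 0::real) + y' (fst z) * snd (1::real, 0::real),
       y' (fst z) * (1 + snd z * k (fst z)) * fst (1::real, 0::real) - x' (fst z) * snd (1::real, 0::real)) *
     snd (x' (fst z) * (1 + snd z * k (fst z)) * fst (0::real, 1::real) + y' (fst z) * snd (0::real, 1::real),
       y' (fst z) * (1 + snd z * k (fst z)) * fst (0::real, 1::real) - x' (fst z) * snd (0::real, 1::real)) -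
     fst (x' (fst z) * (1 + snd z * k (fst z)) * fst (0::real, 1::real) + y' (fst z) * snd (0::real, 1::real),
       y' (fst z) * (1 + snd z * k (fst z)) * fst (0::real, 1::real) - x' (fst z) * snd (0::real, 1::real)) *
     snd (x' (fst z) * (1 + snd z * k (fst z)) * fst (1::real, 0::real) + y' (fst z) * snd (1::real, 0::real),
       y' (fst z) * (1 + snd z * k (fst z)) * fst (1::real, 0::real) - x' (fst z) * snd (1::real, 0::real))\<bar> = width z"
    using width_pos[OF z'] by (simp add: width_def[symmetric] abs_if)
qed (use assms in auto)

text \<open>A compact exhaustion of the open rectangle, symmetric about s = L / 2 so that its image
  is invariant under the mirror.\<close>

definition core :: "real \<Rightarrow> (real \<times> real) set" where
  "core e = cbox (e, e) (L - e, \<delta> - e)"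

lemma core_subset: "e > 0 \<Longrightarrow> core e \<subseteq> {0<..<L} \<times> {0<..<\<delta>}"
  by (auto simp: core_def cbox_Pair_eq)

lemma core_subset': "e > 0 \<Longrightarrow> core e \<subseteq> {0..L} \<times> {0..\<delta>}"
  by (auto simp: core_def cbox_Pair_eq)

text \<open>On each slice of constant r the one-dimensional inequality applies to \<open>V\<close>
  with weight \<open>width\<close>; integrating over r gives the inequality on the image of the
  core. \<open>P\<close> and \<open>Q\<close> are the two integrands pulled back, Jacobian
  included.\<close>

lemma smooth_inequality:
  assumes p: "p > 1" and e: "0 < e" "e < L / 2" "e < \<delta> / 2"
    and A: "A \<ge> 0" "\<And>z. z \<in> {0..L} \<times> {0..\<delta>} \<Longrightarrow> A * width z powr p \<le> 1"
    and C: "C = A * (pi_p p / L) powr p"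
    and v: "\<And>z. z \<in> \<Psi> ` core e \<Longrightarrow> (v has_derivative (\<lambda>h. G z \<bullet> h)) (at z)"
    and cont: "continuous_on (\<Psi> ` core e) v" "continuous_on (\<Psi> ` core e) G"
    and odd: "\<And>z. v (- fst z, snd z) = - v z"
  shows "(\<integral>\<^sup>+z. ennreal (C * \<bar>v z\<bar> powr p) * indicator (\<Psi> ` core e) z \<partial>lborel)
    \<le> (\<integral>\<^sup>+z. ennreal (norm (G z) powr p) * indicator (\<Psi> ` core e) z \<partial>lborel)"
proof -
  note sub = core_subset'[OF e(1)]
  have C0: "C \<ge> 0" using A(1) by (simp add: C)
  define P where "P z = width z * (C * \<bar>v (\<Psi> z)\<bar> powr p)" for z
  define Q where "Q z = width z * norm (G (\<Psi> z)) powr p" for z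
  have cv: "continuous_on (\<Psi> ` core e) (\<lambda>z. C * \<bar>v z\<bar> powr p)"
    by (intro continuous_intros continuous_on_abs_powr[OF p] cont)
  have cG: "continuous_on (\<Psi> ` core e) (\<lambda>z. norm (G z) powr p)"
    using continuous_on_abs_powr[OF p continuous_on_norm[OF cont(2)]] by simp
  have cw: "continuous_on (core e) width" by (rule continuous_on_subset[OF width_continuous sub])
  have c\<Psi>: "continuous_on (core e) \<Psi>" by (rule continuous_on_subset[OF \<Psi>_continuous sub])
  have cP: "continuous_on (core e) P" unfolding P_def
    by (intro continuous_on_mult cw continuous_on_compose2[OF cv c\<Psi>]) auto
  have cQ: "continuous_on (core e) Q" unfolding Q_def
    by (intro continuous_on_mult cw continuous_on_compose2[OF cG c\<Psi>]) auto
  have inner: "integral {e..L - e} (\<lambda>s. P (s, r)) \<le> integral {e..L - e} (\<lambda>s. Q (s, r))"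
    if r: "r \<in> {e..\<delta> - e}" for r
  proof -
    have mem: "(s, r) \<in> core e" if "s \<in> {e..L - e}" for s using that r by (auto simp: core_def cbox_Pair_eq)
    have memS: "s \<in> {0..L}" if "s \<in> {e..L - e}" for s using that e by auto
    have r0: "r \<in> {0..\<delta>}" using r e by auto
    \<comment> \<open>The s-derivative of \<open>\<Psi>\<close>, a tangent vector of length
      \<open>width (s, r)\<close>.\<close>
    define T where "T s = (x' s * width (s, r), y' s * width (s, r))" for s
    define V where "V s = v (\<Psi> (s, r))" for s
    define V' where "V' s = G (\<Psi> (s, r)) \<bullet> T s" for s
    have slice: "continuous_on {e..L - e} (\<lambda>s. (s, r))" by (intro continuous_intros)
    have slice_sub: "(\<lambda>s. (s, r)) ` {e..L - e} \<subseteq> core e" using mem by auto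
    have dV: "(V has_real_derivative V' s) (at s within {e..L - e})" if s: "s \<in> {e..L - e}" for s
    proof -
      have pair: "((\<lambda>s. (s, r)) has_derivative (\<lambda>h. (h, 0))) (at s within {e..L - e})"
        by (auto intro!: derivative_eq_intros)
      have "((\<lambda>s. \<Psi> (s, r)) has_derivative (\<lambda>h. h *\<^sub>R T s)) (at s within {e..L - e})"
        using has_derivative_in_compose[OF pair has_derivative_subset[OF \<Psi>_has_derivative]] mem[OF s] sub slice_sub
        by (force simp: T_def width_def mult.commute)
      from has_derivative_compose[OF this v[OF imageI[OF mem[OF s]]]]
      show ?thesis unfolding V_def V'_def has_field_derivative_def by (simp add: mult_commute_abs)
    qed
    have cV': "continuous_on {e..L - e} V'"
    proof -
      have "continuous_on {e..L - e} (\<lambda>s. G (\<Psi> (s, r)))"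
        by (rule continuous_on_compose2[OF cont(2) continuous_on_compose2[OF c\<Psi> slice slice_sub]])
          (use slice_sub in auto)
      moreover have "continuous_on {e..L - e} (\<lambda>s. width (s, r))"
        by (rule continuous_on_compose2[OF cw slice slice_sub])
      moreover have "continuous_on {e..L - e} x'" "continuous_on {e..L - e} y'"
        by (rule continuous_on_subset[OF DERIV_continuous_on[OF dx']] continuous_on_subset[OF DERIV_continuous_on[OF dy']]; use e in auto)+
      ultimately show ?thesis unfolding V'_def T_def by (intro continuous_intros)
    qed
    \<comment> \<open>The middle normal segment lies on the y-axis, because \<open>x\<close> and
      \<open>y'\<close> are odd about L / 2; there the mirror fixes the point and oddness forces the
      value 0.\<close>
    have axis: "V (L / 2) = 0"
    proof -
      have h: "L / 2 \<in> {0..L}" using L_pos by simp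
      have "x (L / 2) = 0" "y' (L / 2) = 0" using x_sym[OF h] y'_sym[OF h] by simp_all
      then have "\<Psi> (L / 2, r) = (0, snd (\<Psi> (L / 2, r)))" by (simp add: \<Psi>[OF h])
      then show ?thesis using odd[of "\<Psi> (L / 2, r)"] unfolding V_def by (metis add.inverse_neutral equal_neg_zero fst_conv)
    qed
    have cP': "continuous_on {e..L - e} (\<lambda>s. P (s, r))" "continuous_on {e..L - e} (\<lambda>s. Q (s, r))"
      by (rule continuous_on_compose2[OF cP slice slice_sub], rule continuous_on_compose2[OF cQ slice slice_sub])
    have "integral {e..L - e} (\<lambda>s. (pi_p p / L) powr p * \<bar>V s\<bar> powr p * width (s, r))
      \<le> integral {e..L - e} (\<lambda>s. \<bar>V' s\<bar> powr p * width (s, r))"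
    proof (rule weighted_odd_inequality[OF p e(1,2) dV cV' axis])
      show "((\<lambda>s. width (s, r)) has_real_derivative r * k' s) (at s within {e..L - e})" if "s \<in> {e..L - e}" for s
        unfolding width_def using DERIV_subset[OF dk[OF memS[OF that]], of "{e..L - e}"] e
        by (auto intro!: derivative_eq_intros)
      show "0 \<le> width (s, r)" if "s \<in> {e..L - e}" for s
        using width_pos[of "(s, r)"] memS[OF that] r0 by auto
      show "r * k' s \<le> 0" if "s \<in> {L / 2..L - e}" for s
        using k'_nonpos[of s] that e r0 by (intro mult_nonneg_nonpos) auto
      show "width (L - s, r) = width (s, r)" if "s \<in> {e..L - e}" for s
        using k_sym[OF memS[OF that]] by (simp add: width_def)
    qed
    \<comment> \<open>The factor \<open>A\<close> pays for Cauchy-Schwarz: |V'|^p is at most |G|^p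
      w^p, and A w^p is at most 1.\<close>
    then have "A * integral {e..L - e} (\<lambda>s. (pi_p p / L) powr p * \<bar>V s\<bar> powr p * width (s, r))
      \<le> A * integral {e..L - e} (\<lambda>s. \<bar>V' s\<bar> powr p * width (s, r))"
      using A(1) by (rule mult_left_mono)
    then have "integral {e..L - e} (\<lambda>s. P (s, r)) \<le> integral {e..L - e} (\<lambda>s. A * (\<bar>V' s\<bar> powr p * width (s, r)))"
      unfolding integral_mult_right[symmetric] P_def C V_def by (simp add: mult_ac)
    also have "\<dots> \<le> integral {e..L - e} (\<lambda>s. Q (s, r))"
    proof (rule integral_le)
      show "(\<lambda>s. A * (\<bar>V' s\<bar> powr p * width (s, r))) integrable_on {e..L - e}"
        by (intro integrable_continuous_interval continuous_intros continuous_on_abs_powr[OF p] cV'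
          continuous_on_compose2[OF cw slice slice_sub])
      show "(\<lambda>s. Q (s, r)) integrable_on {e..L - e}"
        by (intro integrable_continuous_interval cP')
      fix s assume s: "s \<in> {e..L - e}"
      have zS: "(s, r) \<in> {0..L} \<times> {0..\<delta>}" using memS[OF s] r0 by auto
      have w0: "width (s, r) > 0" using width_pos[OF zS] .
      have "(x' s * width (s, r))\<^sup>2 + (y' s * width (s, r))\<^sup>2 = ((x' s)\<^sup>2 + (y' s)\<^sup>2) * (width (s, r))\<^sup>2"
        by (simp add: power_mult_distrib distrib_right)
      then have "norm (T s) = width (s, r)"
        using unit_speed[OF memS[OF s]] w0 by (simp add: T_def norm_Pair)
      then have "\<bar>V' s\<bar> \<le> norm (G (\<Psi> (s, r))) * width (s, r)"
        unfolding V'_def using Cauchy_Schwarz_ineq2[of "G (\<Psi> (s, r))" "T s"] by simp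
      then have "\<bar>V' s\<bar> powr p \<le> (norm (G (\<Psi> (s, r))) * width (s, r)) powr p"
        using p by (intro powr_mono2) auto
      also have "\<dots> = norm (G (\<Psi> (s, r))) powr p * width (s, r) powr p"
        using w0 by (simp add: powr_mult)
      finally have "A * \<bar>V' s\<bar> powr p \<le> A * (norm (G (\<Psi> (s, r))) powr p * width (s, r) powr p)"
        using A(1) by (rule mult_left_mono)
      also have "\<dots> = norm (G (\<Psi> (s, r))) powr p * (A * width (s, r) powr p)" by (simp add: mult_ac)
      also have "\<dots> \<le> norm (G (\<Psi> (s, r))) powr p * 1" by (intro mult_left_mono A(2) zS) simp
      finally have "A * \<bar>V' s\<bar> powr p * width (s, r) \<le> norm (G (\<Psi> (s, r))) powr p * width (s, r)"
        using w0 by (intro mult_right_mono) auto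
      then show "A * (\<bar>V' s\<bar> powr p * width (s, r)) \<le> Q (s, r)" by (simp add: Q_def mult_ac)
    qed
    finally show ?thesis .
  qed
  have "0 \<le> integral (core e) (\<lambda>z. Q z - P z)"
  proof -
    have cH: "continuous_on (cbox (e, e) (L - e, \<delta> - e)) (\<lambda>z. Q z - P z)"
      using cP cQ unfolding core_def by (intro continuous_intros)
    then have cH': "continuous_on (cbox (e, e) (L - e, \<delta> - e)) (\<lambda>(s, r). Q (s, r) - P (s, r))"
      by (simp add: case_prod_unfold)
    \<comment> \<open>The order of integration is swapped so that s is the inner variable, as the
      slice inequality requires.\<close>
    have "integral (core e) (\<lambda>z. Q z - P z)
      = integral (cbox e (\<delta> - e)) (\<lambda>r. integral (cbox e (L - e)) (\<lambda>s. Q (s, r) - P (s, r)))"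
      unfolding core_def integral_prod_continuous[OF cH] by (rule integral_swap_continuous[OF cH'])
    also have "\<dots> \<ge> 0"
    \<comment> \<open>A function that is not integrable has integral 0 by default, so that case
      satisfies the bound as well.\<close>
    proof (cases "(\<lambda>r. integral (cbox e (L - e)) (\<lambda>s. Q (s, r) - P (s, r))) integrable_on cbox e (\<delta> - e)")
      case True
      then show ?thesis
      proof (rule Henstock_Kurzweil_Integration.integral_nonneg)
        fix r assume "r \<in> cbox e (\<delta> - e)"
        then have r: "r \<in> {e..\<delta> - e}" by simp
        have slice: "continuous_on {e..L - e} (\<lambda>s. (s, r))" by (intro continuous_intros)
        have slice_sub: "(\<lambda>s. (s, r)) ` {e..L - e} \<subseteq> core e" using r by (auto simp: core_def cbox_Pair_eq)
        have "integral {e..L - e} (\<lambda>s. Q (s, r) - P (s, r))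
          = integral {e..L - e} (\<lambda>s. Q (s, r)) - integral {e..L - e} (\<lambda>s. P (s, r))"
          by (intro Henstock_Kurzweil_Integration.integral_diff integrable_continuous_interval
            continuous_on_compose2[OF cP slice slice_sub] continuous_on_compose2[OF cQ slice slice_sub])
        then show "0 \<le> integral (cbox e (L - e)) (\<lambda>s. Q (s, r) - P (s, r))" using inner[OF r] by simp
      qed
    qed (simp add: not_integrable_integral)
    finally show ?thesis .
  qed
  also have "\<dots> = integral (core e) Q - integral (core e) P"
    using cP cQ unfolding core_def by (intro Henstock_Kurzweil_Integration.integral_diff integrable_continuous) auto
  finally have "integral (core e) P \<le> integral (core e) Q" by simp
  moreover have "(\<integral>\<^sup>+z. ennreal (C * \<bar>v z\<bar> powr p) * indicator (\<Psi> ` core e) z \<partial>lborel) = ennreal (integral (core e) P)"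
    unfolding P_def by (rule nn_integral_strip_image[OF _ sub cv]) (use C0 in \<open>auto simp: core_def\<close>)
  moreover have "(\<integral>\<^sup>+z. ennreal (norm (G z) powr p) * indicator (\<Psi> ` core e) z \<partial>lborel) = ennreal (integral (core e) Q)"
    unfolding Q_def by (rule nn_integral_strip_image[OF _ sub cG]) (auto simp: core_def)
  ultimately show ?thesis by (simp add: ennreal_leI)
qed

end

section \<open>Reflection in the y-axis and Sobolev functions on the strip\<close>

definition mirror :: "real \<times> real \<Rightarrow> real \<times> real" where
  "mirror z = (- fst z, snd z)"

lemma mirror_simps [simp]: "norm (mirror z) = norm z" "mirror (mirror z) = z"
  by (cases z, simp add: mirror_def norm_Pair) (simp add: mirror_def)

lemma linear_mirror: "linear mirror"
  by (rule linearI) (auto simp: mirror_def)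

lemma distr_lborel_mirror: "distr lborel borel mirror = lborel"
proof -
  define c :: "real \<times> real \<Rightarrow> real" where "c b = (if b = (1, 0) then - 1 else 1)" for b
  have B: "(Basis :: (real \<times> real) set) = {(1, 0), (0, 1)}" by (auto simp: Basis_prod_def)
  have "(\<lambda>x. 0 + (\<Sum>j\<in>Basis. (c j * (x \<bullet> j)) *\<^sub>R j)) = mirror"
    by (rule ext) (simp add: B c_def mirror_def inner_prod_def)
  moreover have "(\<Prod>j\<in>Basis. \<bar>c j\<bar>) = 1" by (simp add: B c_def)
  ultimately have "lborel = density (distr lborel borel mirror) (\<lambda>_. 1)"
    using lborel_affine_euclidean[of c 0] by (simp add: c_def)
  then show ?thesis by (simp add: density_1)
qed

context symmetric_strip
begin

definition D :: "(real \<times> real) set" where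
  "D = \<Psi> ` ({0<..<L} \<times> {0<..<\<delta>})"

text \<open>Invariance of domain for a continuous injection of an open rectangle.\<close>

lemma D_open: "open D"
  unfolding D_def
proof (rule invariance_of_domain)
  have sub: "{0<..<L} \<times> {0<..<\<delta>} \<subseteq> {0..L} \<times> {0..\<delta>}" by auto
  show "continuous_on ({0<..<L} \<times> {0<..<\<delta>}) \<Psi>" by (rule continuous_on_subset[OF \<Psi>_continuous sub])
  show "inj_on \<Psi> ({0<..<L} \<times> {0<..<\<delta>})" by (rule inj_on_subset[OF \<Psi>_inj sub])
  show "open ({0<..<L} \<times> {0<..<\<delta>})" by (intro open_Times) auto
qed

text \<open>In strip coordinates the mirror is the map from (s, r) to (L - s, r).\<close>

lemma mirror_core:
  assumes "e > 0"
  shows "mirror ` \<Psi> ` core e \<subseteq> \<Psi> ` core e"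
proof -
  have "mirror (\<Psi> (s, r)) = \<Psi> (L - s, r)" if "(s, r) \<in> core e" for s r
  proof -
    have s: "s \<in> {0..L}" "L - s \<in> {0..L}" using core_subset'[OF assms] that by auto
    show ?thesis using x_sym[OF s(1)] y_sym[OF s(1)] x'_sym[OF s(1)] y'_sym[OF s(1)]
      by (simp add: \<Psi>[OF s(1)] \<Psi>[OF s(2)] mirror_def)
  qed
  moreover have "(L - s, r) \<in> core e" if "(s, r) \<in> core e" for s r
    using that by (auto simp: core_def cbox_Pair_eq)
  ultimately show ?thesis by force
qed

lemma core_inequality:
  assumes p: "p > 1" and e: "0 < e" "e < L / 2" "e < \<delta> / 2"
    and A: "A \<ge> 0" "\<And>z. z \<in> {0..L} \<times> {0..\<delta>} \<Longrightarrow> A * width z powr p \<le> 1"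
    and u: "sobolev p D u g" "odd_on D u"
  shows "(\<integral>\<^sup>+z. ennreal (A * (pi_p p / L) powr p * \<bar>u z\<bar> powr p) * indicator (\<Psi> ` core e) z \<partial>lebesgue)
    \<le> (\<integral>\<^sup>+z. ennreal (norm (g z) powr p) * indicator D z \<partial>lebesgue)"
proof (rule sobolev_odd_inequality_from_smooth[OF D_open u(1) p, where \<sigma> = mirror])
  show "compact (\<Psi> ` core e)"
    by (rule compact_continuous_image[OF continuous_on_subset[OF \<Psi>_continuous core_subset'[OF e(1)]]])
      (simp add: core_def)
  show "\<Psi> ` core e \<subseteq> D" unfolding D_def using core_subset[OF e(1)] by (rule image_mono)
  show "AE z in lebesgue_on D. u (mirror z) = - u z"
    using u(2) unfolding odd_on_def mirror_def .
  fix v G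
  assume "\<And>z. z \<in> \<Psi> ` core e \<Longrightarrow> (v has_derivative (\<lambda>h. G z \<bullet> h)) (at z)"
    "continuous_on (\<Psi> ` core e) v" "continuous_on (\<Psi> ` core e) G" "\<And>z. v (mirror z) = - v z"
  then show "(\<integral>\<^sup>+z. ennreal (A * (pi_p p / L) powr p * \<bar>v z\<bar> powr p) * indicator (\<Psi> ` core e) z \<partial>lborel)
    \<le> (\<integral>\<^sup>+z. ennreal (norm (G z) powr p) * indicator (\<Psi> ` core e) z \<partial>lborel)"
    unfolding mirror_def by (intro smooth_inequality[OF p e A refl]) auto
qed (use linear_mirror distr_lborel_mirror mirror_core[OF e(1)] in auto)

text \<open>The cores exhaust the strip while the bound on the right is already over all of
  \<open>D\<close>, so Fatou's lemma removes the margin on the left.\<close>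

lemma rayleigh_inequality:
  assumes p: "p > 1"
    and A: "A \<ge> 0" "\<And>z. z \<in> {0..L} \<times> {0..\<delta>} \<Longrightarrow> A * width z powr p \<le> 1"
    and u: "sobolev p D u g" "odd_on D u"
  shows "A * (pi_p p / L) powr p * (LINT z|lebesgue_on D. \<bar>u z\<bar> powr p)
    \<le> (LINT z|lebesgue_on D. norm (g z) powr p)"
proof -
  define C where "C = A * (pi_p p / L) powr p"
  have C0: "C \<ge> 0" using A(1) by (simp add: C_def)
  \<comment> \<open>A divisor of at least 3 puts the margin below both half widths already for
    \<open>n = 0\<close>.\<close>
  define e where "e n = min L \<delta> / (real n + 3)" for n :: nat
  have m: "min L \<delta> > 0" using L_pos \<delta>_pos by simp
  have e: "0 < e n" "e n < L / 2" "e n < \<delta> / 2" for n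
  proof -
    show "0 < e n" using m by (simp add: e_def add_nonneg_pos)
    have "e n \<le> min L \<delta> / 3" unfolding e_def using m by (intro divide_left_mono) auto
    then show "e n < L / 2" "e n < \<delta> / 2" using m by linarith+
  qed
  have "(\<lambda>n. min L \<delta> / real (n + 3)) \<longlonglongrightarrow> 0"
    by (rule LIMSEQ_ignore_initial_segment[OF lim_const_over_n])
  then have elim: "e \<longlonglongrightarrow> 0" by (simp add: e_def[abs_def])
  have Dm: "D \<inter> space lebesgue \<in> sets lebesgue" using D_open by auto
  have iu: "integrable (lebesgue_on D) (\<lambda>z. \<bar>u z\<bar> powr p)" and ig: "integrable (lebesgue_on D) (\<lambda>z. norm (g z) powr p)"
    and um: "u \<in> borel_measurable (lebesgue_on D)"
    using u(1) unfolding sobolev_def Lp_fun_def by auto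
  define f where "f z = ennreal (C * \<bar>u z\<bar> powr p)" for z
  have "f \<in> borel_measurable (lebesgue_on D)" unfolding f_def using um by measurable
  then have fm: "(\<lambda>z. f z * indicator D z) \<in> borel_measurable lebesgue"
    by (simp add: borel_measurable_restrict_space_iff_ennreal[OF Dm])
  have coreD: "\<Psi> ` core (e n) \<subseteq> D" for n unfolding D_def using core_subset[OF e(1)] by (rule image_mono)
  have "compact (\<Psi> ` core (e n))" for n
    by (rule compact_continuous_image[OF continuous_on_subset[OF \<Psi>_continuous core_subset'[OF e(1)]]])
      (simp add: core_def)
  then have cm: "\<Psi> ` core (e n) \<in> sets lebesgue" for n by (auto intro: lmeasurable_compact fmeasurableD)
  have fn: "(\<lambda>z. f z * indicator (\<Psi> ` core (e n)) z) \<in> borel_measurable lebesgue" for n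
  proof -
    have "(\<lambda>z. f z * indicator (\<Psi> ` core (e n)) z) = (\<lambda>z. (f z * indicator D z) * indicator (\<Psi> ` core (e n)) z)"
      by (intro ext) (use coreD[of n] in \<open>auto split: split_indicator\<close>)
    then show ?thesis using fm cm[of n] by simp
  qed
  have lim: "f z * indicator D z = liminf (\<lambda>n. f z * indicator (\<Psi> ` core (e n)) z)" for z
  proof -
    have "\<forall>\<^sub>F n in sequentially. f z * indicator (\<Psi> ` core (e n)) z = f z * indicator D z"
    proof (cases "z \<in> D")
      case True
      then obtain s r where sr: "z = \<Psi> (s, r)" "0 < s" "s < L" "0 < r" "r < \<delta>" by (auto simp: D_def)
      have "\<forall>\<^sub>F n in sequentially. e n < Min {s, L - s, r, \<delta> - r}"
        using sr by (intro order_tendstoD(2)[OF elim]) auto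
      then show ?thesis
      proof eventually_elim
        case (elim n)
        then have "(s, r) \<in> core (e n)" by (simp add: core_def cbox_Pair_eq)
        then show ?case using True sr(1) by simp
      qed
    next
      case False
      then have "z \<notin> \<Psi> ` core (e n)" for n using coreD[of n] by auto
      then show ?thesis using False by simp
    qed
    then have "(\<lambda>n. f z * indicator (\<Psi> ` core (e n)) z) \<longlonglongrightarrow> f z * indicator D z"
      by (rule tendsto_eventually)
    then show ?thesis using lim_imp_Liminf[OF sequentially_bot] by metis
  qed
  have "ennreal (C * (LINT z|lebesgue_on D. \<bar>u z\<bar> powr p)) = (\<integral>\<^sup>+z. f z \<partial>lebesgue_on D)"
    unfolding f_def using iu C0
    by (subst nn_integral_eq_integral) auto
  also have "\<dots> = (\<integral>\<^sup>+z. f z * indicator D z \<partial>lebesgue)"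
    by (rule nn_integral_restrict_space[OF Dm])
  also have "\<dots> = (\<integral>\<^sup>+z. liminf (\<lambda>n. f z * indicator (\<Psi> ` core (e n)) z) \<partial>lebesgue)"
    by (simp only: lim)
  also have "\<dots> \<le> liminf (\<lambda>n. \<integral>\<^sup>+z. f z * indicator (\<Psi> ` core (e n)) z \<partial>lebesgue)"
    by (rule nn_integral_liminf[OF fn])
  also have "\<dots> \<le> liminf (\<lambda>n::nat. \<integral>\<^sup>+z. ennreal (norm (g z) powr p) * indicator D z \<partial>lebesgue)"
    unfolding f_def C_def
    by (intro Liminf_mono always_eventually allI core_inequality[OF p e A u])
  also have "\<dots> = (\<integral>\<^sup>+z. ennreal (norm (g z) powr p) \<partial>lebesgue_on D)"
    by (simp add: Liminf_const nn_integral_restrict_space[OF Dm])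
  also have "\<dots> = ennreal (LINT z|lebesgue_on D. norm (g z) powr p)"
    using ig by (intro nn_integral_eq_integral) auto
  finally show ?thesis
    unfolding C_def by (simp add: ennreal_le_iff)
qed

end

text \<open>The second derivative is orthogonal to the unit tangent, hence a multiple of the normal,
  and the multiple is the signed curvature.\<close>

lemma symmetric_strip_of_curve:
  fixes L \<delta> :: real and \<gamma> :: "real \<Rightarrow> real \<times> real"
  assumes L: "L > 0" "\<delta> > 0"
    and "smooth_curve L \<gamma>" and arc: "arc_length_parametrized L \<gamma>" and sym: "symmetric_curve L \<gamma>"
    and bij: "bij_betw (strip_map L \<gamma>) (closure (flat_strip L \<delta>)) (closure (curved_strip L \<delta> \<gamma>))"
    and conc: "concave_on {0..L} (signed_curvature L \<gamma>)"
    and pos: "\<forall>(s, r) \<in> closure (flat_strip L \<delta>). 1 + r * signed_curvature L \<gamma> s > 0"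
    and cl: "closure (flat_strip L \<delta>) = {0..L} \<times> {0..\<delta>}"
  obtains x y x' y' k' where "symmetric_strip L \<delta> x y x' y' (signed_curvature L \<gamma>) k' (strip_map L \<gamma>)"
proof -
  obtain X Y where X0: "\<And>s. X 0 s = fst (\<gamma> s)" "\<And>s. Y 0 s = snd (\<gamma> s)"
    and dX: "\<And>n s. s \<in> {0..L} \<Longrightarrow> (X n has_real_derivative X (Suc n) s) (at s within {0..L})"
    and dY: "\<And>n s. s \<in> {0..L} \<Longrightarrow> (Y n has_real_derivative Y (Suc n) s) (at s within {0..L})"
    and cg: "\<And>s. s \<in> {0..L} \<Longrightarrow> curve_deriv L \<gamma> s = (X 1 s, Y 1 s)"
    and cx: "\<And>s. s \<in> {0..L} \<Longrightarrow> curve_deriv L (\<lambda>t. fst (\<gamma> t)) s = X 1 s"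
    and cy: "\<And>s. s \<in> {0..L} \<Longrightarrow> curve_deriv L (\<lambda>t. snd (\<gamma> t)) s = Y 1 s"
    and k: "\<And>s. s \<in> {0..L} \<Longrightarrow> signed_curvature L \<gamma> s = X 1 s * Y 2 s - X 2 s * Y 1 s"
    using curve_derivatives_of_smooth_curve[OF L(1) assms(3)] by blast
  have dX': "(X 1 has_real_derivative X 2 s) (at s within {0..L})" "(X 2 has_real_derivative X 3 s) (at s within {0..L})"
    and dY': "(Y 1 has_real_derivative Y 2 s) (at s within {0..L})" "(Y 2 has_real_derivative Y 3 s) (at s within {0..L})"
    if "s \<in> {0..L}" for s
    using dX[OF that, of 1] dX[OF that, of 2] dY[OF that, of 1] dY[OF that, of 2]
    by (simp_all add: numeral_2_eq_2 numeral_3_eq_3)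
  have unit: "(X 1 s)\<^sup>2 + (Y 1 s)\<^sup>2 = 1" if "s \<in> {0..L}" for s
  proof -
    have "norm (X 1 s, Y 1 s) = 1"
      using arc that unfolding arc_length_parametrized_def cg[OF that, symmetric] by blast
    then show ?thesis by (simp only: norm_Pair real_norm_def power2_abs real_sqrt_eq_1_iff)
  qed
  \<comment> \<open>Differentiate the constant squared speed.\<close>
  have orth: "X 1 s * X 2 s + Y 1 s * Y 2 s = 0" if s: "s \<in> {0..L}" for s
  proof -
    have "((\<lambda>s. (X 1 s)\<^sup>2 + (Y 1 s)\<^sup>2) has_real_derivative 2 * (X 1 s * X 2 s + Y 1 s * Y 2 s)) (at s within {0..L})"
      by (rule derivative_eq_intros dX'(1)[OF s] dY'(1)[OF s] refl)+ (simp add: algebra_simps)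
    moreover have "((\<lambda>s. (X 1 s)\<^sup>2 + (Y 1 s)\<^sup>2) has_real_derivative 0) (at s within {0..L})"
      by (rule has_field_derivative_transform_within[OF DERIV_const, of 1 _ _ 1]) (use s unit in auto)
    ultimately show ?thesis
      using vector_derivative_unique_within[OF at_within_Icc_nontrivial[OF L(1) s]]
      by (fastforce simp: has_real_derivative_iff_has_vector_derivative)
  qed
  have frenet: "X 2 s = - signed_curvature L \<gamma> s * Y 1 s" "Y 2 s = signed_curvature L \<gamma> s * X 1 s"
    if s: "s \<in> {0..L}" for s
  proof -
    \<comment> \<open>The second derivative expanded in the orthonormal frame of tangent and normal;
      its tangential coefficient is zero by \<open>orth\<close>.\<close>
    have "- (X 1 s * Y 2 s - X 2 s * Y 1 s) * Y 1 s
      = X 2 s * ((X 1 s)\<^sup>2 + (Y 1 s)\<^sup>2) - X 1 s * (X 1 s * X 2 s + Y 1 s * Y 2 s)"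
      by (simp add: algebra_simps power2_eq_square)
    then show "X 2 s = - signed_curvature L \<gamma> s * Y 1 s" using unit[OF s] orth[OF s] k[OF s] by simp
    have "(X 1 s * Y 2 s - X 2 s * Y 1 s) * X 1 s
      = Y 2 s * ((X 1 s)\<^sup>2 + (Y 1 s)\<^sup>2) - Y 1 s * (X 1 s * X 2 s + Y 1 s * Y 2 s)"
      by (simp add: algebra_simps power2_eq_square)
    then show "Y 2 s = signed_curvature L \<gamma> s * X 1 s" using unit[OF s] orth[OF s] k[OF s] by simp
  qed
  \<comment> \<open>The symmetry is assumed for the first half of the parameter interval;
    substituting \<open>L - s\<close> gives the second half.\<close>
  have refl: "fst (\<gamma> (L - s)) = - fst (\<gamma> s) \<and> snd (\<gamma> (L - s)) = snd (\<gamma> s)" if s: "s \<in> {0..L}" for s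
  proof (cases "s \<le> L / 2")
    case True
    then show ?thesis using sym s unfolding symmetric_curve_def by auto
  next
    case False
    then have "L - s \<in> {0..L / 2}" using s by auto
    then have "fst (\<gamma> (L - (L - s))) = - fst (\<gamma> (L - s)) \<and> snd (\<gamma> (L - (L - s))) = snd (\<gamma> (L - s))"
      using sym unfolding symmetric_curve_def by blast
    then show ?thesis by simp
  qed
  have "symmetric_strip L \<delta> (X 0) (Y 0) (X 1) (Y 1) (signed_curvature L \<gamma>)
    (\<lambda>s. X 1 s * Y 3 s - X 3 s * Y 1 s) (strip_map L \<gamma>)"
  proof
    fix s assume s: "s \<in> {0..L}"
    show "(X 0 has_real_derivative X 1 s) (at s within {0..L})" "(Y 0 has_real_derivative Y 1 s) (at s within {0..L})"
      using dX[OF s, of 0] dY[OF s, of 0] by simp_all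
    show "(X 1 has_real_derivative - signed_curvature L \<gamma> s * Y 1 s) (at s within {0..L})"
      using dX'(1)[OF s] frenet(1)[OF s] by simp
    show "(Y 1 has_real_derivative signed_curvature L \<gamma> s * X 1 s) (at s within {0..L})"
      using dY'(1)[OF s] frenet(2)[OF s] by simp
    \<comment> \<open>The products of second derivatives cancel, leaving only terms with a third
      derivative.\<close>
    have "((\<lambda>s. X 1 s * Y 2 s - X 2 s * Y 1 s) has_real_derivative X 1 s * Y 3 s - X 3 s * Y 1 s) (at s within {0..L})"
      using DERIV_diff[OF DERIV_mult[OF dX'(1)[OF s] dY'(2)[OF s]] DERIV_mult[OF dX'(2)[OF s] dY'(1)[OF s]]]
      by (simp add: algebra_simps del: One_nat_def)
    then show "(signed_curvature L \<gamma> has_real_derivative X 1 s * Y 3 s - X 3 s * Y 1 s) (at s within {0..L})"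
      by (rule has_field_derivative_transform_within[where d = 1]) (use s k in auto)
    show "X 0 (L - s) = - X 0 s" "Y 0 (L - s) = Y 0 s" using refl[OF s] by (simp_all add: X0)
    show "strip_map L \<gamma> (s, r) = (X 0 s + r * Y 1 s, Y 0 s - r * X 1 s)" for r
      using s by (simp add: strip_map_def cx cy X0)
    show "1 + r * signed_curvature L \<gamma> s > 0" if "r \<in> {0..\<delta>}" for r
      using pos s that unfolding cl by auto
  next
    show "inj_on (strip_map L \<gamma>) ({0..L} \<times> {0..\<delta>})"
      using bij unfolding cl by (rule bij_betw_imp_inj_on)
  qed (use L conc unit in auto)
  then show thesis by (rule that)
qed

theorem theorem1p2:
  fixes L \<delta> p :: real and \<gamma> :: "real \<Rightarrow> real \<times> real"
  assumes "L > 0" and "\<delta> > 0" and "p > 1"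
    and "smooth_curve L \<gamma>"
    and "inj_on \<gamma> {0..L}"
    and "arc_length_parametrized L \<gamma>"
    and "symmetric_curve L \<gamma>"
    and "bij_betw (strip_map L \<gamma>) (closure (flat_strip L \<delta>)) (closure (curved_strip L \<delta> \<gamma>))"
    and "concave_on {0..L} (signed_curvature L \<gamma>)"
    and "\<forall>(s, r) \<in> closure (flat_strip L \<delta>). 1 + r * signed_curvature L \<gamma> s > 0"
  shows "ereal (A_const p L \<delta> (signed_curvature L \<gamma>) * (pi_p p / L) powr p)
           \<le> mu1_odd p (curved_strip L \<delta> \<gamma>) \<and>
         ereal (A_const p L \<delta> (signed_curvature L \<gamma>) * (pi_p p / L) powr p)
           \<le> mu1_odd_rayleigh p (curved_strip L \<delta> \<gamma>) \<and>
         pi_p p = 2 * pi * ((p - 1) powr (1 / p) / (p * sin (pi / p)))"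
proof -
  let ?D = "curved_strip L \<delta> \<gamma>" and ?k = "signed_curvature L \<gamma>"
  let ?A = "A_const p L \<delta> ?k"
  have cl: "closure (flat_strip L \<delta>) = {0..L} \<times> {0..\<delta>}"
    using assms(1,2) by (simp add: flat_strip_def closure_Times)
  obtain x y x' y' k' where "symmetric_strip L \<delta> x y x' y' ?k k' (strip_map L \<gamma>)"
    using symmetric_strip_of_curve[OF assms(1,2,4,6-10) cl] by blast
  then interpret symmetric_strip L \<delta> x y x' y' ?k k' "strip_map L \<gamma>" .
  have D: "D = ?D" by (simp add: D_def curved_strip_def flat_strip_def)
  define h where "h = (\<lambda>(s, r). 1 / (1 + r * ?k s) powr p)"
  have A_eq: "?A = (INF z \<in> {0..L} \<times> {0..\<delta>}. h z)"
    by (simp add: A_const_def cl h_def)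
  have h0: "h z \<ge> 0" for z by (simp add: h_def split: prod.split)
  have A0: "?A \<ge> 0"
    unfolding A_eq using assms(1,2) h0 by (intro cINF_greatest) auto
  have A1: "?A * width z powr p \<le> 1" if z: "z \<in> {0..L} \<times> {0..\<delta>}" for z
  proof -
    have "bdd_below (h ` ({0..L} \<times> {0..\<delta>}))" using h0 by (intro bdd_belowI2[of _ 0])
    then have "?A \<le> h z" unfolding A_eq using z by (rule cINF_lower)
    also have "h z = 1 / width z powr p" by (simp add: h_def width_def split: prod.split)
    finally show ?thesis using width_pos[OF z] by (simp add: field_simps)
  qed
  note main = rayleigh_inequality[OF assms(3) A0 A1, unfolded D]
  have quotient: "?A * (pi_p p / L) powr p
      \<le> (LINT z|lebesgue_on ?D. norm (g z) powr p) / (LINT z|lebesgue_on ?D. \<bar>v z\<bar> powr p)"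
    and positive: "(LINT z|lebesgue_on ?D. \<bar>v z\<bar> powr p) > 0"
    if v: "sobolev p ?D v g" "nonzero_on ?D v" "odd_on ?D v" for v g
  proof -
    have "integrable (lebesgue_on ?D) (\<lambda>z. \<bar>v z\<bar> powr p)"
      using v(1) unfolding sobolev_def Lp_fun_def by auto
    \<comment> \<open>Division by zero would return 0, so a lower bound on the quotient needs a
      positive denominator.\<close>
    then have "(LINT z|lebesgue_on ?D. \<bar>v z\<bar> powr p) \<noteq> 0"
      using v(2) unfolding nonzero_on_def by (subst integral_nonneg_eq_0_iff_AE) auto
    then show pos: "(LINT z|lebesgue_on ?D. \<bar>v z\<bar> powr p) > 0"
      by (simp add: order_less_le Bochner_Integration.integral_nonneg)
    show "?A * (pi_p p / L) powr p
      \<le> (LINT z|lebesgue_on ?D. norm (g z) powr p) / (LINT z|lebesgue_on ?D. \<bar>v z\<bar> powr p)"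
      using main[OF _ v(1,3)] pos by (simp add: le_divide_eq)
  qed
  have "ereal (?A * (pi_p p / L) powr p) \<le> mu1_odd_rayleigh p ?D"
    unfolding mu1_odd_rayleigh_def by (rule Inf_greatest) (use quotient in auto)
  moreover have "ereal (?A * (pi_p p / L) powr p) \<le> mu1_odd p ?D"
    unfolding mu1_odd_def
  proof (rule Inf_greatest, safe)
    fix \<mu> u assume ef: "neumann_eigenfunction p ?D \<mu> u" and odd: "odd_on ?D u"
    then obtain g where nz: "nonzero_on ?D u" and sob: "sobolev p ?D u g"
      and weak: "\<And>\<phi> h. sobolev p ?D \<phi> h \<Longrightarrow>
        (LINT z|lebesgue_on ?D. norm (g z) powr (p - 2) * (g z \<bullet> h z))
          = \<mu> * (LINT z|lebesgue_on ?D. \<bar>u z\<bar> powr (p - 2) * u z * \<phi> z)"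
      unfolding neumann_eigenfunction_def by blast
    \<comment> \<open>Testing the weak equation with the eigenfunction itself identifies
      \<open>\<mu>\<close> with its Rayleigh quotient. Where a vanishes, both sides are 0.\<close>
    have "norm a powr (p - 2) * (a \<bullet> a) = norm a powr p" for a :: "real \<times> real"
    proof (cases "a = 0")
      case False
      then show ?thesis using powr_add[of "norm a" "p - 2" 2] by (simp add: dot_square_norm)
    qed simp
    moreover have "\<bar>a\<bar> powr (p - 2) * a * a = \<bar>a\<bar> powr p" for a :: real
    proof (cases "a = 0")
      case False
      then show ?thesis using powr_add[of "\<bar>a\<bar>" "p - 2" 2] by (simp add: power2_eq_square)
    qed simp
    ultimately have "(LINT z|lebesgue_on ?D. norm (g z) powr p) = \<mu> * (LINT z|lebesgue_on ?D. \<bar>u z\<bar> powr p)"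
      using weak[OF sob] by simp
    then show "ereal (?A * (pi_p p / L) powr p) \<le> ereal \<mu>"
      using quotient[OF sob nz odd] positive[OF sob nz odd] by simp
  qed
  ultimately show ?thesis using pi_p_eq[OF assms(3)] by blast
qed

end
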